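(* Let $\mathrm{M}$ be a loopless matroid of rank $d$ on a finite set $E$, and let $i\in E$. If $i$ is not a coloop of $\mathrm{M}$, there is a direct sum decomposition of $\mathrm{CH}(\mathrm{M})$ into indecomposable graded $\mathrm{CH}(\mathrm{M}\setminus i)$-modules $$\mathrm{CH}(\mathrm{M}) = \mathrm{CH}_{(i)} \oplus \bigoplus_{F \in \mathscr{S}_i} x_{F\cup i}\, \mathrm{CH}_{(i)},$$ and all pairs of distinct summands are orthogonal for the Poincaré pairing of $\mathrm{CH}(\mathrm{M})$. If $i$ is a coloop of $\mathrm{M}$, there is a direct sum decomposition of $\mathrm{CH}(\mathrm{M})$ into indecomposable graded $\mathrm{CH}(\mathrm{M}\setminus i)$-modules $$\mathrm{CH}(\mathrm{M}) = \mathrm{CH}_{(i)} \oplus x_{E\setminus i}\,\mathrm{CH}_{(i)} \oplus \bigoplus_{F\in \mathscr{S}_i} x_{F\cup i}\, \mathrm{CH}_{(i)},$$ and all pairs of distinct summands except for the first two are orthogonal for the Poincaré pairing of $\mathrm{CH}(\mathrm{M})$.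
   Context: Matroids. A matroid $\mathrm{M}$ on a finite set $E$ is a nonempty collection of subsets of $E$, called flats, such that (1) the intersection of any two flats is a flat; (2) for any flat $F$, any element of $E\setminus F$ is contained in exactly one flat that is minimal among the flats strictly containing $F$. It is loopless if $\varnothing$ is a flat. $\mathscr{L}(\mathrm{M})$ is the lattice of flats; a flat is proper if it is not $E$. Every maximal flag (chain) of proper flats has the same cardinality $d$, the rank of $\mathrm{M}$. The deletion $\mathrm{M}\setminus i$ is the matroid on $E\setminus i$ whose flats are the sets $F\setminus i$ for flats $F$ of $\mathrm{M}$. The element $i$ is a coloop of $\mathrm{M}$ if the ranks of $\mathrm{M}$ and $\mathrm{M}\setminus i$ differ. We write $F\cup i$ for $F\cup\{i\}$ and $E\setminus i$ for $E\setminus\{i\}$. Augmented Chow ring. Let $S_\mathrm{M}=\mathbb{Q}[y_j\mid j\in E]\otimes\mathbb{Q}[x_F\mid F\text{ a proper flat of }\mathrm{M}]$ and $\mathrm{CH}(\mathrm{M})=S_\mathrm{M}/(I_\mathrm{M}+J_\mathrm{M})$ (graded with all variables in degree 1), where $I_\mathrm{M}$ is generated by $y_j-\sum_{j\notin F}x_F$ for $j\in E$ (sum over proper flats $F$ not containing $j$), and $J_\mathrm{M}$ is generated by $x_{F_1}x_{F_2}$ for all pairs of incomparable proper flats $F_1,F_2$ and by $y_jx_F$ for every $j\in E$ and every proper flat $F$ not containing $j$. There is a well-defined degree map, the linear isomorphism $\deg_\mathrm{M}:\mathrm{CH}^d(\mathrm{M})\to\mathbb{Q}$ with $\prod_{F\in\mathscr{F}}x_F\mapsto1$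 for every complete (maximal) flag $\mathscr{F}$ of proper flats. The Poincaré pairing is $\mathrm{CH}^k(\mathrm{M})\times\mathrm{CH}^{d-k}(\mathrm{M})\to\mathbb{Q}$, $(\eta_1,\eta_2)\mapsto\deg_\mathrm{M}(\eta_1\eta_2)$. Two graded subspaces are orthogonal if this pairing vanishes on all pairs of their elements of complementary degrees $k$ and $d-k$. Deletion. There is a graded algebra homomorphism $\theta_i:\mathrm{CH}(\mathrm{M}\setminus i)\to\mathrm{CH}(\mathrm{M})$, $x_F\mapsto x_F+x_{F\cup i}$, where a variable in the target is set to zero if its label is not a flat of $\mathrm{M}$ (this determines $\theta_i$, as the $y_j$ are linear combinations of the $x_F$). It makes $\mathrm{CH}(\mathrm{M})$ a graded $\mathrm{CH}(\mathrm{M}\setminus i)$-module. $\mathrm{CH}_{(i)}$ denotes the image of $\theta_i$, and $$\mathscr{S}_i=\{F\mid F\text{ is a proper subset of }E\setminus i\text{ such that }F\in\mathscr{L}(\mathrm{M})\text{ and }F\cup i\in\mathscr{L}(\mathrm{M})\}.$$ *)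

theory Defs
  imports Complex_Main "HOL-Library.Poly_Mapping" "HOL-Library.FuncSet" "HOL-Algebra.QuotRing" "HOL-Algebra.Module"
begin

section \<open>Matroids given by their flats\<close>

definition covering_flat :: "'a set set \<Rightarrow> 'a set \<Rightarrow> 'a set \<Rightarrow> bool" where
  "covering_flat L F G \<longleftrightarrow> G \<in> L \<and> F \<subset> G \<and> \<not> (\<exists>H\<in>L. F \<subset> H \<and> H \<subset> G)"

text \<open>The ground set is \<open>E\<close> and the collection of flats is \<open>L\<close>.\<close>

definition matroid :: "'a set \<Rightarrow> 'a set set \<Rightarrow> bool" where
  "matroid E L \<longleftrightarrow>
     finite E \<and> L \<noteq> {} \<and> L \<subseteq> Pow E \<and>
     (\<forall>F\<in>L. \<forall>G\<in>L. F \<inter> G \<in> L) \<and>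
     (\<forall>F\<in>L. \<forall>e\<in>E - F. \<exists>!G. covering_flat L F G \<and> e \<in> G)"

definition loopless :: "'a set set \<Rightarrow> bool" where
  "loopless L \<longleftrightarrow> {} \<in> L"

definition proper_flats :: "'a set \<Rightarrow> 'a set set \<Rightarrow> 'a set set" where
  "proper_flats E L = {F \<in> L. F \<noteq> E}"

definition proper_flag :: "'a set \<Rightarrow> 'a set set \<Rightarrow> 'a set set \<Rightarrow> bool" where
  "proper_flag E L C \<longleftrightarrow> C \<subseteq> proper_flats E L \<and> (\<forall>F\<in>C. \<forall>G\<in>C. F \<subseteq> G \<or> G \<subseteq> F)"

definition complete_flag :: "'a set \<Rightarrow> 'a set set \<Rightarrow> 'a set set \<Rightarrow> bool" where
  "complete_flag E L C \<longleftrightarrow>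
     proper_flag E L C \<and> (\<forall>D. proper_flag E L D \<longrightarrow> C \<subseteq> D \<longrightarrow> D = C)"

definition matroid_rank :: "'a set \<Rightarrow> 'a set set \<Rightarrow> nat" where
  "matroid_rank E L = (THE d. \<forall>C. complete_flag E L C \<longrightarrow> card C = d)"

text \<open>The flats of the deletion of \<open>i\<close>; its ground set is \<open>E - {i}\<close>.\<close>

definition deletion :: "'a set set \<Rightarrow> 'a \<Rightarrow> 'a set set" where
  "deletion L i = (\<lambda>F. F - {i}) ` L"

definition coloop :: "'a set \<Rightarrow> 'a set set \<Rightarrow> 'a \<Rightarrow> bool" where
  "coloop E L i \<longleftrightarrow> matroid_rank E L \<noteq> matroid_rank (E - {i}) (deletion L i)"

definition special_flats :: "'a set \<Rightarrow> 'a set set \<Rightarrow> 'a \<Rightarrow> 'a set set" where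
  "special_flats E L i = {F. F \<subset> E - {i} \<and> F \<in> L \<and> insert i F \<in> L}"


section \<open>The polynomial ring of a matroid\<close>

datatype 'a chow_var = Y 'a | X "'a set"

text \<open>Rational polynomials in all variables of type \<open>'a chow_var\<close>; the polynomial ring of a
  particular matroid is cut out as the polynomials that only involve its own variables.\<close>

type_synonym 'a chow_poly = "('a chow_var \<Rightarrow>\<^sub>0 nat) \<Rightarrow>\<^sub>0 rat"

definition poly_var :: "'a chow_var \<Rightarrow> 'a chow_poly" where
  "poly_var v = Poly_Mapping.single (Poly_Mapping.single v 1) 1"

definition poly_const :: "rat \<Rightarrow> 'a chow_poly" where
  "poly_const c = Poly_Mapping.single 0 c"

definition poly_vars :: "'a chow_poly \<Rightarrow> 'a chow_var set" where
  "poly_vars p = (\<Union>m\<in>Poly_Mapping.keys p. Poly_Mapping.keys m)"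

definition mono_deg :: "('a chow_var \<Rightarrow>\<^sub>0 nat) \<Rightarrow> nat" where
  "mono_deg m = (\<Sum>v\<in>Poly_Mapping.keys m. Poly_Mapping.lookup m v)"

definition homogeneous_poly :: "nat \<Rightarrow> 'a chow_poly \<Rightarrow> bool" where
  "homogeneous_poly k p \<longleftrightarrow> (\<forall>m\<in>Poly_Mapping.keys p. mono_deg m = k)"

definition chow_poly_ring :: "'a set \<Rightarrow> 'a set set \<Rightarrow> 'a chow_poly ring" where
  "chow_poly_ring E L =
     \<lparr>carrier = {p. poly_vars p \<subseteq> Y ` E \<union> X ` proper_flats E L},
      mult = (*), one = 1, zero = 0, add = (+)\<rparr>"


section \<open>The augmented Chow ring\<close>

definition chow_linear_ideal :: "'a set \<Rightarrow> 'a set set \<Rightarrow> 'a chow_poly set" where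
  "chow_linear_ideal E L =
     Idl\<^bsub>chow_poly_ring E L\<^esub>
       {poly_var (Y j) - (\<Sum>F\<in>{F \<in> proper_flats E L. j \<notin> F}. poly_var (X F)) | j. j \<in> E}"

definition chow_monomial_ideal :: "'a set \<Rightarrow> 'a set set \<Rightarrow> 'a chow_poly set" where
  "chow_monomial_ideal E L =
     Idl\<^bsub>chow_poly_ring E L\<^esub>
       ({poly_var (X F) * poly_var (X G) | F G.
           F \<in> proper_flats E L \<and> G \<in> proper_flats E L \<and> \<not> F \<subseteq> G \<and> \<not> G \<subseteq> F} \<union>
        {poly_var (Y j) * poly_var (X F) | j F. j \<in> E \<and> F \<in> proper_flats E L \<and> j \<notin> F})"

definition chow_ideal :: "'a set \<Rightarrow> 'a set set \<Rightarrow> 'a chow_poly set" where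
  "chow_ideal E L = chow_linear_ideal E L <+>\<^bsub>chow_poly_ring E L\<^esub> chow_monomial_ideal E L"

definition CH :: "'a set \<Rightarrow> 'a set set \<Rightarrow> 'a chow_poly set ring" where
  "CH E L = chow_poly_ring E L Quot chow_ideal E L"

definition chow_class :: "'a set \<Rightarrow> 'a set set \<Rightarrow> 'a chow_poly \<Rightarrow> 'a chow_poly set" where
  "chow_class E L p = chow_ideal E L +>\<^bsub>chow_poly_ring E L\<^esub> p"

definition chow_const :: "'a set \<Rightarrow> 'a set set \<Rightarrow> rat \<Rightarrow> 'a chow_poly set" where
  "chow_const E L c = chow_class E L (poly_const c)"

text \<open>The element \<open>x\<^sub>F\<close>, set to zero when the label is not a proper flat.\<close>

definition chow_x :: "'a set \<Rightarrow> 'a set set \<Rightarrow> 'a set \<Rightarrow> 'a chow_poly set" where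
  "chow_x E L F =
     (if F \<in> proper_flats E L then chow_class E L (poly_var (X F)) else \<zero>\<^bsub>CH E L\<^esub>)"

definition CH_deg :: "'a set \<Rightarrow> 'a set set \<Rightarrow> nat \<Rightarrow> 'a chow_poly set set" where
  "CH_deg E L k =
     chow_class E L ` {p \<in> carrier (chow_poly_ring E L). homogeneous_poly k p}"

text \<open>Degree maps and the homomorphism from the Chow ring of the deletion are required to be
  extensional, that is, to have the default value outside of their domain: the characterizing
  properties then determine a unique HOL function, which is named by a definite description.
  The rational numbers act on the Chow ring through multiplication by the classes of constants.\<close>

definition is_degree_map :: "'a set \<Rightarrow> 'a set set \<Rightarrow> ('a chow_poly set \<Rightarrow> rat) \<Rightarrow> bool" where
  "is_degree_map E L \<phi> \<longleftrightarrow>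
     (let T = CH_deg E L (matroid_rank E L) in
       \<phi> \<in> extensional T \<and>
       (\<forall>\<eta>\<in>T. \<forall>\<xi>\<in>T. \<phi> (\<eta> \<oplus>\<^bsub>CH E L\<^esub> \<xi>) = \<phi> \<eta> + \<phi> \<xi>) \<and>
       (\<forall>c. \<forall>\<eta>\<in>T. \<phi> (chow_const E L c \<otimes>\<^bsub>CH E L\<^esub> \<eta>) = c * \<phi> \<eta>) \<and>
       bij_betw \<phi> T UNIV \<and>
       (\<forall>C. complete_flag E L C \<longrightarrow> \<phi> (\<Otimes>\<^bsub>CH E L\<^esub>F\<in>C. chow_x E L F) = 1))"

definition degree_map :: "'a set \<Rightarrow> 'a set set \<Rightarrow> 'a chow_poly set \<Rightarrow> rat" where
  "degree_map E L = (THE \<phi>. is_degree_map E L \<phi>)"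

definition poincare_orthogonal ::
  "'a set \<Rightarrow> 'a set set \<Rightarrow> 'a chow_poly set set \<Rightarrow> 'a chow_poly set set \<Rightarrow> bool" where
  "poincare_orthogonal E L A B \<longleftrightarrow>
     (\<forall>k \<le> matroid_rank E L.
        \<forall>\<eta>\<in>A \<inter> CH_deg E L k. \<forall>\<xi>\<in>B \<inter> CH_deg E L (matroid_rank E L - k).
          degree_map E L (\<eta> \<otimes>\<^bsub>CH E L\<^esub> \<xi>) = 0)"


section \<open>The module structure over the augmented Chow ring of the deletion\<close>

definition is_theta ::
  "'a set \<Rightarrow> 'a set set \<Rightarrow> 'a \<Rightarrow> ('a chow_poly set \<Rightarrow> 'a chow_poly set) \<Rightarrow> bool" where
  "is_theta E L i h \<longleftrightarrow>
     (let E' = E - {i}; L' = deletion L i in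
       h \<in> ring_hom (CH E' L') (CH E L) \<and>
       h \<in> extensional (carrier (CH E' L')) \<and>
       (\<forall>c. h (chow_const E' L' c) = chow_const E L c) \<and>
       (\<forall>k. h ` CH_deg E' L' k \<subseteq> CH_deg E L k) \<and>
       (\<forall>F\<in>proper_flats E' L'.
          h (chow_x E' L' F) = chow_x E L F \<oplus>\<^bsub>CH E L\<^esub> chow_x E L (insert i F)))"

definition theta :: "'a set \<Rightarrow> 'a set set \<Rightarrow> 'a \<Rightarrow> 'a chow_poly set \<Rightarrow> 'a chow_poly set" where
  "theta E L i = (THE h. is_theta E L i h)"

definition CH_image :: "'a set \<Rightarrow> 'a set set \<Rightarrow> 'a \<Rightarrow> 'a chow_poly set set" where
  "CH_image E L i = theta E L i ` carrier (CH (E - {i}) (deletion L i))"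

definition CH_module ::
  "'a set \<Rightarrow> 'a set set \<Rightarrow> 'a \<Rightarrow> ('a chow_poly set, 'a chow_poly set) module" where
  "CH_module E L i =
     ring.extend (CH E L) \<lparr>smult = (\<lambda>\<alpha> \<eta>. theta E L i \<alpha> \<otimes>\<^bsub>CH E L\<^esub> \<eta>)\<rparr>"

definition graded_submodule :: "'a set \<Rightarrow> 'a set set \<Rightarrow> 'a \<Rightarrow> 'a chow_poly set set \<Rightarrow> bool" where
  "graded_submodule E L i N \<longleftrightarrow>
     submodule N (CH (E - {i}) (deletion L i)) (CH_module E L i) \<and>
     (\<forall>\<eta>\<in>N. \<exists>n g. (\<forall>k\<le>n. g k \<in> N \<inter> CH_deg E L k) \<and>
        \<eta> = (\<Oplus>\<^bsub>CH E L\<^esub>k\<in>{..n::nat}. g k))"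

definition internal_direct_sum ::
  "('b, 'm) ring_scheme \<Rightarrow> 'b set \<Rightarrow> 's set \<Rightarrow> ('s \<Rightarrow> 'b set) \<Rightarrow> bool" where
  "internal_direct_sum R N I A \<longleftrightarrow>
     finite I \<and> (\<forall>s\<in>I. A s \<subseteq> N) \<and>
     (\<forall>\<eta>\<in>N. \<exists>!g. g \<in> (\<Pi>\<^sub>E s\<in>I. A s) \<and> \<eta> = (\<Oplus>\<^bsub>R\<^esub>s\<in>I. g s))"

definition indecomposable_graded_submodule ::
  "'a set \<Rightarrow> 'a set set \<Rightarrow> 'a \<Rightarrow> 'a chow_poly set set \<Rightarrow> bool" where
  "indecomposable_graded_submodule E L i N \<longleftrightarrow>
     graded_submodule E L i N \<and> N \<noteq> {\<zero>\<^bsub>CH E L\<^esub>} \<and>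
     (\<forall>A B. graded_submodule E L i A \<longrightarrow> graded_submodule E L i B \<longrightarrow>
        A <+>\<^bsub>CH E L\<^esub> B = N \<longrightarrow> A \<inter> B = {\<zero>\<^bsub>CH E L\<^esub>} \<longrightarrow>
        A = {\<zero>\<^bsub>CH E L\<^esub>} \<or> B = {\<zero>\<^bsub>CH E L\<^esub>})"

text \<open>The decomposition is a family indexed by formal labels, so that summands with different labels
  count as distinct summands.\<close>

datatype 'a summand_label = Image_Summand | Coloop_Summand | Flat_Summand "'a set"

primrec summand ::
  "'a set \<Rightarrow> 'a set set \<Rightarrow> 'a \<Rightarrow> 'a summand_label \<Rightarrow> 'a chow_poly set set" where
  "summand E L i Image_Summand = CH_image E L i"
| "summand E L i Coloop_Summand = chow_x E L (E - {i}) <#\<^bsub>CH E L\<^esub> CH_image E L i"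
| "summand E L i (Flat_Summand F) = chow_x E L (insert i F) <#\<^bsub>CH E L\<^esub> CH_image E L i"

end

theory Submission
  imports Defs "HOL-Computational_Algebra.Polynomial"
begin

text \<open>Set \<open>x\<^sub>E = - \<Sum> x\<^sub>F\<close>, the sum running over the proper flats. For every flat \<open>F\<close> avoiding \<open>i\<close>
  such that \<open>F \<union> i\<close> is a flat, including \<open>F = E - i\<close> when \<open>i\<close> is a coloop, put \<open>e\<^sub>F = x\<^bsub>F \<union> i\<^esub>\<close>.

  Modulo the Chow relations a product \<open>e\<^sub>F e\<^sub>G\<close> is a linear combination of \<open>1\<close> and the elements
  \<open>e\<^sub>H\<close> over the image of \<open>\<theta>\<close>, so these elements generate the Chow ring as a module. For their
  independence, adjoin the \<open>e\<^sub>F\<close> to the Chow ring of the deletion one at a time, beginning with the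
  largest flats: each is a root of a quadratic polynomial \<open>t\<^sup>2 - p t - q\<close> and is annihilated by an
  ideal \<open>K\<close> with \<open>K q = 0\<close>, so that the extension of a ring \<open>R\<close> is \<open>R \<oplus> (R / K) t\<close>. The Chow ring
  of the matroid maps to the last ring of this tower. Poincare duality is not used.

  Every element is a combination of squarefree flag monomials. Counting the lengths of flags shows
  that \<open>e\<^sub>F\<close> times the image of \<open>\<theta>\<close> vanishes in top degree for \<open>F \<noteq> E - i\<close>. This gives the
  orthogonality, and also the existence of the degree map by induction on the ground set, because
  the top degree comes from the deletion. The summands are cyclic modules over a connected graded
  ring, hence indecomposable.\<close>

section \<open>Evaluating polynomials\<close>

text \<open>The class \<open>x_E\<close> is chosen so that the flats of a matroid sum to zero. As
  this holds for the deletion too, \<open>\<theta>\<close> sends \<open>x_G\<close> to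
  \<open>x_G + e_G\<close> for every flat \<open>G\<close> of the deletion, the ground set included,
  and \<open>e_F\<close> makes sense for \<open>F = E - i\<close>, where it replaces the generator
  of the coloop summand. The quadratic equation of \<open>e_F\<close> is \<open>x_F y_i = 0\<close>
  with \<open>y_i\<close> expanded over the flats avoiding \<open>i\<close>; its constant term
  contains \<open>e_H\<close> for larger flats \<open>H\<close>, which forces the tower to start at
  the top. The obstacle is the condition \<open>K q = 0\<close> at each stage. It is met because
  relations of the same shape are already available there: from the quadratic equation of a larger
  flat or, where adding \<open>i\<close> to a flat gives no flat, from an element \<open>j\<close>
  parallel to \<open>i\<close>, whose relation lives in the deletion. All computations take place in
  one polynomial ring with every possible variable, foreign variables being killed, so that
  substitutions are total functions.\<close>

lemma poly_mapping_induct_single [case_names zero single add]: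
  fixes p :: "'k \<Rightarrow>\<^sub>0 'b::comm_monoid_add"
  assumes "Q 0" "\<And>m c. Q (Poly_Mapping.single m c)" "\<And>p q. Q p \<Longrightarrow> Q q \<Longrightarrow> Q (p + q)"
  shows "Q p"
proof (induction p rule: update_induct)
  case const
  show ?case using assms(1) by simp
next
  case (update f a b)
  have "Poly_Mapping.update a b f = f + Poly_Mapping.single a b"
    using update(1) by (intro poly_mapping_eqI)
      (auto simp: lookup_update lookup_add lookup_single not_in_keys_iff_lookup_eq_zero when_def)
  then show ?case using assms update by simp
qed

definition mono_eval :: "('v \<Rightarrow> 'b::comm_ring_1) \<Rightarrow> ('v \<Rightarrow>\<^sub>0 nat) \<Rightarrow> 'b" where
  "mono_eval s m = (\<Prod>v\<in>Poly_Mapping.keys m. s v ^ Poly_Mapping.lookup m v)"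

text \<open>A single substitution operator: \<open>grade\<close>, \<open>isolate_var\<close>,
  \<open>\<theta>\<close>, \<open>forget\<close>, \<open>lift\<close> and \<open>restr\<close> are
  all instances, so that they are ring homomorphisms is proved once. The scalar map varies because
  the target is a polynomial ring, a univariate ring over it, or the rationals.\<close>

definition poly_eval ::
  "(rat \<Rightarrow> 'b::comm_ring_1) \<Rightarrow> ('a chow_var \<Rightarrow> 'b) \<Rightarrow> 'a chow_poly \<Rightarrow> 'b" where
  "poly_eval \<iota> s p = (\<Sum>m\<in>Poly_Mapping.keys p. \<iota> (Poly_Mapping.lookup p m) * mono_eval s m)"

definition scalar_hom :: "(rat \<Rightarrow> 'b::comm_ring_1) \<Rightarrow> bool" where
  "scalar_hom \<iota> \<longleftrightarrow> \<iota> 1 = 1 \<and> (\<forall>a b. \<iota> (a + b) = \<iota> a + \<iota> b) \<and> (\<forall>a b. \<iota> (a * b) = \<iota> a * \<iota> b)"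

lemma scalar_homD:
  assumes "scalar_hom \<iota>"
  shows "\<iota> 1 = 1" "\<iota> (a + b) = \<iota> a + \<iota> b" "\<iota> (a * b) = \<iota> a * \<iota> b" "\<iota> 0 = 0"
proof -
  show "\<iota> 1 = 1" "\<iota> (a + b) = \<iota> a + \<iota> b" "\<iota> (a * b) = \<iota> a * \<iota> b"
    using assms by (auto simp: scalar_hom_def)
  have "\<iota> (0 + 0) = \<iota> 0 + \<iota> 0"
    using assms unfolding scalar_hom_def by blast
  then show "\<iota> 0 = 0" by simp
qed

lemma mono_eval_superset:
  assumes "finite V" "Poly_Mapping.keys m \<subseteq> V"
  shows "mono_eval s m = (\<Prod>v\<in>V. s v ^ Poly_Mapping.lookup m v)"
  unfolding mono_eval_def using assms
  by (intro prod.mono_neutral_left) (auto simp: in_keys_iff)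

lemma mono_eval_0 [simp]: "mono_eval s 0 = 1"
  by (simp add: mono_eval_def)

lemma mono_eval_single: "mono_eval s (Poly_Mapping.single v k) = s v ^ k"
  by (simp add: mono_eval_def)

lemma mono_eval_add: "mono_eval s (m + n) = mono_eval s m * mono_eval s n"
proof -
  let ?V = "Poly_Mapping.keys m \<union> Poly_Mapping.keys n"
  have "mono_eval s (m + n) = (\<Prod>v\<in>?V. s v ^ Poly_Mapping.lookup (m + n) v)"
    using keys_add[of m n] by (intro mono_eval_superset) auto
  also have "\<dots> = (\<Prod>v\<in>?V. s v ^ Poly_Mapping.lookup m v) * (\<Prod>v\<in>?V. s v ^ Poly_Mapping.lookup n v)"
    by (simp add: lookup_add power_add prod.distrib)
  also have "\<dots> = mono_eval s m * mono_eval s n"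
    by (simp add: mono_eval_superset[of ?V])
  finally show ?thesis .
qed

context
  fixes \<iota> :: "rat \<Rightarrow> 'b::comm_ring_1"
  assumes \<iota>: "scalar_hom \<iota>"
begin

lemma poly_eval_superset:
  assumes "finite K" "Poly_Mapping.keys p \<subseteq> K"
  shows "poly_eval \<iota> s p = (\<Sum>m\<in>K. \<iota> (Poly_Mapping.lookup p m) * mono_eval s m)"
  unfolding poly_eval_def using assms
  by (intro sum.mono_neutral_left) (auto simp: in_keys_iff scalar_homD(4)[OF \<iota>])

lemma poly_eval_0: "poly_eval \<iota> s 0 = 0"
  by (simp add: poly_eval_def)

lemma poly_eval_add: "poly_eval \<iota> s (p + q) = poly_eval \<iota> s p + poly_eval \<iota> s q"
proof -
  let ?K = "Poly_Mapping.keys p \<union> Poly_Mapping.keys q"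
  have "poly_eval \<iota> s (p + q) = (\<Sum>m\<in>?K. \<iota> (Poly_Mapping.lookup (p + q) m) * mono_eval s m)"
    using keys_add[of p q] by (intro poly_eval_superset) auto
  also have "\<dots> = poly_eval \<iota> s p + poly_eval \<iota> s q"
    by (simp add: poly_eval_superset[of ?K] lookup_add scalar_homD(2)[OF \<iota>] distrib_right sum.distrib)
  finally show ?thesis .
qed

lemma poly_eval_single: "poly_eval \<iota> s (Poly_Mapping.single m c) = \<iota> c * mono_eval s m"
  by (subst poly_eval_superset[of "{m}"]) auto

lemma poly_eval_mult: "poly_eval \<iota> s (p * q) = poly_eval \<iota> s p * poly_eval \<iota> s q"
proof (induction p rule: poly_mapping_induct_single)
  case (single m c)
  show ?case
  proof (induction q rule: poly_mapping_induct_single)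
    case (single n d)
    show ?case
      by (simp add: mult_single poly_eval_single mono_eval_add scalar_homD(3)[OF \<iota>] mult_ac)
  qed (simp_all add: poly_eval_0 poly_eval_add distrib_left)
qed (simp_all add: poly_eval_0 poly_eval_add distrib_right)

lemma poly_eval_const: "poly_eval \<iota> s (poly_const c) = \<iota> c"
  by (simp add: poly_const_def poly_eval_single)

lemma poly_eval_1: "poly_eval \<iota> s 1 = 1"
  using poly_eval_const[of s 1] by (simp add: poly_const_def scalar_homD(1)[OF \<iota>])

lemma poly_eval_var: "poly_eval \<iota> s (poly_var v) = s v"
  by (simp add: poly_var_def poly_eval_single mono_eval_single scalar_homD(1)[OF \<iota>])

lemma poly_eval_uminus: "poly_eval \<iota> s (- p) = - poly_eval \<iota> s p"
  using poly_eval_add[of s p "- p"] by (simp add: poly_eval_0 minus_unique)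

lemma poly_eval_diff: "poly_eval \<iota> s (p - q) = poly_eval \<iota> s p - poly_eval \<iota> s q"
  using poly_eval_add[of s p "- q"] by (simp add: poly_eval_uminus)

lemma poly_eval_sum: "poly_eval \<iota> s (\<Sum>x\<in>I. f x) = (\<Sum>x\<in>I. poly_eval \<iota> s (f x))"
  by (induction I rule: infinite_finite_induct) (auto simp: poly_eval_0 poly_eval_add)

lemma poly_eval_prod: "poly_eval \<iota> s (\<Prod>x\<in>I. f x) = (\<Prod>x\<in>I. poly_eval \<iota> s (f x))"
  by (induction I rule: infinite_finite_induct) (auto simp: poly_eval_1 poly_eval_mult)

lemma poly_eval_power: "poly_eval \<iota> s (p ^ n) = poly_eval \<iota> s p ^ n"
  by (induction n) (auto simp: poly_eval_1 poly_eval_mult)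

lemmas poly_eval_simps = poly_eval_0 poly_eval_1 poly_eval_add poly_eval_mult poly_eval_const
  poly_eval_var poly_eval_uminus poly_eval_diff poly_eval_sum poly_eval_prod poly_eval_power

end

lemma poly_const_0 [simp]: "poly_const 0 = 0"
  and poly_const_1 [simp]: "poly_const 1 = 1"
  and poly_const_add: "poly_const (a + b) = poly_const a + poly_const b"
  and poly_const_mult: "poly_const (a * b) = poly_const a * poly_const b"
  by (simp_all add: poly_const_def single_add mult_single)

lemma poly_const_uminus: "poly_const (- a) = - poly_const a"
  by (simp add: poly_const_def single_uminus)

lemma scalar_hom_const: "scalar_hom poly_const"
  by (simp add: scalar_hom_def poly_const_add poly_const_mult)

lemma scalar_hom_const_poly: "scalar_hom (\<lambda>c. [:poly_const c:])"
  by (simp add: scalar_hom_def poly_const_add poly_const_mult one_pCons)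

lemma scalar_hom_id: "scalar_hom (\<lambda>c. c)"
  by (simp add: scalar_hom_def)

lemma single_mono_eval: "Poly_Mapping.single m c = poly_const c * mono_eval poly_var m"
proof -
  have *: "Poly_Mapping.single m 1 = mono_eval poly_var m" for m :: "'a chow_var \<Rightarrow>\<^sub>0 nat"
  proof (induction m rule: poly_mapping_induct_single)
    case (single v k)
    show ?case
    proof (induction k)
      case (Suc k)
      have "Poly_Mapping.single (Poly_Mapping.single v (Suc k)) (1::rat) =
        Poly_Mapping.single (Poly_Mapping.single v 1) 1 * Poly_Mapping.single (Poly_Mapping.single v k) 1"
        by (simp add: mult_single flip: single_add)
      with Suc show ?case by (simp add: mono_eval_single poly_var_def)
    qed simp
  next
    case (add p q)
    have "Poly_Mapping.single (p + q) (1::rat) = Poly_Mapping.single p 1 * Poly_Mapping.single q 1"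
      by (simp add: mult_single)
    then show ?case by (simp add: add mono_eval_add)
  qed simp
  show ?thesis by (simp flip: * add: poly_const_def mult_single)
qed

lemma poly_vars_0 [simp]: "poly_vars 0 = {}"
  by (simp add: poly_vars_def)

lemma poly_vars_const [simp]: "poly_vars (poly_const c) = {}"
  by (auto simp: poly_vars_def poly_const_def)

lemma poly_vars_1 [simp]: "poly_vars 1 = {}"
  using poly_vars_const[of 1] by (simp del: poly_vars_const)

lemma poly_vars_var [simp]: "poly_vars (poly_var v) = {v}"
  by (auto simp: poly_vars_def poly_var_def)

lemma poly_vars_add: "poly_vars (p + q) \<subseteq> poly_vars p \<union> poly_vars q"
  using keys_add[of p q] by (auto simp: poly_vars_def)

lemma poly_vars_uminus [simp]: "poly_vars (- p) = poly_vars p"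
  by (simp add: poly_vars_def in_keys_iff)

lemma poly_vars_diff: "poly_vars (p - q) \<subseteq> poly_vars p \<union> poly_vars q"
  using poly_vars_add[of p "- q"] by simp

lemma poly_vars_mult: "poly_vars (p * q) \<subseteq> poly_vars p \<union> poly_vars q"
proof
  fix v assume "v \<in> poly_vars (p * q)"
  then obtain m where m: "m \<in> Poly_Mapping.keys (p * q)" "v \<in> Poly_Mapping.keys m"
    by (auto simp: poly_vars_def)
  from m(1) keys_mult[of p q] obtain a b
    where ab: "a \<in> Poly_Mapping.keys p" "b \<in> Poly_Mapping.keys q" "m = a + b" by blast
  with m(2) keys_add[of a b] show "v \<in> poly_vars p \<union> poly_vars q"
    by (auto simp: poly_vars_def)
qed

lemma poly_vars_sum: "poly_vars (\<Sum>x\<in>I. f x) \<subseteq> (\<Union>x\<in>I. poly_vars (f x))"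
proof (induction I rule: infinite_finite_induct)
  case (insert x F)
  then show ?case using poly_vars_add[of "f x" "sum f F"] by auto
qed auto

lemma poly_vars_subsetI:
  "poly_vars p \<subseteq> V \<Longrightarrow> poly_vars q \<subseteq> V \<Longrightarrow> poly_vars (p + q) \<subseteq> V"
  "poly_vars p \<subseteq> V \<Longrightarrow> poly_vars q \<subseteq> V \<Longrightarrow> poly_vars (p - q) \<subseteq> V"
  "poly_vars p \<subseteq> V \<Longrightarrow> poly_vars q \<subseteq> V \<Longrightarrow> poly_vars (p * q) \<subseteq> V"
  "poly_vars p \<subseteq> V \<Longrightarrow> poly_vars (- p) \<subseteq> V"
  using poly_vars_add[of p q] poly_vars_diff[of p q] poly_vars_mult[of p q] by auto

lemma poly_vars_sum_subsetI: "(\<And>x. x \<in> I \<Longrightarrow> poly_vars (f x) \<subseteq> V) \<Longrightarrow> poly_vars (\<Sum>x\<in>I. f x) \<subseteq> V"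
  using poly_vars_sum[of f I] by blast

text \<open>Expanding into monomials reduces every polynomial to constants and variables. Properties
  compatible with sums and products, such as the agreement of two homomorphisms, are then checked on
  variables.\<close>

lemma poly_vars_induct [consumes 1, case_names const var add mult]:
  assumes "poly_vars p \<subseteq> V"
    and const: "\<And>c. Q (poly_const c)" and var: "\<And>v. v \<in> V \<Longrightarrow> Q (poly_var v)"
    and add: "\<And>p q. Q p \<Longrightarrow> Q q \<Longrightarrow> Q (p + q)" and mult: "\<And>p q. Q p \<Longrightarrow> Q q \<Longrightarrow> Q (p * q)"
  shows "Q p"
proof -
  have 1: "Q 1" using const[of 1] by simp
  have 0: "Q 0" using const[of 0] by simp
  have pow: "Q (x ^ n)" if "Q x" for x and n :: nat
    by (induction n) (auto simp: 1 intro: mult that)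
  have prod: "Q (\<Prod>i\<in>I. f i)" if "\<And>i. i \<in> I \<Longrightarrow> Q (f i)" for I and f :: "'a chow_var \<Rightarrow> 'a chow_poly"
    using that by (induction I rule: infinite_finite_induct) (auto simp: 1 intro: mult)
  have sum: "Q (\<Sum>i\<in>I. f i)" if "\<And>i. i \<in> I \<Longrightarrow> Q (f i)" for I and f :: "_ \<Rightarrow> 'a chow_poly"
    using that by (induction I rule: infinite_finite_induct) (auto simp: 0 intro: add)
  have "p = (\<Sum>m\<in>Poly_Mapping.keys p. Poly_Mapping.single m (Poly_Mapping.lookup p m))"
    by (rule poly_mapping_eqI) (simp add: lookup_sum lookup_single when_def in_keys_iff)
  also have "Q \<dots>"
    unfolding single_mono_eval mono_eval_def
    using assms(1) by (intro sum mult const prod pow var) (auto simp: poly_vars_def)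
  finally show ?thesis .
qed

lemmas poly_induct_vars = poly_vars_induct[OF subset_UNIV, simplified, case_names const var add mult]

section \<open>Ideals generated by a set\<close>

text \<open>An ideal of a type-class ring, without a carrier set, so that ring normalisation
  applies; rule induction reduces statements about all members to the generators.\<close>

inductive_set idl :: "'b::comm_ring_1 set \<Rightarrow> 'b set" for S where
  idl_0: "0 \<in> idl S"
| idl_gen: "g \<in> S \<Longrightarrow> g \<in> idl S"
| idl_add: "p \<in> idl S \<Longrightarrow> q \<in> idl S \<Longrightarrow> p + q \<in> idl S"
| idl_mult: "p \<in> idl S \<Longrightarrow> r * p \<in> idl S"

lemma idl_mult_right: "p \<in> idl S \<Longrightarrow> p * r \<in> idl S"
  using idl_mult[of p S r] by (simp add: mult.commute)

lemma idl_uminus: "p \<in> idl S \<Longrightarrow> - p \<in> idl S"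
  using idl_mult[of p S "-1"] by simp

lemma idl_diff: "p \<in> idl S \<Longrightarrow> q \<in> idl S \<Longrightarrow> p - q \<in> idl S"
  using idl_add[of p S "- q"] idl_uminus[of q S] by simp

lemma idl_sum: "(\<And>x. x \<in> I \<Longrightarrow> f x \<in> idl S) \<Longrightarrow> (\<Sum>x\<in>I. f x) \<in> idl S"
  by (induction I rule: infinite_finite_induct) (auto intro: idl.intros)

lemma idl_subset:
  assumes "p \<in> idl S" "S \<subseteq> idl T"
  shows "p \<in> idl T"
  using assms(1) by induction (use assms(2) in \<open>auto intro: idl.intros\<close>)

lemma idl_mono: "S \<subseteq> T \<Longrightarrow> idl S \<subseteq> idl T"
  by (auto intro: idl_subset idl_gen)

text \<open>The means by which \<open>\<theta>\<close>, \<open>lift\<close> and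
  \<open>forget\<close> are shown to respect relations: a map compatible with sums and products is
  tested on generators.\<close>

lemma idl_hom_image:
  assumes "p \<in> idl S"
    and "h 0 = 0" "\<And>p q. h (p + q) = h p + h q" "\<And>p q. h (p * q) = h p * h q"
    and "\<And>g. g \<in> S \<Longrightarrow> h g \<in> idl T"
  shows "h p \<in> idl T"
  using assms(1) by induction (auto simp: assms(2-4) intro: idl.intros assms(5))

lemma idl_cong_trans: "p - q \<in> idl S \<Longrightarrow> q - r \<in> idl S \<Longrightarrow> p - r \<in> idl S"
  using idl_add[of "p - q" S "q - r"] by simp

lemma idl_cong_sym: "p - q \<in> idl S \<Longrightarrow> q - p \<in> idl S"
  using idl_uminus[of "p - q" S] by simp

lemma idl_cong_add: "p - q \<in> idl S \<Longrightarrow> p' - q' \<in> idl S \<Longrightarrow> (p + p') - (q + q') \<in> idl S"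
  using idl_add[of "p - q" S "p' - q'"] by (simp add: algebra_simps)

lemma idl_cong_mult: "p - q \<in> idl S \<Longrightarrow> p' - q' \<in> idl S \<Longrightarrow> p * p' - q * q' \<in> idl S"
  using idl_add[OF idl_mult[of "p' - q'" S p] idl_mult[of "p - q" S q']]
  by (simp add: algebra_simps)

lemma idl_cong_mem: "p - q \<in> idl S \<Longrightarrow> q \<in> idl S \<Longrightarrow> p \<in> idl S"
  using idl_add[of "p - q" S q] by simp

section \<open>Homogeneous components\<close>

text \<open>Every variable is multiplied by a formal parameter whose exponent records the degree.
  Since this map is multiplicative, the grading rules become polynomial arithmetic.\<close>

definition grade :: "'a chow_poly \<Rightarrow> 'a chow_poly poly" where
  "grade = poly_eval (\<lambda>c. [:poly_const c:]) (\<lambda>v. [:0, poly_var v:])"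

definition hcomp :: "nat \<Rightarrow> 'a chow_poly \<Rightarrow> 'a chow_poly" where
  "hcomp k p = coeff (grade p) k"

lemmas grade_simps = poly_eval_simps[OF scalar_hom_const_poly, of "\<lambda>v. [:0, poly_var v:]", folded grade_def]

lemma mono_deg_superset:
  assumes "finite V" "Poly_Mapping.keys m \<subseteq> V"
  shows "mono_deg m = (\<Sum>v\<in>V. Poly_Mapping.lookup m v)"
  unfolding mono_deg_def using assms by (intro sum.mono_neutral_left) (auto simp: in_keys_iff)

lemma mono_deg_add: "mono_deg (m + n) = mono_deg m + mono_deg n"
proof -
  let ?V = "Poly_Mapping.keys m \<union> Poly_Mapping.keys n"
  have "mono_deg (m + n) = (\<Sum>v\<in>?V. Poly_Mapping.lookup (m + n) v)"
    using keys_add[of m n] by (intro mono_deg_superset) auto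
  also have "\<dots> = mono_deg m + mono_deg n"
    by (simp add: mono_deg_superset[of ?V] lookup_add sum.distrib)
  finally show ?thesis .
qed

lemma grade_single: "grade (Poly_Mapping.single m c) = monom (Poly_Mapping.single m c) (mono_deg m)"
proof -
  have *: "mono_eval (\<lambda>v. [:0, poly_var v:]) m = monom (mono_eval poly_var m) (mono_deg m)"
    for m :: "'a chow_var \<Rightarrow>\<^sub>0 nat"
  proof (induction m rule: poly_mapping_induct_single)
    case zero
    show ?case by (simp add: mono_deg_def one_pCons monom_0)
  next
    case (single v k)
    have "[:0, poly_var v:] = monom (poly_var v) 1" by (simp add: monom_altdef)
    then show ?case by (simp add: mono_eval_single mono_deg_def monom_power)
  next
    case (add p q)
    then show ?case by (simp add: mono_eval_add mono_deg_add mult_monom)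
  qed
  have "grade (Poly_Mapping.single m c) = [:poly_const c:] * monom (mono_eval poly_var m) (mono_deg m)"
    by (simp add: grade_def poly_eval_single[OF scalar_hom_const_poly] *)
  also have "\<dots> = monom (poly_const c * mono_eval poly_var m) (mono_deg m)"
    by (simp add: smult_monom)
  finally show ?thesis by (simp add: single_mono_eval)
qed

lemma poly_mapping_sum_single:
  fixes p :: "'k \<Rightarrow>\<^sub>0 'b::comm_monoid_add"
  shows "p = (\<Sum>m\<in>Poly_Mapping.keys p. Poly_Mapping.single m (Poly_Mapping.lookup p m))"
  by (rule poly_mapping_eqI) (simp add: lookup_sum lookup_single when_def in_keys_iff)

lemma hcomp_single: "hcomp k (Poly_Mapping.single m c) = (if mono_deg m = k then Poly_Mapping.single m c else 0)"
  by (simp add: hcomp_def grade_single)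

lemma hcomp_0 [simp]: "hcomp k 0 = 0"
  by (simp add: hcomp_def grade_simps)

lemma hcomp_add: "hcomp k (p + q) = hcomp k p + hcomp k q"
  by (simp add: hcomp_def grade_simps)

lemma hcomp_diff: "hcomp k (p - q) = hcomp k p - hcomp k q"
  by (simp add: hcomp_def grade_simps)

lemma hcomp_sum: "hcomp k (\<Sum>x\<in>I. f x) = (\<Sum>x\<in>I. hcomp k (f x))"
  by (simp add: hcomp_def grade_simps coeff_sum)

lemma lookup_hcomp: "Poly_Mapping.lookup (hcomp k p) m = (if mono_deg m = k then Poly_Mapping.lookup p m else 0)"
  by (induction p rule: poly_mapping_induct_single)
    (auto simp: hcomp_single hcomp_add lookup_single lookup_add when_def)

lemma homogeneous_poly_hcomp [simp]: "homogeneous_poly k (hcomp k p)"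
  by (auto simp: homogeneous_poly_def in_keys_iff lookup_hcomp split: if_splits)

lemma hcomp_homogeneous: "homogeneous_poly k p \<Longrightarrow> hcomp j p = (if j = k then p else 0)"
  by (rule poly_mapping_eqI) (auto simp: lookup_hcomp homogeneous_poly_def in_keys_iff)

lemma homogeneous_poly_iff: "homogeneous_poly k p \<longleftrightarrow> hcomp k p = p"
  using homogeneous_poly_hcomp[of k p] hcomp_homogeneous[of k p k] by metis

lemma grade_homogeneous: "homogeneous_poly k p \<Longrightarrow> grade p = monom p k"
  by (rule poly_eqI) (simp add: hcomp_homogeneous flip: hcomp_def)

lemma homogeneous_polyI_grade: "grade p = monom p k \<Longrightarrow> homogeneous_poly k p"
  by (simp add: homogeneous_poly_iff hcomp_def)

lemma homogeneous_poly_mult: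
  "homogeneous_poly k p \<Longrightarrow> homogeneous_poly l q \<Longrightarrow> homogeneous_poly (k + l) (p * q)"
  by (intro homogeneous_polyI_grade) (simp add: grade_simps grade_homogeneous mult_monom)

lemma homogeneous_poly_0 [simp]: "homogeneous_poly k 0"
  by (simp add: homogeneous_poly_def)

lemma homogeneous_poly_const [simp]: "homogeneous_poly 0 (poly_const c)"
  by (intro homogeneous_polyI_grade) (simp add: grade_simps monom_0)

lemma homogeneous_poly_1 [simp]: "homogeneous_poly 0 1"
  using homogeneous_poly_const[of 1] by simp

lemma homogeneous_poly_var [simp]: "homogeneous_poly (Suc 0) (poly_var v)"
  by (intro homogeneous_polyI_grade) (simp add: grade_simps monom_altdef)

lemma homogeneous_poly_add:
  "homogeneous_poly k p \<Longrightarrow> homogeneous_poly k q \<Longrightarrow> homogeneous_poly k (p + q)"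
  by (simp add: homogeneous_poly_iff hcomp_add)

lemma homogeneous_poly_diff:
  "homogeneous_poly k p \<Longrightarrow> homogeneous_poly k q \<Longrightarrow> homogeneous_poly k (p - q)"
  by (simp add: homogeneous_poly_iff hcomp_diff)

lemma homogeneous_poly_uminus: "homogeneous_poly k p \<Longrightarrow> homogeneous_poly k (- p)"
  using homogeneous_poly_diff[of k 0 p] by simp

lemma homogeneous_poly_sum:
  "(\<And>x. x \<in> I \<Longrightarrow> homogeneous_poly k (f x)) \<Longrightarrow> homogeneous_poly k (\<Sum>x\<in>I. f x)"
  by (simp add: homogeneous_poly_iff hcomp_sum)

lemma homogeneous_poly_power:
  "homogeneous_poly k p \<Longrightarrow> homogeneous_poly (n * k) (p ^ n)"
  by (induction n) (auto intro: homogeneous_poly_mult)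

lemma homogeneous_poly_prod:
  "(\<And>x. x \<in> I \<Longrightarrow> homogeneous_poly (d x) (f x)) \<Longrightarrow> homogeneous_poly (\<Sum>x\<in>I. d x) (\<Prod>x\<in>I. f x)"
  by (induction I rule: infinite_finite_induct) (auto intro: homogeneous_poly_mult)

lemma homogeneous_poly_eval:
  assumes "homogeneous_poly k p" "\<And>v. homogeneous_poly (Suc 0) (s v)"
  shows "homogeneous_poly k (poly_eval poly_const s p)"
  unfolding poly_eval_def
proof (rule homogeneous_poly_sum)
  fix m assume "m \<in> Poly_Mapping.keys p"
  then have "mono_deg m = k" using assms(1) by (auto simp: homogeneous_poly_def)
  have "homogeneous_poly (\<Sum>v\<in>Poly_Mapping.keys m. Poly_Mapping.lookup m v) (mono_eval s m)"
    unfolding mono_eval_def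
    using homogeneous_poly_power[OF assms(2)] by (intro homogeneous_poly_prod) simp
  then have "homogeneous_poly k (mono_eval s m)"
    using \<open>mono_deg m = k\<close> by (simp add: mono_deg_def)
  then show "homogeneous_poly k (poly_const (Poly_Mapping.lookup p m) * mono_eval s m)"
    using homogeneous_poly_mult[OF homogeneous_poly_const] by fastforce
qed

lemma hcomp_sum_bound: "\<exists>n. \<forall>N\<ge>n. p = (\<Sum>k\<le>N. hcomp k p)"
proof (intro exI allI impI)
  \<comment> \<open>The inserted 0 keeps the maximum defined for the zero polynomial.\<close>
  fix N assume N: "N \<ge> Max (insert 0 (mono_deg ` Poly_Mapping.keys p))"
  show "p = (\<Sum>k\<le>N. hcomp k p)"
  proof (rule poly_mapping_eqI)
    fix m
    have "mono_deg m \<le> N" if "Poly_Mapping.lookup p m \<noteq> 0"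
    proof -
      have "mono_deg m \<le> Max (insert 0 (mono_deg ` Poly_Mapping.keys p))"
        using that by (intro Max_ge) (auto simp: in_keys_iff)
      then show ?thesis using N by (rule order.trans)
    qed
    then show "Poly_Mapping.lookup p m = Poly_Mapping.lookup (\<Sum>k\<le>N. hcomp k p) m"
      by (cases "Poly_Mapping.lookup p m = 0") (auto simp: lookup_sum lookup_hcomp)
  qed
qed

lemma hcomp_mult_homogeneous:
  assumes "homogeneous_poly l q"
  shows "hcomp (k + l) (q * p) = q * hcomp k p"
proof (induction p rule: poly_mapping_induct_single)
  case (single m c)
  have "homogeneous_poly (mono_deg m) (Poly_Mapping.single m c)"
    by (simp add: homogeneous_poly_def)
  then have "hcomp (k + l) (q * Poly_Mapping.single m c) =
      (if k + l = l + mono_deg m then q * Poly_Mapping.single m c else 0)"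
    using hcomp_homogeneous[OF homogeneous_poly_mult[OF assms]] by blast
  then show ?case by (auto simp: hcomp_single add.commute)
qed (simp_all add: hcomp_add distrib_left)

lemma hcomp_eval:
  assumes "\<And>v. homogeneous_poly (Suc 0) (s v)"
  shows "hcomp k (poly_eval poly_const s p) = poly_eval poly_const s (hcomp k p)"
proof (induction p rule: poly_mapping_induct_single)
  case (single m c)
  have "homogeneous_poly (mono_deg m) (Poly_Mapping.single m c)"
    by (simp add: homogeneous_poly_def)
  then have "homogeneous_poly (mono_deg m) (poly_eval poly_const s (Poly_Mapping.single m c))"
    using assms by (rule homogeneous_poly_eval)
  then show ?case
    by (simp add: hcomp_single hcomp_homogeneous poly_eval_0[OF scalar_hom_const])
qed (simp_all add: hcomp_add poly_eval_add[OF scalar_hom_const] poly_eval_0[OF scalar_hom_const])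

lemma hcomp_idl:
  assumes "p \<in> idl S" and hom: "\<And>g. g \<in> S \<Longrightarrow> \<exists>k. homogeneous_poly k g"
  shows "hcomp k p \<in> idl S"
proof -
  \<comment> \<open>All components at once: a component of \<open>r * p\<close> is a sum of products
    of components of \<open>r\<close> and of \<open>p\<close> in several degrees.\<close>
  have "\<forall>k. coeff (grade p) k \<in> idl S"
    using assms(1)
  proof induction
    case (idl_gen g)
    then obtain l where "homogeneous_poly l g" using hom by blast
    then show ?case using idl_gen by (auto simp: grade_homogeneous intro: idl.intros)
  next
    case (idl_mult p r)
    then show ?case by (auto simp: grade_simps coeff_mult intro!: idl_sum idl.idl_mult)
  qed (auto simp: grade_simps intro: idl.intros)
  then show ?thesis by (simp add: hcomp_def)
qed

section \<open>Matroids\<close>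

text \<open>The number of covering steps from a flat up to the ground set. It is a relation because
  the steps are chosen freely, until \<open>corank_rel_unique\<close> shows that all choices give
  the same number.\<close>

inductive corank_rel :: "'a set \<Rightarrow> 'a set set \<Rightarrow> 'a set \<Rightarrow> nat \<Rightarrow> bool" for E L where
  corank_rel_ground: "corank_rel E L E 0"
| corank_rel_cover: "covering_flat L F G \<Longrightarrow> corank_rel E L G n \<Longrightarrow> corank_rel E L F (Suc n)"

locale flat_matroid =
  fixes E :: "'a set" and L :: "'a set set"
  assumes matroid: "matroid E L"
begin

definition cl :: "'a set \<Rightarrow> 'a set" where
  "cl S = \<Inter>{F \<in> L. S \<subseteq> F}"

definition corank :: "'a set \<Rightarrow> nat" where
  "corank F = (THE n. corank_rel E L F n)"

lemma finite_E: "finite E"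
  and flat_subset: "F \<in> L \<Longrightarrow> F \<subseteq> E"
  and flat_Int: "F \<in> L \<Longrightarrow> G \<in> L \<Longrightarrow> F \<inter> G \<in> L"
  and ex1_cover: "F \<in> L \<Longrightarrow> e \<in> E \<Longrightarrow> e \<notin> F \<Longrightarrow> \<exists>!G. covering_flat L F G \<and> e \<in> G"
  using matroid by (auto simp: matroid_def)

lemma finite_L: "finite L"
  using finite_E flat_subset by (meson Pow_iff finite_Pow_iff finite_subset subsetI)

lemma finite_flat: "F \<in> L \<Longrightarrow> finite F"
  using finite_E flat_subset finite_subset by blast

lemma ground_flat: "E \<in> L"
proof -
  have "L \<noteq> {}" using matroid by (simp add: matroid_def)
  then obtain F where F: "F \<in> L" "\<And>G. G \<in> L \<Longrightarrow> F \<subseteq> G \<Longrightarrow> G = F"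
    using finite_L finite_has_maximal[of L] by metis
  have "e \<in> F" if e: "e \<in> E" for e
  proof (rule ccontr)
    assume "e \<notin> F"
    then obtain G where "covering_flat L F G" using ex1_cover[OF F(1) e] by blast
    then show False using F(2)[of G] by (auto simp: covering_flat_def)
  qed
  then have "F = E" using flat_subset[OF F(1)] by blast
  with F(1) show ?thesis by simp
qed

lemma flat_Inter:
  assumes "finite A" "A \<noteq> {}" "A \<subseteq> L"
  shows "\<Inter>A \<in> L"
  using assms by (induction A rule: finite_ne_induct) (auto intro: flat_Int)

lemma cl_flat: "S \<subseteq> E \<Longrightarrow> cl S \<in> L"
  unfolding cl_def using finite_L ground_flat by (intro flat_Inter) auto

lemma subset_cl: "S \<subseteq> cl S"
  by (auto simp: cl_def)

lemma cl_least: "F \<in> L \<Longrightarrow> S \<subseteq> F \<Longrightarrow> cl S \<subseteq> F"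
  by (auto simp: cl_def)

lemma cl_eq: "F \<in> L \<Longrightarrow> cl F = F"
  using subset_cl cl_least by blast

lemma cl_mono: "S \<subseteq> T \<Longrightarrow> cl S \<subseteq> cl T"
  by (auto simp: cl_def)

lemma cover_eq_cl:
  assumes "covering_flat L F G" "F \<in> L" "e \<in> G" "e \<notin> F"
  shows "G = cl (insert e F)"
proof -
  have G: "G \<in> L" "F \<subset> G" using assms by (auto simp: covering_flat_def)
  have "cl (insert e F) \<in> L" using assms G flat_subset by (intro cl_flat) blast
  moreover have "F \<subset> cl (insert e F)" using subset_cl[of "insert e F"] assms by blast
  moreover have "cl (insert e F) \<subseteq> G" using G assms by (intro cl_least) auto
  ultimately show ?thesis using assms(1) unfolding covering_flat_def by blast
qed

lemma covering_cl:
  assumes "F \<in> L" "e \<in> E" "e \<notin> F"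
  shows "covering_flat L F (cl (insert e F))"
proof -
  obtain G where G: "covering_flat L F G" "e \<in> G" using ex1_cover[OF assms] by blast
  with cover_eq_cl[OF G(1) assms(1) G(2) assms(3)] show ?thesis by simp
qed

text \<open>The cover of \<open>F\<close> through \<open>e\<close> also contains \<open>f\<close>,
  and a cover is generated by any of its new elements.\<close>

lemma exchange:
  assumes "F \<in> L" "e \<in> E" "e \<notin> F" "f \<in> cl (insert e F)" "f \<notin> F"
  shows "cl (insert f F) = cl (insert e F)"
  using cover_eq_cl[OF covering_cl[OF assms(1-3)] assms(1,4,5)] by simp

lemma flat_psubset_induct [consumes 1, case_names step]:
  assumes "F \<in> L" and "\<And>F. F \<in> L \<Longrightarrow> (\<And>G. G \<in> L \<Longrightarrow> F \<subset> G \<Longrightarrow> Q G) \<Longrightarrow> Q F"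
  shows "Q F"
  using assms(1)
proof (induction "card (E - F)" arbitrary: F rule: less_induct)
  case less
  show ?case
  proof (rule assms(2)[OF less.prems])
    fix G assume G: "G \<in> L" "F \<subset> G"
    then have "card (E - G) < card (E - F)"
      using finite_E flat_subset[OF G(1)] by (intro psubset_card_mono) auto
    then show "Q G" using less.hyps G by blast
  qed
qed

lemma corank_rel_ex: "F \<in> L \<Longrightarrow> \<exists>n. corank_rel E L F n"
proof (induction F rule: flat_psubset_induct)
  case (step F)
  show ?case
  proof (cases "F = E")
    case False
    then obtain e where "e \<in> E" "e \<notin> F" using flat_subset[OF step(1)] by blast
    note cov = covering_cl[OF step(1) this]
    then obtain n where "corank_rel E L (cl (insert e F)) n"
      using step(2)[of "cl (insert e F)"] by (auto simp: covering_flat_def)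
    then show ?thesis using corank_rel_cover[OF cov] by blast
  qed (use corank_rel_ground in blast)
qed

text \<open>A diamond argument. Two distinct covers \<open>G\<close> and \<open>H\<close> of
  \<open>F\<close> are both covered by their join; a chain from the join upwards extends to both,
  and induction compares it with the given chains of \<open>G\<close> and \<open>H\<close>.\<close>

lemma corank_rel_unique: "F \<in> L \<Longrightarrow> corank_rel E L F n \<Longrightarrow> corank_rel E L F m \<Longrightarrow> n = m"
proof (induction F arbitrary: n m rule: flat_psubset_induct)
  case (step F)
  have ground: "k = 0" if "corank_rel E L E k" for k
    using that by cases (use flat_subset in \<open>auto simp: covering_flat_def\<close>)
  show ?case
  proof (cases "F = E")
    case True
    then have "n = 0" "m = 0" using step(3,4) ground by blast+
    then show ?thesis by simp
  next
    case False
    from step(3) False obtain G n' where G: "covering_flat L F G" "corank_rel E L G n'" "n = Suc n'"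
      by cases auto
    from step(4) False obtain H m' where H: "covering_flat L F H" "corank_rel E L H m'" "m = Suc m'"
      by cases auto
    have flats: "G \<in> L" "H \<in> L" "F \<subset> G" "F \<subset> H" using G(1) H(1) by (auto simp: covering_flat_def)
    show ?thesis
    proof (cases "G = H")
      case True
      then show ?thesis using G H step(2)[of G n' m'] flats by simp
    next
      case False
      obtain g h where gh: "g \<in> G" "g \<notin> F" "h \<in> H" "h \<notin> F" using flats by blast
      have E: "g \<in> E" "h \<in> E" using gh flats flat_subset by auto
      have eqs: "G = cl (insert g F)" "H = cl (insert h F)"
        using cover_eq_cl[OF G(1) step(1) gh(1,2)] cover_eq_cl[OF H(1) step(1) gh(3,4)] by blast+
      have ne: "h \<notin> G" "g \<notin> H"
        using exchange[OF step(1) E(1) gh(2), of h] exchange[OF step(1) E(2) gh(4), of g]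
          gh eqs[symmetric] False by metis+
      define D where "D = cl (insert h G)"
      have "covering_flat L G D" unfolding D_def using covering_cl flats E ne by blast
      moreover have "D = cl (insert g H)"
      proof
        have "H \<subseteq> D"
          unfolding D_def eqs(2) using flats(3) by (intro cl_mono) auto
        moreover have "g \<in> D" using subset_cl[of "insert h G"] gh(1) by (auto simp: D_def)
        ultimately have "insert g H \<subseteq> D" by simp
        then show "cl (insert g H) \<subseteq> D"
          using flats E flat_subset unfolding D_def by (intro cl_least cl_flat) auto
        have "G \<subseteq> cl (insert g H)"
          unfolding eqs(1) using flats(4) by (intro cl_mono) auto
        moreover have "h \<in> cl (insert g H)" using subset_cl[of "insert g H"] gh(3) by auto
        ultimately have "insert h G \<subseteq> cl (insert g H)" by simp
        then show "D \<subseteq> cl (insert g H)"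
          using flats E flat_subset unfolding D_def by (intro cl_least cl_flat) auto
      qed
      then have "covering_flat L H D" using covering_cl flats E ne by simp
      moreover have "D \<in> L" using calculation by (simp add: covering_flat_def)
      then obtain k where "corank_rel E L D k" using corank_rel_ex by blast
      ultimately have "corank_rel E L G (Suc k)" "corank_rel E L H (Suc k)"
        using corank_rel_cover by blast+
      then have "n' = Suc k" "m' = Suc k"
        using step(2)[OF flats(1,3)] step(2)[OF flats(2,4)] G(2) H(2) by blast+
      then show ?thesis using G H by simp
    qed
  qed
qed

lemma corankI: "F \<in> L \<Longrightarrow> corank_rel E L F n \<Longrightarrow> corank F = n"
  unfolding corank_def using corank_rel_unique by blast

lemma corank_rel_corank: "F \<in> L \<Longrightarrow> corank_rel E L F (corank F)"
  using corankI corank_rel_ex by blast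

lemma corank_ground: "corank E = 0"
  using corankI ground_flat corank_rel_ground by blast

lemma corank_cover: "F \<in> L \<Longrightarrow> covering_flat L F G \<Longrightarrow> corank F = Suc (corank G)"
  by (rule corankI, assumption, rule corank_rel_cover, assumption, rule corank_rel_corank)
    (auto simp: covering_flat_def)

lemma corank_cl_insert:
  "F \<in> L \<Longrightarrow> e \<in> E \<Longrightarrow> e \<notin> F \<Longrightarrow> corank F = Suc (corank (cl (insert e F)))"
  using corank_cover covering_cl by blast

lemma corank_strict: "F \<in> L \<Longrightarrow> G \<in> L \<Longrightarrow> F \<subset> G \<Longrightarrow> corank G < corank F"
proof (induction F rule: flat_psubset_induct)
  case (step F)
  then obtain e where e: "e \<in> G" "e \<notin> F" by blast
  then have "e \<in> E" using step flat_subset by blast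
  have cov: "cl (insert e F) \<in> L" "F \<subset> cl (insert e F)"
    using covering_cl[OF step(1) \<open>e \<in> E\<close> e(2)] by (auto simp: covering_flat_def)
  have rk: "corank F = Suc (corank (cl (insert e F)))"
    using corank_cl_insert[OF step(1) \<open>e \<in> E\<close> e(2)] .
  have sub: "cl (insert e F) \<subseteq> G" using step(3,4) e by (intro cl_least) auto
  show ?case
  proof (cases "cl (insert e F) = G")
    case False
    then have "corank G < corank (cl (insert e F))" using step(2)[OF cov step(3)] sub by blast
    then show ?thesis using rk by simp
  qed (use rk in simp)
qed

lemma corank_pos: "F \<in> L \<Longrightarrow> F \<noteq> E \<Longrightarrow> 0 < corank F"
  using corank_strict[of F E] ground_flat flat_subset[of F] by (metis neq0_conv not_less0 psubsetI)

lemma finite_proper_flats: "finite (proper_flats E L)"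
  using finite_L by (simp add: proper_flats_def)

lemma proper_flag_finite: "proper_flag E L C \<Longrightarrow> finite C"
  using finite_proper_flats finite_subset by (auto simp: proper_flag_def)

end

section \<open>Flags of a loopless matroid and its rank\<close>

locale loopless_matroid = flat_matroid +
  assumes loopless: "loopless L"
begin

lemma empty_flat: "{} \<in> L"
  using loopless by (simp add: loopless_def)

lemma corank_le: "F \<in> L \<Longrightarrow> corank F \<le> corank {}"
  using corank_strict[OF empty_flat, of F] by (cases "F = {}") (auto simp: psubset_eq)

lemma proper_flag_corank:
  assumes "proper_flag E L C"
  shows "inj_on corank C" "corank ` C \<subseteq> {1..corank {}}"
proof -
  show "inj_on corank C"
  proof (rule inj_onI, rule ccontr)
    fix F G assume FG: "F \<in> C" "G \<in> C" "corank F = corank G" "F \<noteq> G"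
    then have "F \<in> L" "G \<in> L" "F \<subset> G \<or> G \<subset> F"
      using assms by (auto simp: proper_flag_def proper_flats_def)
    then show False using corank_strict[of F G] corank_strict[of G F] FG by auto
  qed
  show "corank ` C \<subseteq> {1..corank {}}"
  proof
    fix n assume "n \<in> corank ` C"
    then obtain F where "F \<in> L" "F \<noteq> E" "n = corank F"
      using assms by (auto simp: proper_flag_def proper_flats_def)
    then show "n \<in> {1..corank {}}" using corank_le[of F] corank_pos[of F] by auto
  qed
qed

lemma proper_flag_card_le:
  assumes "proper_flag E L C"
  shows "card C \<le> corank {}"
  using card_inj_on_le[OF proper_flag_corank[OF assms]] by simp

lemma complete_flagI_card: "proper_flag E L C \<Longrightarrow> card C = corank {} \<Longrightarrow> complete_flag E L C"
  unfolding complete_flag_def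
  using proper_flag_card_le proper_flag_finite by (metis card_seteq)

text \<open>A complete flag must realise every corank from 1 to that of the empty flat. If
  \<open>v\<close> were missed, a cover of the largest member of corank above \<open>v\<close>,
  taken inside the smallest member of corank below \<open>v\<close> (or the ground set), could be
  inserted.\<close>

lemma complete_flag_card:
  assumes C: "complete_flag E L C"
  shows "card C = corank {}"
proof (rule ccontr)
  assume ne: "card C \<noteq> corank {}"
  have flag: "proper_flag E L C" and max: "\<And>D. proper_flag E L D \<Longrightarrow> C \<subseteq> D \<Longrightarrow> D = C"
    using C by (auto simp: complete_flag_def)
  have CL: "F \<in> L" "F \<noteq> E" if "F \<in> C" for F
    using flag that by (auto simp: proper_flag_def proper_flats_def)
  have chain: "F \<subseteq> G \<or> G \<subseteq> F" if "F \<in> C" "G \<in> C" for F G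
    using flag that by (auto simp: proper_flag_def)
  have "corank ` C \<noteq> {1..corank {}}"
    using ne card_image[OF proper_flag_corank(1)[OF flag]] by auto
  then obtain v where v: "v \<in> {1..corank {}}" "v \<notin> corank ` C"
    using proper_flag_corank(2)[OF flag] by blast
  have "E \<noteq> {}" using v corank_ground by auto
  then have "{} \<in> proper_flats E L" using empty_flat by (auto simp: proper_flats_def)
  then have "proper_flag E L (insert {} C)" using flag by (auto simp: proper_flag_def)
  then have "{} \<in> C" using max[of "insert {} C"] by blast
  define U where "U = {F \<in> C. v < corank F}"
  have "{} \<in> U" using v \<open>{} \<in> C\<close> by (force simp: U_def)
  have "finite U" using proper_flag_finite[OF flag] by (simp add: U_def)
  then obtain F where F: "F \<in> U" "\<And>G. G \<in> U \<Longrightarrow> F \<subseteq> G \<Longrightarrow> G = F"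
    using finite_has_maximal[of U] \<open>{} \<in> U\<close> by (metis empty_iff)
  have FC: "F \<in> C" "v < corank F" using F(1) by (auto simp: U_def)
  have U_le: "G \<subseteq> F" if "G \<in> U" for G
    using F(2)[OF that] chain[of F G] FC that by (auto simp: U_def)
  define W where "W = insert E {G \<in> C. corank G < v}"
  have "finite W" using proper_flag_finite[OF flag] by (simp add: W_def)
  then obtain G where G: "G \<in> W" "\<And>H. H \<in> W \<Longrightarrow> H \<subseteq> G \<Longrightarrow> H = G"
    using finite_has_minimal[of W] by (metis W_def insert_not_empty)
  have GL: "G \<in> L" "corank G < v"
    using G(1) CL ground_flat corank_ground v by (auto simp: W_def)
  have W_ge: "G \<subseteq> H" if "H \<in> W" for H
    using G(2)[OF that] chain[of G H] that G(1) CL flat_subset by (auto simp: W_def)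
  have "F \<subset> G"
  proof -
    have "\<not> G \<subseteq> F"
      using corank_strict[OF GL(1) CL(1)[OF FC(1)]] FC GL by (cases "G = F") auto
    then show ?thesis using chain[of F G] G(1) FC CL flat_subset by (auto simp: W_def)
  qed
  then obtain e where e: "e \<in> G" "e \<notin> F" by blast
  have eE: "e \<in> E" using e GL flat_subset by blast
  \<comment> \<open>\<open>H\<close> covers \<open>F\<close>, so its corank is still at least
    \<open>v\<close>; were it a member, its corank would exceed \<open>v\<close>, against the choice
    of \<open>F\<close> as the largest such member.\<close>
  define H where "H = cl (insert e F)"
  have HL: "H \<in> L" "F \<subset> H" and Hr: "corank F = Suc (corank H)"
    using covering_cl[OF CL(1)[OF FC(1)] eE e(2)] corank_cl_insert[OF CL(1)[OF FC(1)] eE e(2)]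
    by (auto simp: H_def covering_flat_def)
  have "H \<subseteq> G" unfolding H_def using GL e \<open>F \<subset> G\<close> by (intro cl_least) auto
  have "v \<le> corank H" using Hr FC by simp
  have "H \<notin> C"
  proof
    assume "H \<in> C"
    then have "H \<in> U" using \<open>v \<le> corank H\<close> v(2) by (auto simp: U_def le_less)
    then show False using U_le HL by blast
  qed
  have "H \<noteq> E" using \<open>v \<le> corank H\<close> corank_ground v by auto
  have "proper_flag E L (insert H C)"
    unfolding proper_flag_def
  proof (intro conjI ballI)
    show "insert H C \<subseteq> proper_flats E L" using HL \<open>H \<noteq> E\<close> CL by (auto simp: proper_flats_def)
    have *: "K \<subseteq> H \<or> H \<subseteq> K" if "K \<in> C" for K
    proof -
      have "corank K \<noteq> v" using v that by auto
      then have "K \<in> U \<or> K \<in> W" using that by (auto simp: U_def W_def)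
      then show ?thesis using U_le W_ge HL \<open>H \<subseteq> G\<close> by blast
    qed
    show "K \<subseteq> K' \<or> K' \<subseteq> K" if "K \<in> insert H C" "K' \<in> insert H C" for K K'
      using that * chain by blast
  qed
  then show False using max[of "insert H C"] \<open>H \<notin> C\<close> by blast
qed

lemma complete_flag_iff: "complete_flag E L C \<longleftrightarrow> proper_flag E L C \<and> card C = corank {}"
  using complete_flag_card complete_flagI_card by (auto simp: complete_flag_def)

lemma ex_complete_flag: "\<exists>C. complete_flag E L C"
proof -
  let ?A = "{C. proper_flag E L C}"
  have "?A \<subseteq> Pow (proper_flats E L)" by (auto simp: proper_flag_def)
  then have "finite ?A" using finite_proper_flats finite_subset by blast
  moreover have "{} \<in> ?A" by (simp add: proper_flag_def)
  ultimately obtain C where "C \<in> ?A" "\<And>D. D \<in> ?A \<Longrightarrow> C \<subseteq> D \<Longrightarrow> D = C"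
    using finite_has_maximal[of ?A] by (metis empty_iff)
  then show ?thesis by (auto simp: complete_flag_def)
qed

lemma matroid_rank_eq: "matroid_rank E L = corank {}"
  unfolding matroid_rank_def using ex_complete_flag complete_flag_card by (intro the_equality) auto

end

section \<open>Deletion\<close>

locale matroid_deletion = M: loopless_matroid E L for E :: "'a set" and L :: "'a set set" +
  fixes i :: 'a
  assumes i_in: "i \<in> E"
begin

abbreviation "E' \<equiv> E - {i}"
abbreviation "L' \<equiv> deletion L i"

text \<open>In contrast to \<open>special_flats\<close> this includes \<open>E - {i}\<close> if \<open>i\<close> is a coloop.\<close>

definition both_flats :: "'a set set" where
  "both_flats = {F \<in> L. i \<notin> F \<and> insert i F \<in> L}"

lemma mem_deletion_iff: "F \<in> L' \<longleftrightarrow> i \<notin> F \<and> (F \<in> L \<or> insert i F \<in> L)"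
proof
  assume "F \<in> L'"
  then obtain G where G: "G \<in> L" "F = G - {i}" by (auto simp: deletion_def)
  then show "i \<notin> F \<and> (F \<in> L \<or> insert i F \<in> L)"
    by (cases "i \<in> G") (auto simp: insert_absorb)
next
  assume "i \<notin> F \<and> (F \<in> L \<or> insert i F \<in> L)"
  then have "F = F - {i} \<and> F \<in> L \<or> F = insert i F - {i} \<and> insert i F \<in> L" by auto
  then show "F \<in> L'" unfolding deletion_def by blast
qed

lemma deletionI: "F \<in> L \<Longrightarrow> F - {i} \<in> L'"
  unfolding deletion_def by (rule imageI)

lemma deletion_flat_subset: "F \<in> L' \<Longrightarrow> F \<subseteq> E'"
  using M.flat_subset unfolding deletion_def by blast

lemma deletion_cl: "S \<subseteq> E' \<Longrightarrow> F \<in> L' \<Longrightarrow> S \<subseteq> F \<Longrightarrow> M.cl S - {i} \<subseteq> F"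
  unfolding mem_deletion_iff using M.cl_least[of F S] M.cl_least[of "insert i F" S] by blast

lemma deletion_cl_eq: "F \<in> L' \<Longrightarrow> M.cl F - {i} = F"
proof
  assume F: "F \<in> L'"
  then have "F \<subseteq> E'" using M.flat_subset by (auto simp: deletion_def)
  then show "M.cl F - {i} \<subseteq> F" using deletion_cl F by blast
  show "F \<subseteq> M.cl F - {i}" using M.subset_cl[of F] F by (auto simp: mem_deletion_iff)
qed

text \<open>Flats of the deletion are compared through their closures in the matroid: taking
  \<open>M.cl\<close> and removing \<open>i\<close> gives back the flat, so a flat strictly in
  between would have a closure strictly between \<open>M.cl F\<close> and a cover of it.\<close>

lemma deletion_cover:
  assumes F: "F \<in> L'" and e: "e \<in> E'" "e \<notin> F"
  shows "covering_flat L' F (M.cl (insert e (M.cl F)) - {i})"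
proof -
  have FE: "F \<subseteq> E'" using F deletion_flat_subset by blast
  have clF: "M.cl F \<in> L" using FE by (intro M.cl_flat) auto
  have e': "e \<notin> M.cl F" using e deletion_cl_eq[OF F] by blast
  let ?G = "M.cl (insert e (M.cl F))"
  have G: "covering_flat L (M.cl F) ?G" using M.covering_cl[OF clF _ e'] e by blast
  show ?thesis
    unfolding covering_flat_def
  proof (intro conjI notI)
    have "?G \<in> L" using G by (simp add: covering_flat_def)
    then show "?G - {i} \<in> L'" by (rule deletionI)
    have "e \<in> ?G - {i}" "F \<subseteq> ?G - {i}"
      using e M.subset_cl[of "insert e (M.cl F)"] M.subset_cl[of F] FE by blast+
    then show "F \<subset> ?G - {i}" using e by blast
    assume "\<exists>H\<in>L'. F \<subset> H \<and> H \<subset> ?G - {i}"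
    then obtain H where H: "H \<in> L'" "F \<subset> H" "H \<subset> ?G - {i}" by blast
    then have HE: "H \<subseteq> E" using deletion_flat_subset by blast
    have HL: "M.cl H \<in> L" using HE by (rule M.cl_flat)
    have "M.cl F \<subseteq> M.cl H" using H by (intro M.cl_mono) auto
    moreover have "M.cl H \<subseteq> ?G" using H \<open>?G \<in> L\<close> by (intro M.cl_least) auto
    ultimately have "M.cl H = M.cl F \<or> M.cl H = ?G"
      using G HL unfolding covering_flat_def by blast
    then have "H = F \<or> H = ?G - {i}"
      using deletion_cl_eq[OF H(1)] deletion_cl_eq[OF F] by metis
    then show False using H by blast
  qed
qed

lemma deletion_matroid: "matroid E' L'"
  unfolding matroid_def
proof (intro conjI ballI)
  show "finite E'" using M.finite_E by simp
  show "L' \<noteq> {}" using deletionI[OF M.ground_flat] by blast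
  show "L' \<subseteq> Pow E'" using deletion_flat_subset by blast
  show "F \<inter> G \<in> L'" if FG: "F \<in> L'" "G \<in> L'" for F G
  proof -
    obtain F' G' where "F' \<in> L" "F = F' - {i}" "G' \<in> L" "G = G' - {i}"
      using FG by (auto simp: deletion_def)
    then have "F \<inter> G = F' \<inter> G' - {i}" "F' \<inter> G' \<in> L" using M.flat_Int by auto
    then show ?thesis using deletionI by simp
  qed
  fix F e assume F: "F \<in> L'" and e: "e \<in> E' - F"
  have FE: "F \<subseteq> E'" using F deletion_flat_subset by blast
  let ?G = "M.cl (insert e (M.cl F)) - {i}"
  show "\<exists>!G. covering_flat L' F G \<and> e \<in> G"
  proof (rule ex1I[of _ ?G], rule conjI)
    show cov: "covering_flat L' F ?G" using deletion_cover F e by blast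
    show "e \<in> ?G" using M.subset_cl[of "insert e (M.cl F)"] e by auto
    fix G assume G: "covering_flat L' F G \<and> e \<in> G"
    then have GL: "G \<in> L'" "insert e F \<subseteq> G" by (auto simp: covering_flat_def)
    have "M.cl (insert e (M.cl F)) \<subseteq> M.cl (insert e F)"
      using M.subset_cl[of "insert e F"] M.cl_mono[of F "insert e F"] FE e
      by (intro M.cl_least M.cl_flat) auto
    then have "?G \<subseteq> G" using deletion_cl[of "insert e F" G] GL e FE by blast
    then show "G = ?G" using cov G unfolding covering_flat_def by blast
  qed
qed

lemma deletion_loopless: "loopless L'"
  using M.empty_flat by (auto simp: loopless_def mem_deletion_iff)

sublocale D: loopless_matroid E' L'
  using deletion_matroid deletion_loopless
  by (simp add: loopless_matroid_def loopless_matroid_axioms_def flat_matroid_def)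

text \<open>Covers in the deletion are covers of closures with \<open>i\<close> removed, so both
  coranks drop together along a chain. The constant difference is what is left at the top, the
  corank of the closure of \<open>E'\<close>.\<close>

lemma corank_deletion: "F \<in> L' \<Longrightarrow> D.corank F + M.corank (M.cl E') = M.corank (M.cl F)"
proof (induction F rule: D.flat_psubset_induct)
  case (step F)
  show ?case
  proof (cases "F = E'")
    case True
    then show ?thesis using D.corank_ground by simp
  next
    case False
    then obtain e where e: "e \<in> E'" "e \<notin> F" using D.flat_subset[OF step(1)] by blast
    have FE: "F \<subseteq> E" using D.flat_subset[OF step(1)] by blast
    have e': "e \<notin> M.cl F" using e deletion_cl_eq[OF step(1)] by blast
    let ?G = "M.cl (insert e (M.cl F))"
    have cov: "covering_flat L' F (?G - {i})" using deletion_cover step(1) e by blast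
    have G: "?G \<in> L" using e FE M.flat_subset M.cl_flat[OF FE] by (intro M.cl_flat) auto
    have "M.cl (?G - {i}) = ?G"
    proof
      show "M.cl (?G - {i}) \<subseteq> ?G" using G by (intro M.cl_least) auto
      have "insert e (M.cl F) \<subseteq> M.cl (?G - {i})"
      proof -
        have "insert e F \<subseteq> ?G - {i}"
          using e M.subset_cl[of "insert e (M.cl F)"] M.subset_cl[of F] D.flat_subset[OF step(1)] by blast
        then have "insert e F \<subseteq> M.cl (?G - {i})" "M.cl F \<subseteq> M.cl (?G - {i})"
          using M.subset_cl[of "?G - {i}"] by (blast, intro M.cl_mono, blast)
        then show ?thesis by blast
      qed
      then show "?G \<subseteq> M.cl (?G - {i})"
        using M.flat_subset[OF G] by (intro M.cl_least M.cl_flat) auto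
    qed
    moreover have "D.corank (?G - {i}) + M.corank (M.cl E') = M.corank (M.cl (?G - {i}))"
      using cov by (intro step(2)) (auto simp: covering_flat_def)
    moreover have "D.corank F = Suc (D.corank (?G - {i}))" using D.corank_cover step(1) cov by blast
    moreover have "M.corank (M.cl F) = Suc (M.corank ?G)"
      using M.corank_cl_insert[OF M.cl_flat[OF FE] _ e'] e by blast
    ultimately show ?thesis by simp
  qed
qed

text \<open>The closure of \<open>E'\<close> is \<open>E'\<close> itself, of corank 1, if
  \<open>E'\<close> is a flat, and the whole ground set otherwise.\<close>

lemma rank_deletion: "D.corank {} + (if E' \<in> L then 1 else 0) = M.corank {}"
proof -
  have "M.corank (M.cl E') = (if E' \<in> L then 1 else 0)"
  proof (cases "E' \<in> L")
    case True
    have "M.cl (insert i E') = E" using i_in M.cl_eq[OF M.ground_flat] by (simp add: insert_absorb)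
    then show ?thesis
      using M.corank_cl_insert[OF True i_in] M.corank_ground M.cl_eq[OF True] True by simp
  next
    case False
    have "M.cl E' \<in> L" by (intro M.cl_flat) auto
    have "E' \<noteq> M.cl E'" using False \<open>M.cl E' \<in> L\<close> by metis
    then have "M.cl E' = E"
      using M.subset_cl[of E'] M.flat_subset[OF \<open>M.cl E' \<in> L\<close>] by blast
    then show ?thesis using False M.corank_ground by simp
  qed
  moreover have "D.corank {} + M.corank (M.cl E') = M.corank (M.cl {})"
    using corank_deletion D.empty_flat by blast
  ultimately show ?thesis using M.cl_eq[OF M.empty_flat] by simp
qed

lemma coloop_iff: "coloop E L i \<longleftrightarrow> E' \<in> L"
  unfolding coloop_def M.matroid_rank_eq D.matroid_rank_eq using rank_deletion by (auto split: if_splits)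

section \<open>Flats under adding and removing \<open>i\<close>\<close>

lemma both_flatsD: "F \<in> both_flats \<Longrightarrow> F \<in> L" "F \<in> both_flats \<Longrightarrow> i \<notin> F"
  "F \<in> both_flats \<Longrightarrow> insert i F \<in> L" "F \<in> both_flats \<Longrightarrow> F \<in> L'" "F \<in> both_flats \<Longrightarrow> F \<subseteq> E'"
  using M.flat_subset by (auto simp: both_flats_def mem_deletion_iff)

lemma finite_both_flats: "finite both_flats"
  using M.finite_L by (simp add: both_flats_def)

lemma special_flats_eq: "special_flats E L i = both_flats - {E'}"
  using M.flat_subset by (auto simp: special_flats_def both_flats_def)

lemma deletion_flat_below:
  assumes "H \<in> L'" "F \<in> L" "i \<notin> F" "H \<subseteq> F"
  shows "H \<in> L"
proof (rule ccontr)
  assume "H \<notin> L"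
  then have "insert i H \<in> L" using assms by (simp add: mem_deletion_iff)
  then have "insert i H \<inter> F \<in> L" using assms M.flat_Int by blast
  moreover have "insert i H \<inter> F = H" using assms by blast
  ultimately show False using \<open>H \<notin> L\<close> by simp
qed

text \<open>Otherwise the closure of \<open>insert i G\<close> contains a further \<open>j\<close>,
  which lies in \<open>F\<close>; by exchange \<open>i\<close> lies in the closure of
  \<open>insert j G\<close>, hence in \<open>F\<close>.\<close>

lemma both_flats_below:
  assumes "G \<in> L" "i \<notin> G" "F \<in> both_flats" "G \<subseteq> F"
  shows "G \<in> both_flats"
proof (rule ccontr)
  assume "G \<notin> both_flats"
  then have ni: "insert i G \<notin> L" using assms by (auto simp: both_flats_def)
  let ?K = "M.cl (insert i G)"
  have K: "?K \<in> L" using M.flat_subset[OF assms(1)] i_in by (intro M.cl_flat) auto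
  then have "?K \<noteq> insert i G" using ni by auto
  then obtain j where j: "j \<in> ?K" "j \<notin> insert i G" using M.subset_cl[of "insert i G"] by blast
  have "?K \<subseteq> insert i F" using assms both_flatsD by (intro M.cl_least) auto
  then have "j \<in> F" using j by blast
  have jE: "j \<in> E" using j M.flat_subset[OF K] by blast
  have "i \<in> M.cl (insert j G)"
    using M.exchange[OF assms(1) i_in assms(2) j(1)] j M.subset_cl[of "insert i G"] by auto
  moreover have "M.cl (insert j G) \<subseteq> F" using \<open>j \<in> F\<close> assms both_flatsD by (intro M.cl_least) auto
  ultimately show False using both_flatsD assms by blast
qed

text \<open>Intersecting \<open>G\<close> with a flat above \<open>G - {i}\<close> that avoids
  \<open>i\<close> would make \<open>G - {i}\<close> a flat.\<close>

lemma deleted_in_closure: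
  assumes "G \<in> L" "i \<in> G" "G - {i} \<notin> L" "H \<in> L" "i \<notin> H"
  shows "\<not> G - {i} \<subseteq> H"
proof
  assume sub: "G - {i} \<subseteq> H"
  have "G \<inter> H \<in> L" using assms M.flat_Int by blast
  moreover have "G \<inter> H = G - {i}" using sub assms by blast
  ultimately show False using assms by simp
qed

text \<open>If \<open>i\<close> is parallel to some \<open>j\<close> modulo the flat \<open>H\<close>, then \<open>j\<close> detects which flats of the
  deletion above \<open>H\<close> are flats of the matroid.\<close>

lemma parallel_element:
  assumes H: "H \<in> L" "i \<notin> H" "insert i H \<notin> L"
  obtains j where "j \<in> E'" "j \<notin> H"
    "\<And>G. G \<in> L' \<Longrightarrow> H \<subseteq> G \<Longrightarrow> G \<in> L \<longleftrightarrow> j \<notin> G"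
proof -
  let ?K = "M.cl (insert i H)"
  have K: "?K \<in> L" using M.flat_subset[OF H(1)] i_in by (intro M.cl_flat) auto
  then have "?K \<noteq> insert i H" using H by auto
  then obtain j where j: "j \<in> ?K" "j \<notin> insert i H" using M.subset_cl[of "insert i H"] by blast
  have jE: "j \<in> E" using j M.flat_subset[OF K] by blast
  have eq: "M.cl (insert j H) = ?K" using M.exchange[OF H(1) i_in H(2) j(1)] j by blast
  show ?thesis
  proof (rule that[of j])
    fix G assume G: "G \<in> L'" "H \<subseteq> G"
    show "G \<in> L \<longleftrightarrow> j \<notin> G"
    proof
      assume "G \<in> L"
      show "j \<notin> G"
      proof
        assume "j \<in> G"
        then have "M.cl (insert j H) \<subseteq> G" using G \<open>G \<in> L\<close> by (intro M.cl_least) auto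
        then have "i \<in> G" using eq M.subset_cl[of "insert i H"] by blast
        then show False using G by (simp add: mem_deletion_iff)
      qed
    next
      assume "j \<notin> G"
      show "G \<in> L"
      proof (rule ccontr)
        assume "G \<notin> L"
        then have "?K \<subseteq> insert i G" using G by (intro M.cl_least) (auto simp: mem_deletion_iff)
        then show False using j \<open>j \<notin> G\<close> by blast
      qed
    qed
  qed (use j jE in auto)
qed

end

section \<open>The Chow ideal\<close>

definition chow_core_gens :: "'a set \<Rightarrow> 'a set set \<Rightarrow> 'a chow_poly set" where
  "chow_core_gens E L =
     {poly_var (Y j) - (\<Sum>F\<in>{F \<in> proper_flats E L. j \<notin> F}. poly_var (X F)) | j. j \<in> E} \<union>
     {poly_var (X F) * poly_var (X G) | F G.
        F \<in> proper_flats E L \<and> G \<in> proper_flats E L \<and> \<not> F \<subseteq> G \<and> \<not> G \<subseteq> F} \<union>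
     {poly_var (Y j) * poly_var (X F) | j F. j \<in> E \<and> F \<in> proper_flats E L \<and> j \<notin> F}"

text \<open>Adding the variables that do not belong to the matroid as generators lets us form the
  ideal in the polynomial ring in all variables.\<close>

definition chow_gens :: "'a set \<Rightarrow> 'a set set \<Rightarrow> 'a chow_poly set" where
  "chow_gens E L = chow_core_gens E L \<union> poly_var ` (- (Y ` E \<union> X ` proper_flats E L))"

abbreviation chow_full_ideal :: "'a set \<Rightarrow> 'a set set \<Rightarrow> 'a chow_poly set" where
  "chow_full_ideal E L \<equiv> idl (chow_gens E L)"

lemma chow_core_gens_cases [consumes 1, case_names linear incomparable mixed]:
  assumes "g \<in> chow_core_gens E L"
  obtains j where "j \<in> E" "g = poly_var (Y j) - (\<Sum>F\<in>{F \<in> proper_flats E L. j \<notin> F}. poly_var (X F))"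
  | F G where "F \<in> proper_flats E L" "G \<in> proper_flats E L" "\<not> F \<subseteq> G" "\<not> G \<subseteq> F"
      "g = poly_var (X F) * poly_var (X G)"
  | j F where "j \<in> E" "F \<in> proper_flats E L" "j \<notin> F" "g = poly_var (Y j) * poly_var (X F)"
  using assms unfolding chow_core_gens_def by blast

lemma chow_gens_cases [consumes 1, case_names linear incomparable mixed outside]:
  assumes "g \<in> chow_gens E L"
  obtains j where "j \<in> E" "g = poly_var (Y j) - (\<Sum>F\<in>{F \<in> proper_flats E L. j \<notin> F}. poly_var (X F))"
  | F G where "F \<in> proper_flats E L" "G \<in> proper_flats E L" "\<not> F \<subseteq> G" "\<not> G \<subseteq> F"
      "g = poly_var (X F) * poly_var (X G)"
  | j F where "j \<in> E" "F \<in> proper_flats E L" "j \<notin> F" "g = poly_var (Y j) * poly_var (X F)"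
  | v where "v \<notin> Y ` E" "v \<notin> X ` proper_flats E L" "g = poly_var v"
  using assms unfolding chow_gens_def chow_core_gens_def by blast

lemma chow_core_ideal_subset: "idl (chow_core_gens E L) \<subseteq> chow_full_ideal E L"
  by (intro idl_mono) (simp add: chow_gens_def)

lemma chow_gens_homogeneous: "g \<in> chow_gens E L \<Longrightarrow> \<exists>k>0. homogeneous_poly k g"
proof (erule chow_gens_cases)
  fix j assume "g = poly_var (Y j) - (\<Sum>F\<in>{F \<in> proper_flats E L. j \<notin> F}. poly_var (X F))"
  then have "homogeneous_poly (Suc 0) g"
    by (simp add: homogeneous_poly_diff homogeneous_poly_sum)
  then show ?thesis by blast
next
  fix F G assume "g = poly_var (X F) * poly_var (X G)"
  then have "homogeneous_poly (Suc 0 + Suc 0) g" by (simp only: homogeneous_poly_mult homogeneous_poly_var)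
  then show ?thesis by blast
next
  fix j F assume "g = poly_var (Y j) * poly_var (X F)"
  then have "homogeneous_poly (Suc 0 + Suc 0) g" by (simp only: homogeneous_poly_mult homogeneous_poly_var)
  then show ?thesis by blast
next
  fix v assume "g = poly_var v"
  then have "homogeneous_poly (Suc 0) g" by simp
  then show ?thesis by blast
qed

lemma hcomp_chow_ideal: "p \<in> chow_full_ideal E L \<Longrightarrow> hcomp k p \<in> chow_full_ideal E L"
  by (erule hcomp_idl) (use chow_gens_homogeneous in blast)

definition matroid_vars :: "'a set \<Rightarrow> 'a set set \<Rightarrow> 'a chow_var set" where
  "matroid_vars E L = Y ` E \<union> X ` proper_flats E L"

lemma poly_vars_chow_core_gens: "g \<in> chow_core_gens E L \<Longrightarrow> poly_vars g \<subseteq> matroid_vars E L"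
  by (erule chow_core_gens_cases; hypsubst; intro poly_vars_subsetI poly_vars_sum_subsetI)
    (auto simp: matroid_vars_def)

context flat_matroid
begin

text \<open>Extending the variables by \<open>x\<^sub>E = - \<Sum> x\<^sub>F\<close> treats all flats on an equal footing: the
  linear relations become \<open>\<Sum> x\<^sub>F = 0\<close> and \<open>y\<^sub>j = - \<Sum> x\<^sub>F\<close> over the flats containing \<open>j\<close>.\<close>

definition xf :: "'a set \<Rightarrow> 'a chow_poly" where
  "xf F = (if F \<notin> L then 0 else if F = E then - (\<Sum>G\<in>proper_flats E L. poly_var (X G))
     else poly_var (X F))"

lemma xf_proper: "F \<in> proper_flats E L \<Longrightarrow> xf F = poly_var (X F)"
  by (simp add: xf_def proper_flats_def)

lemma xf_not_flat: "F \<notin> L \<Longrightarrow> xf F = 0"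
  by (simp add: xf_def)

lemma proper_flats_eq: "proper_flats E L = L - {E}"
  by (auto simp: proper_flats_def)

lemma sum_xf: "(\<Sum>F\<in>L. xf F) = 0"
proof -
  have "(\<Sum>F\<in>L. xf F) = xf E + (\<Sum>F\<in>L - {E}. xf F)"
    using finite_L ground_flat by (rule sum.remove)
  also have "(\<Sum>F\<in>L - {E}. xf F) = (\<Sum>G\<in>proper_flats E L. poly_var (X G))"
    unfolding proper_flats_eq by (intro sum.cong) (auto simp: xf_def)
  finally show ?thesis using ground_flat by (simp add: xf_def)
qed

lemma xf_homogeneous: "homogeneous_poly (Suc 0) (xf F)"
  by (simp add: xf_def homogeneous_poly_uminus homogeneous_poly_sum)

lemma xf_incomparable_core:
  assumes "\<not> F \<subseteq> G" "\<not> G \<subseteq> F"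
  shows "xf F * xf G \<in> idl (chow_core_gens E L)"
proof (cases "F \<in> L \<and> G \<in> L")
  case True
  then have "F \<in> proper_flats E L" "G \<in> proper_flats E L"
    using assms flat_subset by (auto simp: proper_flats_def)
  then have "poly_var (X F) * poly_var (X G) \<in> chow_core_gens E L"
    using assms unfolding chow_core_gens_def by blast
  then show ?thesis using \<open>F \<in> _\<close> \<open>G \<in> _\<close> by (simp add: xf_proper idl_gen)
qed (auto simp: xf_not_flat idl_0)

lemma var_Y_xf_core:
  assumes "j \<in> E" "j \<notin> F"
  shows "poly_var (Y j) * xf F \<in> idl (chow_core_gens E L)"
proof (cases "F \<in> L")
  case True
  then have "F \<in> proper_flats E L" using assms by (auto simp: proper_flats_def)
  moreover from this have "poly_var (Y j) * poly_var (X F) \<in> chow_core_gens E L"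
    using assms unfolding chow_core_gens_def by blast
  ultimately show ?thesis by (simp add: xf_proper idl_gen)
qed (auto simp: xf_not_flat idl_0)

lemma sum_xf_avoiding:
  "j \<in> E \<Longrightarrow> (\<Sum>F\<in>{F \<in> proper_flats E L. j \<notin> F}. poly_var (X F)) = (\<Sum>F\<in>{F \<in> L. j \<notin> F}. xf F)"
  by (intro sum.cong) (auto simp: xf_def proper_flats_def)

lemma var_Y_eq_core:
  assumes "j \<in> E"
  shows "poly_var (Y j) - (\<Sum>F\<in>{F \<in> L. j \<notin> F}. xf F) \<in> idl (chow_core_gens E L)"
  unfolding sum_xf_avoiding[OF assms, symmetric]
  using assms by (intro idl_gen) (auto simp: chow_core_gens_def)

lemma outside_var:
  "v \<notin> Y ` E \<Longrightarrow> v \<notin> X ` proper_flats E L \<Longrightarrow> poly_var v \<in> chow_full_ideal E L"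
  by (intro idl_gen) (auto simp: chow_gens_def)

text \<open>The relation \<open>y_j x_F = 0\<close> after eliminating \<open>y_j\<close> by its
  linear relation; in this form it speaks of flats only.\<close>

lemma xf_sum_avoiding_core:
  assumes "j \<in> E" "j \<notin> F"
  shows "xf F * (\<Sum>G\<in>{G \<in> L. j \<notin> G}. xf G) \<in> idl (chow_core_gens E L)"
proof -
  let ?S = "\<Sum>G\<in>{G \<in> L. j \<notin> G}. xf G"
  have "xf F * ?S = poly_var (Y j) * xf F - xf F * (poly_var (Y j) - ?S)"
    by (simp add: algebra_simps)
  then show ?thesis
    using var_Y_xf_core[OF assms] var_Y_eq_core[OF assms(1)] by (simp add: idl_diff idl_mult)
qed

lemmas xf_incomparable = subsetD[OF chow_core_ideal_subset xf_incomparable_core]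
  and var_Y_xf = subsetD[OF chow_core_ideal_subset var_Y_xf_core]
  and var_Y_eq = subsetD[OF chow_core_ideal_subset var_Y_eq_core]
  and xf_sum_avoiding = subsetD[OF chow_core_ideal_subset xf_sum_avoiding_core]

end

section \<open>The deletion homomorphism\<close>

context matroid_deletion
begin

text \<open>Variables foreign to the deletion, \<open>Y i\<close> among them, go to zero because
  they are generators of its full ideal. The value at \<open>Y j\<close> agrees with the linear
  relations.\<close>

definition theta_var :: "'a chow_var \<Rightarrow> 'a chow_poly" where
  "theta_var v = (case v of
      Y j \<Rightarrow> if j \<in> E' then poly_var (Y j) else 0
    | X G \<Rightarrow> if G \<in> proper_flats E' L' then M.xf G + M.xf (insert i G) else 0)"

definition \<theta> :: "'a chow_poly \<Rightarrow> 'a chow_poly" where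
  "\<theta> = poly_eval poly_const theta_var"

lemmas \<theta>_simps = poly_eval_simps[OF scalar_hom_const, of theta_var, folded \<theta>_def]

abbreviation "IM \<equiv> chow_full_ideal E L"
abbreviation "ID \<equiv> chow_full_ideal E' L'"

abbreviation e :: "'a set \<Rightarrow> 'a chow_poly" where
  "e F \<equiv> M.xf (insert i F)"

lemma theta_var_homogeneous: "homogeneous_poly (Suc 0) (theta_var v)"
  by (auto simp: theta_var_def M.xf_homogeneous homogeneous_poly_add split: chow_var.split)

lemma \<theta>_homogeneous: "homogeneous_poly k p \<Longrightarrow> homogeneous_poly k (\<theta> p)"
  unfolding \<theta>_def using theta_var_homogeneous by (rule homogeneous_poly_eval[rotated])

lemma hcomp_\<theta>: "hcomp k (\<theta> p) = \<theta> (hcomp k p)"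
  unfolding \<theta>_def using theta_var_homogeneous by (rule hcomp_eval)

text \<open>A flat \<open>F\<close> of the matroid occurs on the left exactly once, from
  \<open>G = F - {i}\<close>; the other terms vanish by \<open>f0\<close>. The condition on
  \<open>P\<close> makes it independent of \<open>i\<close>.\<close>

lemma sum_deletion_flats:
  fixes f :: "'a set \<Rightarrow> 'b::comm_monoid_add"
  assumes f0: "\<And>F. F \<notin> L \<Longrightarrow> f F = 0" and P: "\<And>G. i \<notin> G \<Longrightarrow> P (insert i G) = P G"
  shows "(\<Sum>G\<in>{G \<in> L'. P G}. f G + f (insert i G)) = (\<Sum>F\<in>{F \<in> L. P F}. f F)"
proof -
  have "(\<Sum>G\<in>{G \<in> L'. P G}. f G) = (\<Sum>F\<in>{F \<in> L. i \<notin> F \<and> P F}. f F)"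
    using D.finite_L f0
    by (intro sum.mono_neutral_right) (simp, auto simp: mem_deletion_iff)
  moreover have "(\<Sum>G\<in>{G \<in> L'. P G}. f (insert i G)) = (\<Sum>F\<in>insert i ` {G \<in> L'. P G}. f F)"
    by (subst sum.reindex) (auto simp: inj_on_def mem_deletion_iff insert_ident)
  moreover have "(\<Sum>F\<in>insert i ` {G \<in> L'. P G}. f F) = (\<Sum>F\<in>{F \<in> L. i \<in> F \<and> P F}. f F)"
  proof (intro sum.mono_neutral_right ballI)
    show "{F \<in> L. i \<in> F \<and> P F} \<subseteq> insert i ` {G \<in> L'. P G}"
    proof
      fix F assume F: "F \<in> {F \<in> L. i \<in> F \<and> P F}"
      then have "F = insert i (F - {i})" "F - {i} \<in> L'" "P (F - {i})"
        using P[of "F - {i}"] deletionI[of F] by (auto simp: insert_absorb)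
      then show "F \<in> insert i ` {G \<in> L'. P G}" by blast
    qed
    show "f F = 0" if "F \<in> insert i ` {G \<in> L'. P G} - {F \<in> L. i \<in> F \<and> P F}" for F
    proof -
      obtain G where "F = insert i G" "P G" "i \<notin> G" using \<open>F \<in> _\<close> by (auto simp: mem_deletion_iff)
      then have "F \<notin> L" using that P by auto
      then show ?thesis by (rule f0)
    qed
  qed (use D.finite_L in auto)
  moreover have "(\<Sum>F\<in>{F \<in> L. P F}. f F) =
      (\<Sum>F\<in>{F \<in> L. i \<notin> F \<and> P F} \<union> {F \<in> L. i \<in> F \<and> P F}. f F)"
    by (intro sum.cong) auto
  moreover have "\<dots> = (\<Sum>F\<in>{F \<in> L. i \<notin> F \<and> P F}. f F) + (\<Sum>F\<in>{F \<in> L. i \<in> F \<and> P F}. f F)"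
    using M.finite_L by (intro sum.union_disjoint) auto
  ultimately show ?thesis by (simp add: sum.distrib)
qed

text \<open>Immediate for proper flats. At the ground set the value is forced, since both sides sum
  to zero over all flats of the deletion.\<close>

lemma \<theta>_xf: "G \<in> L' \<Longrightarrow> \<theta> (D.xf G) = M.xf G + e G"
proof -
  have proper: "\<theta> (D.xf G) = M.xf G + e G" if "G \<in> L' - {E'}" for G
    using that by (simp add: D.xf_def \<theta>_simps theta_var_def D.proper_flats_eq)
  assume G: "G \<in> L'"
  show ?thesis
  proof (cases "G = E'")
    case True
    have eq: "(\<Sum>G\<in>L' - {E'}. M.xf G + e G) = (\<Sum>G\<in>L' - {E'}. \<theta> (D.xf G))"
      by (intro sum.cong) (simp_all add: proper)
    have "(\<Sum>G\<in>{G \<in> L'. True}. M.xf G + e G) = \<theta> (\<Sum>G\<in>L'. D.xf G)"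
      using sum_deletion_flats[of M.xf "\<lambda>_. True", OF M.xf_not_flat refl]
      by (simp add: D.sum_xf M.sum_xf \<theta>_simps)
    also have "\<theta> (\<Sum>G\<in>L'. D.xf G) = \<theta> (D.xf E') + (\<Sum>G\<in>L' - {E'}. M.xf G + e G)"
      by (simp add: sum.remove[OF D.finite_L D.ground_flat] \<theta>_simps eq)
    also have "(\<Sum>G\<in>{G \<in> L'. True}. M.xf G + e G) =
        (M.xf E' + e E') + (\<Sum>G\<in>L' - {E'}. M.xf G + e G)"
      by (simp add: sum.remove[OF D.finite_L D.ground_flat])
    finally show ?thesis using True by simp
  next
    case False
    then show ?thesis using proper G by blast
  qed
qed

lemma \<theta>_ideal: "p \<in> ID \<Longrightarrow> \<theta> p \<in> IM"
proof (rule idl_hom_image[where h = \<theta>])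
  fix g assume "g \<in> chow_gens E' L'"
  then show "\<theta> g \<in> IM"
  proof (cases rule: chow_gens_cases)
    case (linear j)
    have "\<theta> g = poly_var (Y j) - (\<Sum>F\<in>{F \<in> L'. j \<notin> F}. M.xf F + e F)"
      unfolding linear D.sum_xf_avoiding[OF linear(1)]
      using linear(1) by (simp add: \<theta>_simps theta_var_def \<theta>_xf)
    also have "(\<Sum>F\<in>{F \<in> L'. j \<notin> F}. M.xf F + e F) = (\<Sum>F\<in>{F \<in> L. j \<notin> F}. M.xf F)"
      using linear(1) by (intro sum_deletion_flats) (auto simp: M.xf_not_flat)
    finally show ?thesis using M.var_Y_eq[of j] linear(1) by simp
  next
    case (incomparable F G)
    then have i: "i \<notin> F" "i \<notin> G" by (auto simp: proper_flats_def mem_deletion_iff)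
    have "\<theta> g = M.xf F * M.xf G + M.xf F * e G + e F * M.xf G + e F * e G"
      using incomparable by (simp add: \<theta>_simps theta_var_def algebra_simps)
    also have "\<dots> \<in> IM"
      using incomparable i by (intro idl_add M.xf_incomparable) auto
    finally show ?thesis .
  next
    case (mixed j F)
    have "\<theta> g = poly_var (Y j) * M.xf F + poly_var (Y j) * e F"
      using mixed by (simp add: \<theta>_simps theta_var_def algebra_simps)
    also have "\<dots> \<in> IM"
      using mixed by (intro idl_add M.var_Y_xf) auto
    finally show ?thesis .
  next
    case (outside v)
    then have "\<theta> g = 0" by (auto simp: \<theta>_simps theta_var_def split: chow_var.split)
    then show ?thesis by (simp add: idl_0)
  qed
qed (auto simp: \<theta>_simps)

section \<open>Generation as a module\<close>

definition below_sum :: "'a set \<Rightarrow> 'a chow_poly" where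
  "below_sum F = (\<Sum>H\<in>{H \<in> L. H \<subseteq> F}. D.xf H)"

definition above_sum :: "'a set \<Rightarrow> 'a chow_poly" where
  "above_sum F = (\<Sum>H\<in>{H \<in> L. i \<notin> H \<and> F \<subset> H}. D.xf H)"

lemma flat_in_deletion: "F \<in> L \<Longrightarrow> i \<notin> F \<Longrightarrow> F \<in> L'"
  by (simp add: mem_deletion_iff)

lemma e_incomparable: "i \<notin> H \<Longrightarrow> \<not> H \<subseteq> F \<Longrightarrow> e F * M.xf H \<in> IM"
  by (intro M.xf_incomparable) auto

lemma e_mult_psubset:
  assumes "F \<in> both_flats" "G \<in> both_flats" "F \<subset> G"
  shows "e F * e G - e F * \<theta> (D.xf G) \<in> IM"
proof -
  have "e F * e G - e F * \<theta> (D.xf G) = - (e F * M.xf G)"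
    using \<theta>_xf[OF both_flatsD(4)[OF assms(2)]] by (simp add: algebra_simps)
  moreover have "e F * M.xf G \<in> IM"
    using assms both_flatsD by (intro e_incomparable) auto
  ultimately show ?thesis by (simp add: idl_uminus)
qed

lemma e_mult_incomparable: "F \<in> both_flats \<Longrightarrow> G \<in> both_flats \<Longrightarrow> \<not> F \<subseteq> G \<Longrightarrow> \<not> G \<subseteq> F \<Longrightarrow> e F * e G \<in> IM"
  using both_flatsD(2) by (intro M.xf_incomparable) auto

text \<open>This is the relation \<open>x\<^sub>F y\<^sub>i = 0\<close>, rewritten in terms of \<open>x\<^sub>F = \<theta> x\<^sub>F - x\<^bsub>F \<union> i\<^esub>\<close>.\<close>

lemma e_square:
  assumes F: "F \<in> both_flats"
  shows "e F * e F - (e F * \<theta> (D.xf F + below_sum F)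
     - \<theta> (D.xf F) * (\<theta> (below_sum F + above_sum F) - (\<Sum>H\<in>{H \<in> both_flats. F \<subset> H}. e H))) \<in> IM"
proof -
  note FD = both_flatsD[OF F]
  define x where "x = M.xf F"
  let ?A = "{H \<in> L. i \<notin> H \<and> F \<subset> H}" and ?B = "{H \<in> L. H \<subset> F}"
    and ?N = "{H \<in> L. i \<notin> H \<and> \<not> F \<subseteq> H \<and> \<not> H \<subseteq> F}"
  define U where "U = (\<Sum>H\<in>?B. M.xf H)"
  define V where "V = (\<Sum>H\<in>?B. e H)"
  define W where "W = (\<Sum>H\<in>?A. M.xf H)"
  define N where "N = (\<Sum>H\<in>?N. M.xf H)"
  have t: "\<theta> (D.xf F) = x + e F" using \<theta>_xf FD by (simp add: x_def)
  have "{H \<in> L. H \<subseteq> F} = insert F ?B" using FD by auto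
  then have "below_sum F = D.xf F + (\<Sum>H\<in>?B. D.xf H)"
    using M.finite_L by (simp add: below_sum_def)
  moreover have "(\<Sum>H\<in>?B. \<theta> (D.xf H)) = U + V"
    unfolding U_def V_def sum.distrib[symmetric]
    using FD by (intro sum.cong \<theta>_xf flat_in_deletion) auto
  ultimately have b: "\<theta> (below_sum F) = x + e F + (U + V)"
    by (simp add: \<theta>_simps t)
  have "\<theta> (above_sum F) = (\<Sum>H\<in>?A. M.xf H + e H)"
    unfolding above_sum_def \<theta>_simps by (intro sum.cong \<theta>_xf flat_in_deletion) auto
  also have "\<dots> = W + (\<Sum>H\<in>?A. e H)" by (simp add: W_def sum.distrib)
  also have "(\<Sum>H\<in>?A. e H) = (\<Sum>H\<in>{H \<in> both_flats. F \<subset> H}. e H)"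
    using M.finite_L by (intro sum.mono_neutral_right) (use M.xf_not_flat in \<open>auto simp: both_flats_def\<close>)
  finally have a: "\<theta> (above_sum F) - (\<Sum>H\<in>{H \<in> both_flats. F \<subset> H}. e H) = W" by simp
  \<comment> \<open>This is \<open>x_F y_i = 0\<close>: the flats avoiding \<open>i\<close> are
    \<open>F\<close>, those below it, those above it and the incomparable ones.\<close>
  have full: "x * (x + U + W + N) \<in> IM"
  proof -
    have "{H \<in> L. i \<notin> H} = insert F (?B \<union> (?A \<union> ?N))" using FD by auto
    moreover have "(\<Sum>H\<in>?A \<union> ?N. M.xf H) = W + N"
      unfolding W_def N_def using M.finite_L by (intro sum.union_disjoint) auto
    then have "(\<Sum>H\<in>?B \<union> (?A \<union> ?N). M.xf H) = U + (W + N)"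
      unfolding U_def using M.finite_L by (subst sum.union_disjoint) auto
    ultimately have "(\<Sum>H\<in>{H \<in> L. i \<notin> H}. M.xf H) = x + U + W + N"
      using M.finite_L by (simp add: x_def)
    then show ?thesis using M.xf_sum_avoiding[OF i_in, of F] FD by (simp add: x_def)
  qed
  have xN: "x * N \<in> IM" unfolding x_def N_def sum_distrib_left
    by (intro idl_sum M.xf_incomparable) auto
  have xV: "x * V \<in> IM" unfolding x_def V_def sum_distrib_left
    using FD by (intro idl_sum M.xf_incomparable) auto
  have eW: "e F * W \<in> IM" unfolding W_def sum_distrib_left
    by (intro idl_sum e_incomparable) auto
  have "e F * e F - (e F * \<theta> (D.xf F + below_sum F)
     - \<theta> (D.xf F) * (\<theta> (below_sum F + above_sum F) - (\<Sum>H\<in>{H \<in> both_flats. F \<subset> H}. e H)))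
    = e F * e F - (e F * ((x + e F) + (x + e F + (U + V))) - (x + e F) * ((x + e F + (U + V)) + W))"
    using a by (simp add: \<theta>_simps t b add_diff_eq[symmetric])
  \<comment> \<open>The mixed terms cancel; what remains besides \<open>full\<close> consists of
    products of incomparable flats.\<close>
  also have "\<dots> = x * (x + U + W + N) - x * N + x * V + e F * W"
    by (simp add: algebra_simps)
  also have "\<dots> \<in> IM" using full xN xV eW by (intro idl_add idl_diff)
  finally show ?thesis .
qed

definition module_form :: "'a chow_poly \<Rightarrow> ('a set \<Rightarrow> 'a chow_poly) \<Rightarrow> 'a chow_poly" where
  "module_form a b = \<theta> a + (\<Sum>F\<in>both_flats. e F * \<theta> (b F))"

text \<open>This set contains 1 and turns out to be closed under multiplication by each variable,
  hence is the whole ring: that is generation as a module.\<close>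

definition spanned :: "'a chow_poly set" where
  "spanned = {p. \<exists>a b. p - module_form a b \<in> IM}"

lemma module_form_add: "module_form a b + module_form a' b' = module_form (a + a') (\<lambda>F. b F + b' F)"
  by (simp add: module_form_def \<theta>_simps distrib_left sum.distrib algebra_simps)

lemma module_form_mult: "\<theta> c * module_form a b = module_form (c * a) (\<lambda>F. c * b F)"
  by (simp add: module_form_def \<theta>_simps distrib_left sum_distrib_left mult_ac)

lemma spanned_add: "p \<in> spanned \<Longrightarrow> q \<in> spanned \<Longrightarrow> p + q \<in> spanned"
proof -
  assume "p \<in> spanned" "q \<in> spanned"
  then obtain a b a' b' where "p - module_form a b \<in> IM" "q - module_form a' b' \<in> IM"
    by (auto simp: spanned_def)
  then have "(p + q) - module_form (a + a') (\<lambda>F. b F + b' F) \<in> IM"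
    using idl_cong_add module_form_add by metis
  then show ?thesis by (auto simp: spanned_def)
qed

lemma spanned_\<theta>_mult: "p \<in> spanned \<Longrightarrow> \<theta> c * p \<in> spanned"
proof -
  assume "p \<in> spanned"
  then obtain a b where "p - module_form a b \<in> IM" by (auto simp: spanned_def)
  then have "\<theta> c * (p - module_form a b) \<in> IM" by (rule idl_mult)
  then have "\<theta> c * p - module_form (c * a) (\<lambda>F. c * b F) \<in> IM"
    by (simp add: right_diff_distrib module_form_mult)
  then show ?thesis by (auto simp: spanned_def)
qed

lemma spanned_cong: "p - q \<in> IM \<Longrightarrow> q \<in> spanned \<Longrightarrow> p \<in> spanned"
  unfolding spanned_def using idl_cong_trans by blast

lemma spanned_0: "0 \<in> spanned"
proof -
  have "0 - module_form 0 (\<lambda>_. 0) \<in> IM" by (simp add: module_form_def \<theta>_simps idl_0)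
  then show ?thesis unfolding spanned_def by blast
qed

lemma spanned_ideal: "p \<in> IM \<Longrightarrow> p \<in> spanned"
  using spanned_cong[of p 0] spanned_0 by simp

lemma spanned_1: "1 \<in> spanned"
proof -
  have "1 - module_form 1 (\<lambda>_. 0) \<in> IM" by (simp add: module_form_def \<theta>_simps idl_0)
  then show ?thesis unfolding spanned_def by blast
qed

lemma spanned_\<theta>: "\<theta> a \<in> spanned"
  using spanned_\<theta>_mult[OF spanned_1, of a] by simp

lemma spanned_e: "F \<in> both_flats \<Longrightarrow> e F \<in> spanned"
proof -
  assume F: "F \<in> both_flats"
  have "module_form 0 (\<lambda>H. if H = F then 1 else 0) = (\<Sum>H\<in>both_flats. if H = F then e H else 0)"
    unfolding module_form_def by (simp add: \<theta>_simps) (intro sum.cong, auto simp: \<theta>_simps)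
  also have "\<dots> = e F" using F finite_both_flats by simp
  finally have "e F - module_form 0 (\<lambda>H. if H = F then 1 else 0) \<in> IM" by (simp add: idl_0)
  then show ?thesis unfolding spanned_def by blast
qed

lemma spanned_uminus: "p \<in> spanned \<Longrightarrow> - p \<in> spanned"
  using spanned_\<theta>_mult[of p "- 1"] by (simp add: \<theta>_simps)

lemma spanned_diff: "p \<in> spanned \<Longrightarrow> q \<in> spanned \<Longrightarrow> p - q \<in> spanned"
  using spanned_add[OF _ spanned_uminus, of p q] by simp

lemma spanned_sum: "(\<And>x. x \<in> I \<Longrightarrow> f x \<in> spanned) \<Longrightarrow> (\<Sum>x\<in>I. f x) \<in> spanned"
  by (induction I rule: infinite_finite_induct) (auto intro: spanned_0 spanned_add)

lemma spanned_e_e: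
  assumes "F \<in> both_flats" "G \<in> both_flats"
  shows "e F * e G \<in> spanned"
proof -
  have *: "e F * e G \<in> spanned" if FG: "F \<in> both_flats" "G \<in> both_flats" "F \<subset> G" for F G
    using spanned_cong[OF e_mult_psubset[OF FG]] spanned_\<theta>_mult[OF spanned_e[OF FG(1)], of "D.xf G"]
    by (simp add: mult.commute)
  consider "F \<subset> G" | "G \<subset> F" | "F = G" | "\<not> F \<subseteq> G" "\<not> G \<subseteq> F" by blast
  then show ?thesis
  proof cases
    case 1
    then show ?thesis using * assms by blast
  next
    case 2
    then show ?thesis using *[of G F] assms by (simp add: mult.commute)
  next
    case 3
    have "\<theta> (D.xf F + below_sum F) * e F \<in> spanned"
      using assms by (intro spanned_\<theta>_mult spanned_e)
    moreover have "\<theta> (D.xf F) * (\<theta> (below_sum F + above_sum F) - (\<Sum>H\<in>{H \<in> both_flats. F \<subset> H}. e H)) \<in> spanned"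
      by (intro spanned_\<theta>_mult spanned_diff spanned_\<theta> spanned_sum spanned_e) auto
    ultimately show ?thesis
      using spanned_cong[OF e_square[OF assms(1)]] 3 by (simp add: spanned_diff mult.commute)
  next
    case 4
    then show ?thesis using e_mult_incomparable assms spanned_ideal by blast
  qed
qed

lemma spanned_e_mult:
  assumes "F \<in> both_flats" "p \<in> spanned"
  shows "e F * p \<in> spanned"
proof -
  obtain a b where ab: "p - module_form a b \<in> IM" using assms by (auto simp: spanned_def)
  then have "e F * (p - module_form a b) \<in> IM" by (rule idl_mult)
  then have 1: "e F * p - e F * module_form a b \<in> IM" by (simp add: right_diff_distrib)
  have "e F * module_form a b = \<theta> a * e F + (\<Sum>G\<in>both_flats. \<theta> (b G) * (e F * e G))"
    by (simp add: module_form_def algebra_simps sum_distrib_left)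
  also have "\<dots> \<in> spanned"
    using assms by (intro spanned_add spanned_sum spanned_\<theta>_mult spanned_e spanned_e_e)
  finally show ?thesis using spanned_cong[OF 1] by blast
qed

text \<open>Each \<open>x_G\<close> is \<open>e_F\<close> or \<open>\<theta> x_F\<close> with
  \<open>F = G - {i}\<close> if \<open>i\<close> belongs to \<open>G\<close>, and
  \<open>\<theta> x_G - e_G\<close> otherwise, where \<open>e_G\<close> is zero unless
  \<open>insert i G\<close> is a flat.\<close>

lemma spanned_xf_mult:
  assumes "G \<in> L" "p \<in> spanned"
  shows "M.xf G * p \<in> spanned"
proof (cases "i \<in> G")
  case True
  define F where "F = G - {i}"
  have G: "G = insert i F" "i \<notin> F" using True by (auto simp: F_def)
  show ?thesis
  proof (cases "F \<in> L")
    case True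
    then have "F \<in> both_flats" using G assms by (simp add: both_flats_def)
    then show ?thesis using spanned_e_mult assms G by blast
  next
    case False
    have "F \<in> L'" using assms deletionI by (simp add: F_def)
    then have "M.xf G = \<theta> (D.xf F)" using \<theta>_xf[of F] False G by (simp add: M.xf_not_flat)
    then show ?thesis using assms spanned_\<theta>_mult by simp
  qed
next
  case False
  then have *: "M.xf G = \<theta> (D.xf G) - e G" using \<theta>_xf[of G] assms flat_in_deletion by simp
  show ?thesis
  proof (cases "insert i G \<in> L")
    case True
    then have "G \<in> both_flats" using False assms by (simp add: both_flats_def)
    then show ?thesis
      using assms unfolding * by (simp add: left_diff_distrib spanned_diff spanned_\<theta>_mult spanned_e_mult)
  next
    case False
    then show ?thesis using assms spanned_\<theta>_mult * by (simp add: M.xf_not_flat)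
  qed
qed

lemma spanned_mult: "q \<in> spanned \<Longrightarrow> p * q \<in> spanned"
proof (induction p arbitrary: q rule: poly_induct_vars)
  case (const c)
  then show ?case using spanned_\<theta>_mult[of q "poly_const c"] by (simp add: \<theta>_simps)
next
  case (var v)
  show ?case
  proof (cases v)
    case (Y j)
    show ?thesis
    proof (cases "j \<in> E")
      case True
      let ?S = "\<Sum>F\<in>{F \<in> L. j \<notin> F}. M.xf F"
      have "(poly_var (Y j) - ?S) * q \<in> IM" using M.var_Y_eq[OF True] by (rule idl_mult_right)
      then have "poly_var (Y j) * q - ?S * q \<in> IM" by (simp add: left_diff_distrib)
      moreover have "?S * q \<in> spanned"
        unfolding sum_distrib_right using var by (intro spanned_sum spanned_xf_mult) auto
      ultimately show ?thesis using spanned_cong Y by simp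
    next
      case False
      then have "poly_var v * q \<in> IM" using Y by (intro idl_mult_right M.outside_var) auto
      then show ?thesis by (rule spanned_ideal)
    qed
  next
    case (X G)
    show ?thesis
    proof (cases "G \<in> proper_flats E L")
      case True
      then show ?thesis
        using spanned_xf_mult[of G q] var X M.xf_proper[OF True] by (simp add: proper_flats_def)
    next
      case False
      then have "poly_var v * q \<in> IM" using X by (intro idl_mult_right M.outside_var) auto
      then show ?thesis by (rule spanned_ideal)
    qed
  qed
next
  case (add p p')
  then show ?case by (simp add: distrib_right spanned_add)
next
  case (mult p p')
  then show ?case by (simp add: mult.assoc)
qed

lemma ex_module_form: "\<exists>a b. p - module_form a b \<in> IM"
  using spanned_mult[OF spanned_1, of p] by (simp add: spanned_def)

text \<open>Each \<open>e F\<close> has degree one, so its coefficient is taken one degree lower;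
  the successor keeps that degree from being negative.\<close>

lemma hcomp_module_form:
  "hcomp (Suc k) (module_form a b) = module_form (hcomp (Suc k) a) (\<lambda>F. hcomp k (b F))"
  using hcomp_mult_homogeneous[OF M.xf_homogeneous]
  by (simp add: module_form_def hcomp_add hcomp_sum hcomp_\<theta>)

lemma ex_module_form_homogeneous:
  assumes "homogeneous_poly (Suc k) p"
  obtains a b where "p - module_form a b \<in> IM" "homogeneous_poly (Suc k) a"
    "\<And>F. homogeneous_poly k (b F)"
proof -
  obtain a b where "p - module_form a b \<in> IM" using ex_module_form by blast
  then have "hcomp (Suc k) (p - module_form a b) \<in> IM" by (rule hcomp_chow_ideal)
  then have "p - module_form (hcomp (Suc k) a) (\<lambda>F. hcomp k (b F)) \<in> IM"
    using assms by (simp add: hcomp_diff hcomp_module_form homogeneous_poly_iff)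
  then show thesis by (rule that) simp_all
qed

end

section \<open>Adjoining a root of a quadratic polynomial\<close>

text \<open>The coefficients of the remainder of \<open>f\<close> modulo \<open>t\<^sup>2 - p t - q\<close>.\<close>

definition quad_red :: "'b::comm_ring_1 \<Rightarrow> 'b \<Rightarrow> 'b poly \<Rightarrow> 'b \<times> 'b" where
  "quad_red p q f = fold_coeffs (\<lambda>c (\<alpha>, \<beta>). (c + q * \<beta>, \<alpha> + p * \<beta>)) f (0, 0)"

context
  fixes p q :: "'b::comm_ring_1"
begin

lemma quad_red_0 [simp]: "quad_red p q 0 = (0, 0)"
  by (simp add: quad_red_def)

lemma quad_red_pCons:
  "quad_red p q (pCons c f) =
    (c + q * snd (quad_red p q f), fst (quad_red p q f) + p * snd (quad_red p q f))"
  by (cases "c = 0 \<and> f = 0") (auto simp: quad_red_def case_prod_beta)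

lemma quad_red_add:
  "quad_red p q (f + g) =
    (fst (quad_red p q f) + fst (quad_red p q g), snd (quad_red p q f) + snd (quad_red p q g))"
proof (induction f arbitrary: g)
  case (pCons c f)
  show ?case
    by (cases g) (simp add: quad_red_pCons pCons.IH, simp add: algebra_simps)
qed simp

lemma quad_red_smult:
  "quad_red p q (smult c f) = (c * fst (quad_red p q f), c * snd (quad_red p q f))"
  by (induction f) (auto simp: quad_red_pCons algebra_simps)

lemma quad_red_mult:
  "quad_red p q (f * g) =
    (fst (quad_red p q f) * fst (quad_red p q g) + q * snd (quad_red p q f) * snd (quad_red p q g),
     fst (quad_red p q f) * snd (quad_red p q g) + snd (quad_red p q f) * fst (quad_red p q g)
       + p * snd (quad_red p q f) * snd (quad_red p q g))"
  by (induction f)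
    (auto simp: quad_red_pCons quad_red_add quad_red_smult mult_pCons_left algebra_simps)

end

text \<open>\<open>v0\<close> becomes the formal variable and the others become coefficients, so
  that \<open>quad_red\<close> can divide by a quadratic in \<open>v0\<close>.\<close>

definition isolate_var :: "'a chow_var \<Rightarrow> 'a chow_poly \<Rightarrow> 'a chow_poly poly" where
  "isolate_var v0 = poly_eval (\<lambda>c. [:poly_const c:]) (\<lambda>v. if v = v0 then [:0, 1:] else [:poly_var v:])"

lemmas isolate_var_simps =
  poly_eval_simps[OF scalar_hom_const_poly, of "\<lambda>v. if v = v0 then [:0, 1:] else [:poly_var v:]"
    for v0, folded isolate_var_def]

lemma isolate_var_free: "v0 \<notin> poly_vars p \<Longrightarrow> isolate_var v0 p = [:p:]"
proof -
  assume "v0 \<notin> poly_vars p"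
  then have "poly_vars p \<subseteq> - {v0}" by blast
  then show ?thesis
    by (induction p rule: poly_vars_induct) (simp_all add: isolate_var_simps)
qed

text \<open>If the ideal \<open>I\<close> contains \<open>K q\<close> then \<open>R[t] / (I, K t, t\<^sup>2 - p t - q)\<close> is the direct sum of
  \<open>R / I\<close> and of \<open>R / K\<close> times \<open>t\<close>.\<close>

lemma quadratic_extension:
  fixes p q :: "'a chow_poly"
  assumes IK: "idl S \<subseteq> idl T" and Kq: "\<And>k. k \<in> idl T \<Longrightarrow> k * q \<in> idl S"
    and gens: "\<And>g. g \<in> U \<Longrightarrow> fst (quad_red p q (isolate_var v g)) \<in> idl S \<and>
      snd (quad_red p q (isolate_var v g)) \<in> idl T"
    and x: "a + b * poly_var v \<in> idl U" and free: "v \<notin> poly_vars a" "v \<notin> poly_vars b"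
  shows "a \<in> idl S \<and> b \<in> idl T"
proof -
  have "fst (quad_red p q (isolate_var v x)) \<in> idl S \<and> snd (quad_red p q (isolate_var v x)) \<in> idl T"
    if "x \<in> idl U" for x
    using that
  proof induction
    case (idl_mult x r)
    define c d where "c = fst (quad_red p q (isolate_var v x))" and "d = snd (quad_red p q (isolate_var v x))"
    define \<alpha> \<beta> where "\<alpha> = fst (quad_red p q (isolate_var v r))" and "\<beta> = snd (quad_red p q (isolate_var v r))"
    have cd: "c \<in> idl S" "d \<in> idl T" using idl_mult by (simp_all add: c_def d_def)
    \<comment> \<open>For the remainders \<open>\<alpha> + \<beta> t\<close> of \<open>r\<close> and
      \<open>c + d t\<close> of \<open>x\<close>, the constant term of the product uses that
      \<open>K q\<close> lies in \<open>I = idl S\<close>, and the linear term that \<open>I\<close>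
      lies in \<open>K = idl T\<close>.\<close>
    have "\<alpha> * c + \<beta> * (d * q) \<in> idl S" 
      by (rule idl_add[OF idl.idl_mult[OF cd(1)] idl.idl_mult[OF Kq[OF cd(2)]]])
    moreover have "\<alpha> * d + \<beta> * c + (p * \<beta>) * d \<in> idl T"
      using cd IK by (intro idl_add idl.idl_mult) auto
    ultimately show ?case
      by (simp add: isolate_var_simps quad_red_mult mult_ac flip: c_def d_def \<alpha>_def \<beta>_def)
  qed (auto simp: isolate_var_simps quad_red_add gens intro: idl_0 idl_add)
  from this[OF x] show ?thesis
    by (simp add: isolate_var_simps isolate_var_free free quad_red_pCons)
qed

lemma idl_sum_cong:
  assumes "\<And>x. x \<in> I \<Longrightarrow> c * (f x - g x) \<in> idl S"
  shows "c * (\<Sum>x\<in>I. f x) - c * (\<Sum>x\<in>I. g x) \<in> idl S"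
proof -
  have "c * (\<Sum>x\<in>I. f x) - c * (\<Sum>x\<in>I. g x) = (\<Sum>x\<in>I. c * (f x - g x))"
    by (simp add: sum_subtractf sum_distrib_left algebra_simps)
  then show ?thesis using assms by (simp add: idl_sum)
qed

lemma idl_sum_diff_sets:
  assumes "finite A" "finite B" "\<And>x. x \<in> (A - B) \<union> (B - A) \<Longrightarrow> c * f x \<in> idl S"
  shows "c * (\<Sum>x\<in>A. f x) - c * (\<Sum>x\<in>B. f x) \<in> idl S"
proof -
  have "c * (\<Sum>x\<in>A. f x) - c * (\<Sum>x\<in>B. f x) = (\<Sum>x\<in>A - B. c * f x) - (\<Sum>x\<in>B - A. c * f x)"
    using assms(1,2) sum.Int_Diff[of A f B] sum.Int_Diff[of B f A]
    by (simp add: sum_distrib_left algebra_simps Int_commute)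
  also have "\<dots> \<in> idl S" using assms(3) by (intro idl_diff idl_sum) auto
  finally show ?thesis .
qed

section \<open>Independence of the summands\<close>

context matroid_deletion
begin

text \<open>The annihilator of \<open>e\<^sub>F\<close> in the Chow ring of the deletion.\<close>

definition comp_gens :: "'a set \<Rightarrow> 'a chow_poly set" where
  "comp_gens F = chow_core_gens E' L' \<union> (poly_var \<circ> Y) ` (E' - F) \<union>
     D.xf ` {G \<in> L'. \<not> F \<subseteq> G \<and> \<not> G \<subseteq> F} \<union> D.xf ` {H \<in> L'. F \<subset> H \<and> insert i H \<notin> L}"

text \<open>The new indeterminate for \<open>e_F\<close>. It reuses the label of \<open>x\<close> at
  \<open>insert i F\<close>, which no flat of the deletion can carry.\<close>

definition ev :: "'a set \<Rightarrow> 'a chow_poly" where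
  "ev F = poly_var (X (insert i F))"

text \<open>The element of the tower that stands for \<open>x\<^sub>H = \<theta> x\<^sub>H - e\<^sub>H\<close>.\<close>

definition zf :: "'a set \<Rightarrow> 'a chow_poly" where
  "zf H = D.xf H - (if H \<in> both_flats then ev H else 0)"

text \<open>The constant term of \<open>e_square\<close>, with the \<open>e_H\<close> of larger
  flats absorbed into \<open>zf H\<close>. It has the factor \<open>x_F\<close>, so whatever kills
  \<open>x_F\<close> kills it.\<close>

definition quad_const :: "'a set \<Rightarrow> 'a chow_poly" where
  "quad_const F = - D.xf F * (below_sum F + (\<Sum>H\<in>{H \<in> L. i \<notin> H \<and> F \<subset> H}. zf H))"

definition quad_rel :: "'a set \<Rightarrow> 'a chow_poly" where
  "quad_rel F = ev F * ev F - (D.xf F + below_sum F) * ev F - quad_const F"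

text \<open>The relations that the \<open>e F\<close> satisfy in the Chow ring of the matroid,
  imposed on free indeterminates: the annihilator of each, the products of two of them, and the
  quadratic equation. \<open>U\<close> collects the flats adjoined so far.\<close>

definition tower_gens :: "'a set set \<Rightarrow> 'a chow_poly set" where
  "tower_gens U = chow_core_gens E' L' \<union> (\<Union>F\<in>U. (\<lambda>k. k * ev F) ` comp_gens F) \<union>
     {ev F * ev G - D.xf G * ev F | F G. F \<in> U \<and> G \<in> U \<and> F \<subset> G} \<union>
     {ev F * ev G | F G. F \<in> U \<and> G \<in> U \<and> \<not> F \<subseteq> G \<and> \<not> G \<subseteq> F} \<union>
     quad_rel ` U"

abbreviation "tower_ideal U \<equiv> idl (tower_gens U)"

text \<open>A stage of the tower contains with \<open>F\<close> all larger members of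
  \<open>both_flats\<close>, because \<open>quad_const F\<close> involves their
  \<open>ev\<close>.\<close>

definition up_closed :: "'a set set \<Rightarrow> bool" where
  "up_closed U \<longleftrightarrow> U \<subseteq> both_flats \<and> (\<forall>F\<in>U. \<forall>G\<in>both_flats. F \<subset> G \<longrightarrow> G \<in> U)"

abbreviation "old_vars \<equiv> matroid_vars E' L'"

lemma new_var: "X (insert i F) \<notin> old_vars"
  by (auto simp: matroid_vars_def proper_flats_def mem_deletion_iff)

lemma poly_vars_D_xf: "poly_vars (D.xf G) \<subseteq> old_vars"
  using poly_vars_sum[of "\<lambda>F. poly_var (X F)" "proper_flats E' L'"]
  by (auto simp: D.xf_def matroid_vars_def proper_flats_def)

lemma poly_vars_ev [simp]: "poly_vars (ev F) = {X (insert i F)}"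
  by (simp add: ev_def)

lemma comp_gens_core: "g \<in> chow_core_gens E' L' \<Longrightarrow> g \<in> comp_gens F"
  and comp_gens_Y: "j \<in> E' \<Longrightarrow> j \<notin> F \<Longrightarrow> poly_var (Y j) \<in> comp_gens F"
  and comp_gens_incomparable: "G \<in> L' \<Longrightarrow> \<not> F \<subseteq> G \<Longrightarrow> \<not> G \<subseteq> F \<Longrightarrow> D.xf G \<in> comp_gens F"
  and comp_gens_above: "H \<in> L' \<Longrightarrow> F \<subset> H \<Longrightarrow> insert i H \<notin> L \<Longrightarrow> D.xf H \<in> comp_gens F"
  by (auto simp: comp_gens_def)

lemma comp_gens_cases [consumes 1, case_names core Y incomparable above]:
  assumes "g \<in> comp_gens F"
  obtains "g \<in> chow_core_gens E' L'"
  | j where "j \<in> E'" "j \<notin> F" "g = poly_var (Y j)"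
  | G where "G \<in> L'" "\<not> F \<subseteq> G" "\<not> G \<subseteq> F" "g = D.xf G"
  | H where "H \<in> L'" "F \<subset> H" "insert i H \<notin> L" "g = D.xf H"
  using assms unfolding comp_gens_def by auto

lemma poly_vars_comp_gens:
  assumes "g \<in> comp_gens F"
  shows "poly_vars g \<subseteq> old_vars"
  using assms
proof (cases rule: comp_gens_cases)
  case core
  then show ?thesis by (rule poly_vars_chow_core_gens)
next
  case (Y j)
  then show ?thesis by (simp add: matroid_vars_def)
qed (simp_all add: poly_vars_D_xf)

section \<open>Relations valid in a stage of the tower\<close>

lemma core_in_tower: "p \<in> idl (chow_core_gens E' L') \<Longrightarrow> p \<in> tower_ideal U"
  by (rule subsetD[OF idl_mono]) (auto simp: tower_gens_def)

lemma tower_comp: "F \<in> U \<Longrightarrow> k \<in> comp_gens F \<Longrightarrow> ev F * k \<in> tower_ideal U"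
  by (intro idl_gen) (auto simp: tower_gens_def mult.commute)

lemma tower_psubset: "F \<in> U \<Longrightarrow> G \<in> U \<Longrightarrow> F \<subset> G \<Longrightarrow> ev F * ev G - D.xf G * ev F \<in> tower_ideal U"
  by (intro idl_gen) (auto simp: tower_gens_def)

lemma tower_incomparable:
  "F \<in> U \<Longrightarrow> G \<in> U \<Longrightarrow> \<not> F \<subseteq> G \<Longrightarrow> \<not> G \<subseteq> F \<Longrightarrow> ev F * ev G \<in> tower_ideal U"
  by (intro idl_gen) (auto simp: tower_gens_def)

lemma tower_quad: "F \<in> U \<Longrightarrow> quad_rel F \<in> tower_ideal U"
  by (intro idl_gen) (auto simp: tower_gens_def)

lemma zf_mult_zf:
  assumes "F \<in> L" "i \<notin> F" "G \<in> L" "i \<notin> G" "\<not> F \<subseteq> G" "\<not> G \<subseteq> F"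
    and "F \<in> both_flats \<Longrightarrow> F \<in> U" "G \<in> both_flats \<Longrightarrow> G \<in> U"
  shows "zf F * zf G \<in> tower_ideal U"
proof -
  have F: "D.xf F * D.xf G \<in> tower_ideal U"
    using assms by (intro core_in_tower D.xf_incomparable_core)
  have a: "ev F * D.xf G \<in> tower_ideal U" if "F \<in> both_flats"
    using assms that flat_in_deletion by (intro tower_comp comp_gens_incomparable) auto
  have b: "ev G * D.xf F \<in> tower_ideal U" if "G \<in> both_flats"
    using assms that flat_in_deletion by (intro tower_comp comp_gens_incomparable) auto
  have c: "ev F * ev G \<in> tower_ideal U" if "F \<in> both_flats" "G \<in> both_flats"
    using assms that by (intro tower_incomparable) auto
  define \<phi> where "\<phi> = (if F \<in> both_flats then ev F else 0)"
  define \<gamma> where "\<gamma> = (if G \<in> both_flats then ev G else 0)"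
  have "zf F * zf G = D.xf F * D.xf G - \<phi> * D.xf G - \<gamma> * D.xf F + \<phi> * \<gamma>"
    by (simp add: zf_def \<phi>_def \<gamma>_def algebra_simps)
  also have "\<dots> \<in> tower_ideal U"
    using F a b c by (intro idl_add idl_diff) (auto simp: \<phi>_def \<gamma>_def idl_0)
  finally show ?thesis .
qed

text \<open>In the matroid \<open>insert i G\<close> and \<open>H\<close> are incomparable. In the
  tower, if \<open>H\<close> is above \<open>G\<close>, the product vanishes by the chain relation
  or by the annihilator of \<open>e_G\<close>, depending on whether \<open>insert i H\<close> is a
  flat; otherwise both terms of \<open>zf H\<close> give zero.\<close>

lemma ev_mult_zf:
  assumes "G \<in> U" "G \<in> both_flats" "H \<in> L" "i \<notin> H" "\<not> H \<subseteq> G"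
    and "H \<in> both_flats \<Longrightarrow> H \<in> U"
  shows "ev G * zf H \<in> tower_ideal U"
proof (cases "G \<subseteq> H")
  case True
  then have GH: "G \<subset> H" using assms by blast
  show ?thesis
  proof (cases "H \<in> both_flats")
    case True
    have "ev G * zf H = - (ev G * ev H - D.xf H * ev G)"
      using True by (simp add: zf_def algebra_simps)
    then show ?thesis using tower_psubset[of G U H] assms True GH by (simp only: idl_uminus)
  next
    case False
    then have "insert i H \<notin> L" using assms by (auto simp: both_flats_def)
    then show ?thesis
      using tower_comp[OF assms(1) comp_gens_above[of H]] assms False GH flat_in_deletion
      by (simp add: zf_def)
  qed
next
  case False
  have 1: "ev G * D.xf H \<in> tower_ideal U"
    using assms False flat_in_deletion by (intro tower_comp comp_gens_incomparable) auto
  have 2: "ev G * ev H \<in> tower_ideal U" if "H \<in> both_flats"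
    using assms False that by (intro tower_incomparable) auto
  show ?thesis using 1 2 by (auto simp: zf_def right_diff_distrib intro: idl_diff)
qed

lemma zf_both: "F \<in> both_flats \<Longrightarrow> zf F = D.xf F - ev F"
  by (simp add: zf_def)

text \<open>The quadratic relation says that \<open>x\<^sub>G - e\<^sub>G\<close> annihilates \<open>y\<^sub>i\<close>.\<close>

lemma zf_mult_quad:
  assumes G: "G \<in> U" "G \<in> both_flats" and U: "\<And>H. H \<in> both_flats \<Longrightarrow> G \<subset> H \<Longrightarrow> H \<in> U"
  shows "zf G * (below_sum G - ev G + (\<Sum>H\<in>{H \<in> L. i \<notin> H \<and> G \<subset> H}. zf H)) \<in> tower_ideal U"
proof -
  let ?w = "\<Sum>H\<in>{H \<in> L. i \<notin> H \<and> G \<subset> H}. zf H"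
  have "zf G * (below_sum G - ev G + ?w) = quad_rel G - ev G * ?w"
    by (simp add: zf_both[OF G(2)] quad_rel_def quad_const_def algebra_simps)
  moreover have "ev G * ?w \<in> tower_ideal U"
    unfolding sum_distrib_left using assms by (intro idl_sum ev_mult_zf) auto
  ultimately show ?thesis using tower_quad[OF G(1)] by (simp add: idl_diff)
qed

text \<open>Summed over \<open>H\<close>, this differs from \<open>\<Sum> (x\<^sub>H - e\<^sub>H)\<close> by terms that \<open>x\<^sub>G - e\<^sub>G\<close> annihilates.\<close>

definition local_zf :: "'a set \<Rightarrow> 'a set \<Rightarrow> 'a chow_poly" where
  "local_zf G H = (if H \<subset> G then D.xf H else if G \<subseteq> H then zf H else 0)"

lemma sum_local_zf:
  assumes G: "G \<in> both_flats"
  shows "(\<Sum>H\<in>{H \<in> L. i \<notin> H}. local_zf G H) =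
    below_sum G - ev G + (\<Sum>H\<in>{H \<in> L. i \<notin> H \<and> G \<subset> H}. zf H)"
proof -
  note GD = both_flatsD[OF G]
  let ?B = "{H \<in> L. H \<subset> G}" and ?A = "{H \<in> L. i \<notin> H \<and> G \<subset> H}"
    and ?N = "{H \<in> L. i \<notin> H \<and> \<not> G \<subseteq> H \<and> \<not> H \<subseteq> G}"
  have "{H \<in> L. i \<notin> H} = insert G (?B \<union> (?A \<union> ?N))" using GD by auto
  then have "(\<Sum>H\<in>{H \<in> L. i \<notin> H}. local_zf G H) = local_zf G G + (\<Sum>H\<in>?B \<union> (?A \<union> ?N). local_zf G H)"
    using M.finite_L by simp
  also have "(\<Sum>H\<in>?B \<union> (?A \<union> ?N). local_zf G H) = (\<Sum>H\<in>?B. local_zf G H) + (\<Sum>H\<in>?A \<union> ?N. local_zf G H)"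
    using M.finite_L by (intro sum.union_disjoint) auto
  also have "(\<Sum>H\<in>?A \<union> ?N. local_zf G H) = (\<Sum>H\<in>?A. local_zf G H) + (\<Sum>H\<in>?N. local_zf G H)"
    using M.finite_L by (intro sum.union_disjoint) auto
  also have "(\<Sum>H\<in>?N. local_zf G H) = 0"
    by (intro sum.neutral) (auto simp: local_zf_def)
  also have "(\<Sum>H\<in>?A. local_zf G H) = (\<Sum>H\<in>?A. zf H)"
    by (intro sum.cong) (auto simp: local_zf_def)
  also have "(\<Sum>H\<in>?B. local_zf G H) = (\<Sum>H\<in>?B. D.xf H)"
    by (intro sum.cong) (auto simp: local_zf_def)
  also have "local_zf G G = D.xf G - ev G" using zf_both[OF G] by (simp add: local_zf_def)
  finally show ?thesis
  proof -
    assume *: "(\<Sum>H\<in>{H \<in> L. i \<notin> H}. local_zf G H) =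
      D.xf G - ev G + ((\<Sum>H\<in>?B. D.xf H) + ((\<Sum>H\<in>?A. zf H) + 0))"
    have "{H \<in> L. H \<subseteq> G} = insert G ?B" using GD by auto
    then have "below_sum G = D.xf G + (\<Sum>H\<in>?B. D.xf H)"
      using M.finite_L by (simp add: below_sum_def)
    then show ?thesis using * by simp
  qed
qed

lemma zf_mult_ev:
  assumes "G \<in> U" "G \<in> both_flats" "H \<in> U" "H \<subset> G"
  shows "zf G * ev H \<in> tower_ideal U"
proof -
  have "zf G * ev H = - (ev H * ev G - D.xf G * ev H)"
    by (simp add: zf_both[OF assms(2)] algebra_simps)
  then show ?thesis using tower_psubset[of H U G] assms by (simp only: idl_uminus)
qed

text \<open>Above a flat \<open>H\<close> modulo which \<open>i\<close> is parallel to some \<open>j\<close>, the relation \<open>x\<^sub>H y\<^sub>j = 0\<close>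
  plays the role of \<open>x\<^sub>H y\<^sub>i = 0\<close>.\<close>

lemma xf_mult_parallel:
  assumes H: "H \<in> L" "i \<notin> H" "insert i H \<notin> L"
  shows "D.xf H * (\<Sum>G\<in>{G \<in> L. i \<notin> G}. D.xf G) \<in> idl (chow_core_gens E' L')"
proof -
  obtain j where j: "j \<in> E'" "j \<notin> H" "\<And>G. G \<in> L' \<Longrightarrow> H \<subseteq> G \<Longrightarrow> G \<in> L \<longleftrightarrow> j \<notin> G"
    using parallel_element[OF H] by blast
  have "D.xf H * (\<Sum>G\<in>{G \<in> L. i \<notin> G}. D.xf G) - D.xf H * (\<Sum>G\<in>{G \<in> L'. j \<notin> G}. D.xf G)
      \<in> idl (chow_core_gens E' L')"
  proof (rule idl_sum_diff_sets)
    fix G assume G: "G \<in> ({G \<in> L. i \<notin> G} - {G \<in> L'. j \<notin> G}) \<union> ({G \<in> L'. j \<notin> G} - {G \<in> L. i \<notin> G})"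
    have "\<not> H \<subseteq> G" using G j(3)[of G] flat_in_deletion by (auto simp: mem_deletion_iff)
    moreover have "\<not> G \<subseteq> H"
      using G j(2) deletion_flat_below[of G H] H flat_in_deletion by (auto simp: mem_deletion_iff)
    ultimately show "D.xf H * D.xf G \<in> idl (chow_core_gens E' L')"
      by (intro D.xf_incomparable_core)
  qed (use M.finite_L D.finite_L in auto)
  moreover have "D.xf H * (\<Sum>G\<in>{G \<in> L'. j \<notin> G}. D.xf G) \<in> idl (chow_core_gens E' L')"
    using D.xf_sum_avoiding_core j by blast
  ultimately show ?thesis using idl_cong_mem by blast
qed

text \<open>\<open>H\<close> is not below \<open>G\<close> by \<open>both_flats_below\<close>;
  whether above \<open>G\<close> or incomparable to it, \<open>x_H\<close> is a generator of the
  annihilator of \<open>e_G\<close>.\<close>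

lemma xf_mult_ev:
  assumes "H \<in> L" "i \<notin> H" "insert i H \<notin> L" "G \<in> both_flats" "G \<in> U"
  shows "D.xf H * ev G \<in> tower_ideal U"
proof -
  have "\<not> H \<subseteq> G" using both_flats_below assms by (auto simp: both_flats_def)
  then have "D.xf H \<in> comp_gens G"
    using assms flat_in_deletion comp_gens_above[of H G] comp_gens_incomparable[of H G] by blast
  then show ?thesis using tower_comp[of G U "D.xf H"] assms by (simp add: mult.commute)
qed

text \<open>The ideal \<open>K\<close> for adjoining \<open>e_F\<close> to the stage
  \<open>U\<close>: the relations of the next stage that are linear in \<open>ev F\<close>, with
  \<open>ev F\<close> divided out, together with the relations of the stage itself, so that
  \<open>K\<close> contains \<open>I\<close>.\<close>

definition comp_tower_gens :: "'a set set \<Rightarrow> 'a set \<Rightarrow> 'a chow_poly set" where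
  "comp_tower_gens U F = comp_gens F \<union> {ev G - D.xf G | G. G \<in> U \<and> F \<subset> G} \<union>
     {ev G | G. G \<in> U \<and> \<not> F \<subseteq> G \<and> \<not> G \<subseteq> F} \<union> tower_gens U"

text \<open>One common index set, the flats avoiding \<open>i\<close>, allows termwise comparison
  with the other sums that represent \<open>y_i\<close>.\<close>

lemma quad_const_eq:
  assumes "F \<in> both_flats"
  shows "quad_const F = - D.xf F *
    (\<Sum>H\<in>{H \<in> L. i \<notin> H}. if H \<subseteq> F then D.xf H else if F \<subset> H then zf H else 0)"
proof -
  note FD = both_flatsD[OF assms]
  let ?f = "\<lambda>H. if H \<subseteq> F then D.xf H else if F \<subset> H then zf H else 0"
  let ?B = "{H \<in> L. H \<subseteq> F}" and ?A = "{H \<in> L. i \<notin> H \<and> F \<subset> H}"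
    and ?N = "{H \<in> L. i \<notin> H \<and> \<not> F \<subseteq> H \<and> \<not> H \<subseteq> F}"
  have "{H \<in> L. i \<notin> H} = ?B \<union> (?A \<union> ?N)" using FD by auto
  then have "(\<Sum>H\<in>{H \<in> L. i \<notin> H}. ?f H) = (\<Sum>H\<in>?B \<union> (?A \<union> ?N). ?f H)" by simp
  also have "\<dots> = (\<Sum>H\<in>?B. ?f H) + (\<Sum>H\<in>?A \<union> ?N. ?f H)"
    using M.finite_L by (intro sum.union_disjoint) auto
  also have "(\<Sum>H\<in>?A \<union> ?N. ?f H) = (\<Sum>H\<in>?A. ?f H) + (\<Sum>H\<in>?N. ?f H)"
    using M.finite_L by (intro sum.union_disjoint) auto
  also have "(\<Sum>H\<in>?N. ?f H) = 0" by (intro sum.neutral) auto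
  also have "(\<Sum>H\<in>?A. ?f H) = (\<Sum>H\<in>?A. zf H)" by (intro sum.cong) auto
  also have "(\<Sum>H\<in>?B. ?f H) = below_sum F" unfolding below_sum_def by (intro sum.cong) auto
  finally show ?thesis by (simp add: quad_const_def)
qed

text \<open>The condition \<open>K q = 0\<close>. Generators that kill \<open>x_F\<close> are
  immediate, as it divides \<open>q\<close>. For the decisive ones the other factor of
  \<open>q\<close> is compared term by term with a sum representing \<open>y_i\<close> that is
  already known to be annihilated.\<close>

lemma comp_tower_quad_const:
  assumes U: "up_closed U" and UF: "up_closed (insert F U)" "F \<notin> U"
    and k: "k \<in> idl (comp_tower_gens U F)"
  shows "k * quad_const F \<in> tower_ideal U"
  using k
proof induction
  case (idl_gen g)
  have F: "F \<in> both_flats" using UF by (auto simp: up_closed_def)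
  note FD = both_flatsD[OF F]
  have above: "H \<in> U" if "H \<in> both_flats" "F \<subset> H" for H
    using UF that by (auto simp: up_closed_def)
  let ?f = "\<lambda>H. if H \<subseteq> F then D.xf H else if F \<subset> H then zf H else 0"
  let ?S = "\<Sum>H\<in>{H \<in> L. i \<notin> H}. ?f H"
  note q = quad_const_eq[OF F]
  have core: "g * quad_const F \<in> tower_ideal U" if "g * D.xf F \<in> tower_ideal U" for g
  proof -
    have "g * quad_const F = - (?S * (g * D.xf F))" unfolding q by (simp add: algebra_simps)
    then show ?thesis using that by (simp only: idl_uminus idl_mult)
  qed
  consider "g \<in> comp_gens F" | G where "G \<in> U" "F \<subset> G" "g = ev G - D.xf G"
    | G where "G \<in> U" "\<not> F \<subseteq> G" "\<not> G \<subseteq> F" "g = ev G" | "g \<in> tower_gens U"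
    using idl_gen unfolding comp_tower_gens_def by blast
  then show ?case
  proof cases
    case 1
    then show ?thesis
    proof (cases rule: comp_gens_cases)
      case core
      then show ?thesis by (intro idl_mult_right core_in_tower idl.idl_gen)
    next
      case (Y j)
      then show ?thesis by (intro core core_in_tower) (simp add: D.var_Y_xf_core)
    next
      case (incomparable G)
      then show ?thesis by (intro core core_in_tower) (simp add: D.xf_incomparable_core)
    next
      case (above H)
      then have H: "H \<in> L" "i \<notin> H" by (auto simp: mem_deletion_iff)
      let ?c = "D.xf H * D.xf F"
      \<comment> \<open>After multiplication by \<open>x_H x_F\<close> each term may be replaced by
        \<open>x_G\<close>: flats incomparable to \<open>F\<close> are killed by \<open>x_F\<close>,
        and the \<open>e_G\<close> that occur are killed by \<open>x_H\<close>. The resulting sum is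
        the one of \<open>xf_mult_parallel\<close>.\<close>
      have "?c * (\<Sum>G\<in>{G \<in> L. i \<notin> G}. ?f G) - ?c * (\<Sum>G\<in>{G \<in> L. i \<notin> G}. D.xf G) \<in> tower_ideal U"
      proof (rule idl_sum_cong)
        fix G assume G: "G \<in> {G \<in> L. i \<notin> G}"
        have "D.xf F * D.xf G \<in> tower_ideal U" if "\<not> G \<subseteq> F" "\<not> F \<subset> G"
          using that by (intro core_in_tower D.xf_incomparable_core) auto
        then have 1: "?c * (0 - D.xf G) \<in> tower_ideal U" if "\<not> G \<subseteq> F" "\<not> F \<subset> G"
          using that idl_mult[of "D.xf F * D.xf G" _ "- D.xf H"] by (simp add: mult_ac)
        have "D.xf H * ev G \<in> tower_ideal U" if "G \<in> both_flats" "F \<subset> G"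
          using xf_mult_ev H above that \<open>\<And>H. H \<in> both_flats \<Longrightarrow> F \<subset> H \<Longrightarrow> H \<in> U\<close> by blast
        then have 2: "?c * (zf G - D.xf G) \<in> tower_ideal U" if "F \<subset> G"
          using that idl_mult[of "D.xf H * ev G" _ "- D.xf F"] by (auto simp: zf_def mult_ac idl_0)
        show "?c * (?f G - D.xf G) \<in> tower_ideal U"
          using 1 2 by (auto simp: idl_0)
      qed
      moreover have "?c * (\<Sum>G\<in>{G \<in> L. i \<notin> G}. D.xf G) \<in> tower_ideal U"
        using idl_mult[OF core_in_tower[OF xf_mult_parallel[OF H above(3)]], of "D.xf F"]
        by (simp add: mult_ac)
      ultimately have "?c * ?S \<in> tower_ideal U" using idl_cong_mem by blast
      then have "- (?c * ?S) \<in> tower_ideal U" by (rule idl_uminus)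
      then show ?thesis unfolding q above(4) by (simp add: mult_ac)
    qed
  next
    case (2 G)
    have Gb: "G \<in> both_flats" using 2 U by (auto simp: up_closed_def)
    note GD = both_flatsD[OF Gb]
    \<comment> \<open>Up to sign the generator is \<open>zf G\<close>, so the sum to compare with
      comes from the quadratic equation of \<open>G\<close>. The five cases below are the positions
      of \<open>H\<close> relative to \<open>F\<close> and \<open>G\<close>; where the terms differ,
      the difference is killed by \<open>zf G\<close> or by \<open>x_F\<close>.\<close>
    let ?c = "zf G * D.xf F"
    have "?c * (\<Sum>H\<in>{H \<in> L. i \<notin> H}. ?f H) - ?c * (\<Sum>H\<in>{H \<in> L. i \<notin> H}. local_zf G H) \<in> tower_ideal U"
    proof (rule idl_sum_cong)
      fix H assume H: "H \<in> {H \<in> L. i \<notin> H}"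
      have zero: "?c * d \<in> tower_ideal U" if "zf G * d \<in> tower_ideal U" for d
        using idl_mult[OF that, of "D.xf F"] by (simp add: mult_ac)
      consider "H \<subseteq> F" | "F \<subset> H" "H \<subset> G" | "F \<subset> H" "G \<subseteq> H"
        | "F \<subset> H" "\<not> H \<subseteq> G" "\<not> G \<subseteq> H" | "\<not> H \<subseteq> F" "\<not> F \<subseteq> H" by blast
      then show "?c * (?f H - local_zf G H) \<in> tower_ideal U"
      proof cases
        case 1
        then have "?f H = local_zf G H" using 2 by (auto simp: local_zf_def)
        then show ?thesis by (simp add: idl_0)
      next
        case hyp: 2
        have "zf G * ev H \<in> tower_ideal U" if "H \<in> both_flats"
          using zf_mult_ev[OF 2(1) Gb above[OF that]] hyp by blast
        then have "zf G * (zf H - D.xf H) \<in> tower_ideal U"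
          by (auto simp: zf_def idl_0 intro: idl_uminus)
        then show ?thesis using zero hyp by (auto simp: local_zf_def)
      next
        case 3
        then have "?f H = local_zf G H" using 2 by (auto simp: local_zf_def)
        then show ?thesis by (simp add: idl_0)
      next
        case 4
        have "zf G * zf H \<in> tower_ideal U"
          using 4 H GD 2(1) above by (intro zf_mult_zf) auto
        then show ?thesis using zero 4 by (auto simp: local_zf_def)
      next
        case 5
        then have f: "?f H = 0" by auto
        have "D.xf F * D.xf H \<in> tower_ideal U"
          using 5 by (intro core_in_tower D.xf_incomparable_core) auto
        then have "?c * (0 - D.xf H) \<in> tower_ideal U"
          using idl_mult[of "D.xf F * D.xf H" _ "- zf G"] by (simp add: mult_ac)
        then show ?thesis using f 5 2 by (auto simp: local_zf_def idl_0)
      qed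
    qed
    moreover have "?c * (\<Sum>H\<in>{H \<in> L. i \<notin> H}. local_zf G H) \<in> tower_ideal U"
      using idl_mult[OF zf_mult_quad[OF 2(1) Gb], of "D.xf F"] above 2 sum_local_zf[OF Gb]
      by (auto simp: mult_ac)
    ultimately have "?c * ?S \<in> tower_ideal U" using idl_cong_mem by blast
    moreover have "g * quad_const F = ?c * ?S"
      unfolding q 2(3) zf_both[OF Gb] by (simp add: algebra_simps)
    ultimately show ?thesis by simp
  next
    case (3 G)
    then show ?thesis using FD by (intro core) (simp add: tower_comp comp_gens_incomparable)
  next
    case 4
    then show ?thesis by (intro idl_mult_right idl.idl_gen)
  qed
next
  case (idl_add p q)
  then show ?case by (simp add: distrib_right idl.idl_add)
next
  case (idl_mult p r)
  then show ?case by (simp add: mult.assoc idl.idl_mult)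
qed (simp add: idl_0)

lemma tower_gensI:
  "g \<in> chow_core_gens E' L' \<Longrightarrow> g \<in> tower_gens U"
  "F \<in> U \<Longrightarrow> k \<in> comp_gens F \<Longrightarrow> k * ev F \<in> tower_gens U"
  "F \<in> U \<Longrightarrow> G \<in> U \<Longrightarrow> F \<subset> G \<Longrightarrow> ev F * ev G - D.xf G * ev F \<in> tower_gens U"
  "F \<in> U \<Longrightarrow> G \<in> U \<Longrightarrow> \<not> F \<subseteq> G \<Longrightarrow> \<not> G \<subseteq> F \<Longrightarrow> ev F * ev G \<in> tower_gens U"
  "F \<in> U \<Longrightarrow> quad_rel F \<in> tower_gens U"
  by (auto simp: tower_gens_def)

lemma comp_tower_gensI:
  "g \<in> comp_gens F \<Longrightarrow> g \<in> comp_tower_gens U F"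
  "G \<in> U \<Longrightarrow> F \<subset> G \<Longrightarrow> ev G - D.xf G \<in> comp_tower_gens U F"
  "G \<in> U \<Longrightarrow> \<not> F \<subseteq> G \<Longrightarrow> \<not> G \<subseteq> F \<Longrightarrow> ev G \<in> comp_tower_gens U F"
  by (auto simp: comp_tower_gens_def)

lemma tower_gens_cases [consumes 1, case_names core comp chain incomparable quad]:
  assumes "g \<in> tower_gens U"
  obtains "g \<in> chow_core_gens E' L'"
  | G k where "G \<in> U" "k \<in> comp_gens G" "g = k * ev G"
  | G H where "G \<in> U" "H \<in> U" "G \<subset> H" "g = ev G * ev H - D.xf H * ev G"
  | G H where "G \<in> U" "H \<in> U" "\<not> G \<subseteq> H" "\<not> H \<subseteq> G" "g = ev G * ev H"
  | G where "G \<in> U" "g = quad_rel G"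
  using assms unfolding tower_gens_def Un_iff UN_iff image_iff mem_Collect_eq Bex_def
  by (elim disjE exE conjE) (rule that; assumption)+

lemma comp_tower_gens_cases [consumes 1, case_names comp above incomparable tower]:
  assumes "g \<in> comp_tower_gens U F"
  obtains "g \<in> comp_gens F"
  | G where "G \<in> U" "F \<subset> G" "g = ev G - D.xf G"
  | G where "G \<in> U" "\<not> F \<subseteq> G" "\<not> G \<subseteq> F" "g = ev G"
  | "g \<in> tower_gens U"
  using assms unfolding comp_tower_gens_def Un_iff mem_Collect_eq
  by (elim disjE exE conjE) (rule that; assumption)+

text \<open>On multiples of \<open>e\<^sub>F\<close> the element \<open>e\<^sub>G\<close> acts as \<open>x\<^sub>G\<close> if \<open>F \<subset> G\<close>, and as \<open>0\<close> if \<open>F\<close> and \<open>G\<close>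
  are incomparable.\<close>

definition forget_var :: "'a set \<Rightarrow> 'a chow_var \<Rightarrow> 'a chow_poly" where
  "forget_var F v = (case v of Y j \<Rightarrow> poly_var v
    | X H \<Rightarrow> if i \<in> H then (if F \<subset> H - {i} then D.xf (H - {i}) else 0) else poly_var v)"

definition forget :: "'a set \<Rightarrow> 'a chow_poly \<Rightarrow> 'a chow_poly" where
  "forget F = poly_eval poly_const (forget_var F)"

lemmas forget_simps = poly_eval_simps[OF scalar_hom_const, of "forget_var F" for F, folded forget_def]

lemma forget_old:
  assumes "poly_vars p \<subseteq> old_vars"
  shows "forget F p = p"
  using assms
proof (induction p rule: poly_vars_induct)
  case (var v)
  then show ?case
    by (auto simp: forget_simps forget_var_def matroid_vars_def proper_flats_def mem_deletion_iff)
qed (simp_all add: forget_simps)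

lemma forget_xf: "forget F (D.xf G) = D.xf G"
  by (rule forget_old) (rule poly_vars_D_xf)

lemma forget_ev: "i \<notin> G \<Longrightarrow> forget F (ev G) = (if F \<subset> G then D.xf G else 0)"
  by (simp add: ev_def forget_simps forget_var_def)

text \<open>The annihilator of \<open>e_F\<close> grows along the tower but gains no element of the
  Chow ring of the deletion: \<open>forget F\<close> fixes the old variables and collapses the
  larger ideal to the original one.\<close>

lemma forget_tower:
  assumes U: "up_closed U" and UF: "up_closed (insert F U)" "F \<notin> U"
    and k: "k \<in> idl (comp_tower_gens U F)"
  shows "forget F k \<in> idl (comp_gens F)"
proof (rule idl_hom_image[OF k, where h = "forget F"])
  let ?K = "idl (comp_gens F)"
  have F: "F \<in> both_flats" using UF by (auto simp: up_closed_def)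
  have Ub: "G \<in> both_flats" if "G \<in> U" for G using U that by (auto simp: up_closed_def)
  \<comment> \<open>\<open>F\<close> is minimal in \<open>insert F U\<close>, because
    \<open>U\<close> is up-closed and misses \<open>F\<close>.\<close>
  have notbelow: "\<not> G \<subseteq> F" if "G \<in> U" for G
  proof
    assume "G \<subseteq> F"
    then have "G \<subset> F" using UF(2) that by auto
    then have "F \<in> U" using U that F unfolding up_closed_def by blast
    then show False using UF(2) by blast
  qed
  have core: "p \<in> ?K" if "p \<in> idl (chow_core_gens E' L')" for p
    using that by (rule idl_subset) (auto intro: idl_gen comp_gens_core)
  have gen: "p \<in> ?K" if "p \<in> comp_gens F" for p
    using that by (rule idl_gen)
  have old: "forget F p = p" if "p \<in> comp_gens G" for p G
    using that by (intro forget_old poly_vars_comp_gens)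
  fix g assume "g \<in> comp_tower_gens U F"
  then show "forget F g \<in> ?K"
  proof (cases rule: comp_tower_gens_cases)
    case comp
    then show ?thesis using old gen by simp
  next
    case (above G)
    then have "forget F g = 0" using Ub both_flatsD by (simp add: forget_simps forget_xf forget_ev)
    then show ?thesis by (simp add: idl_0)
  next
    case (incomparable G)
    then have "forget F g = 0" using Ub both_flatsD by (simp add: forget_ev)
    then show ?thesis by (simp add: idl_0)
  next
    case tower
    then show ?thesis
    proof (cases rule: tower_gens_cases)
      case core
      then have "g \<in> comp_gens F" by (rule comp_gens_core)
      then show ?thesis using old gen by simp
    next
      case (comp G k)
      note GD = both_flatsD[OF Ub[OF comp(1)]]
      have eq: "forget F g = k * (if F \<subset> G then D.xf G else 0)"
        using comp GD by (simp add: forget_simps forget_ev old)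
      have "k * D.xf G \<in> ?K" if FG: "F \<subset> G"
        using comp(2)
      proof (cases rule: comp_gens_cases)
        case core
        then show ?thesis by (intro idl_mult_right gen comp_gens_core)
      next
        case (Y j)
        then show ?thesis by (intro core) (simp add: D.var_Y_xf_core)
      next
        case (incomparable H)
        then show ?thesis by (intro core) (simp add: D.xf_incomparable_core)
      next
        case (above H)
        then have "F \<subset> H" using FG by blast
        then show ?thesis using above comp_gens_above by (intro idl_mult_right gen) blast
      qed
      then show ?thesis by (simp add: eq idl_0)
    next
      case (chain G H)
      have "F \<subset> H" if "F \<subset> G" using that chain by blast
      then have "forget F g = 0"
        using chain Ub both_flatsD by (simp add: forget_simps forget_ev forget_xf)
      then show ?thesis by (simp add: idl_0)
    next
      case (incomparable G H)
      have "D.xf G * D.xf H \<in> ?K" using incomparable by (intro core D.xf_incomparable_core)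
      then show ?thesis
        using incomparable Ub both_flatsD by (auto simp: forget_simps forget_ev idl_0)
    next
      case (quad G)
      note GD = both_flatsD[OF Ub[OF quad(1)]]
      let ?A = "{H \<in> L. i \<notin> H \<and> G \<subset> H}"
      have b: "forget F (below_sum G) = below_sum G"
        by (simp add: below_sum_def forget_simps forget_xf)
      have q: "forget F (quad_const G) = - D.xf G * (below_sum G + (\<Sum>H\<in>?A. forget F (zf H)))"
        by (simp add: quad_const_def forget_simps forget_xf b)
      show ?thesis
      proof (cases "F \<subset> G")
        case True
        \<comment> \<open>With \<open>ev G\<close> sent to \<open>x_G\<close>, the square and the
          linear term cancel against the \<open>below_sum G\<close> part of the constant term; the
          images of the \<open>zf H\<close> that remain are zero or generators.\<close>
        have "forget F g = D.xf G * (\<Sum>H\<in>?A. forget F (zf H))"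
          using True GD
          by (simp add: quad quad_rel_def forget_simps forget_ev forget_xf b q algebra_simps)
        moreover have "forget F (zf H) \<in> ?K" if H: "H \<in> ?A" for H
        proof (cases "H \<in> both_flats")
          case True
          then show ?thesis using H \<open>F \<subset> G\<close>
            by (auto simp: zf_def forget_simps forget_xf forget_ev idl_0)
        next
          case False
          then have "D.xf H \<in> comp_gens F"
            using H \<open>F \<subset> G\<close> flat_in_deletion by (intro comp_gens_above) (auto simp: both_flats_def)
          then show ?thesis using False gen by (simp add: zf_def forget_xf)
        qed
        ultimately show ?thesis by (auto intro!: idl_mult idl_sum)
      next
        case False
        then have "\<not> F \<subseteq> G" "\<not> G \<subseteq> F" using notbelow quad by auto
        then have "D.xf G \<in> ?K" using GD by (intro gen comp_gens_incomparable)
        moreover have "forget F g = (below_sum G + (\<Sum>H\<in>?A. forget F (zf H))) * D.xf G"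
          using False GD
          by (simp add: quad quad_rel_def forget_simps forget_ev forget_xf b q algebra_simps)
        ultimately show ?thesis by (simp add: idl_mult)
      qed
    qed
  qed
qed (simp_all add: forget_simps)

lemma poly_vars_zf: "poly_vars (zf H) \<subseteq> old_vars \<union> (if H \<in> both_flats then {X (insert i H)} else {})"
  unfolding zf_def
proof (rule poly_vars_subsetI(2))
  show "poly_vars (D.xf H) \<subseteq> old_vars \<union> (if H \<in> both_flats then {X (insert i H)} else {})"
    using poly_vars_D_xf[of H] by blast
qed simp

lemma poly_vars_below_sum: "poly_vars (below_sum F) \<subseteq> old_vars"
  unfolding below_sum_def by (intro poly_vars_sum_subsetI poly_vars_D_xf)

lemma poly_vars_quad_const:
  "poly_vars (quad_const G) \<subseteq> old_vars \<union> (\<lambda>H. X (insert i H)) ` {H \<in> both_flats. G \<subset> H}"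
  unfolding quad_const_def
proof (intro poly_vars_subsetI poly_vars_sum_subsetI)
  fix H assume "H \<in> {H \<in> L. i \<notin> H \<and> G \<subset> H}"
  then show "poly_vars (zf H) \<subseteq> old_vars \<union> (\<lambda>H. X (insert i H)) ` {H \<in> both_flats. G \<subset> H}"
    using poly_vars_zf[of H] by (auto split: if_splits)
qed (use poly_vars_D_xf poly_vars_below_sum in blast)+

lemma poly_vars_tower_gens:
  assumes U: "up_closed U" and g: "g \<in> tower_gens U"
  shows "poly_vars g \<subseteq> old_vars \<union> (\<lambda>H. X (insert i H)) ` U"
proof -
  let ?V = "old_vars \<union> (\<lambda>H. X (insert i H)) ` U"
  have old: "poly_vars (D.xf G) \<subseteq> ?V" for G using poly_vars_D_xf by blast
  have ev: "poly_vars (ev G) \<subseteq> ?V" if "G \<in> U" for G using that by simp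
  from g show ?thesis
  proof (cases rule: tower_gens_cases)
    case core
    then show ?thesis using poly_vars_chow_core_gens by blast
  next
    case (comp G k)
    show ?thesis unfolding comp(3)
      by (intro poly_vars_subsetI ev comp) (use poly_vars_comp_gens comp in blast)
  next
    case (chain G H)
    show ?thesis unfolding chain(4) by (intro poly_vars_subsetI ev old chain(1,2))
  next
    case (incomparable G H)
    show ?thesis unfolding incomparable(5) by (intro poly_vars_subsetI ev old incomparable(1,2))
  next
    case (quad G)
    have below: "poly_vars (below_sum G) \<subseteq> ?V" using poly_vars_below_sum by blast
    have "{H \<in> both_flats. G \<subset> H} \<subseteq> U" using U quad(1) unfolding up_closed_def by blast
    then have const: "poly_vars (quad_const G) \<subseteq> ?V"
      by (intro order.trans[OF poly_vars_quad_const] Un_mono image_mono order.refl)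
    show ?thesis
      unfolding quad(2) quad_rel_def by (intro poly_vars_subsetI ev old below const quad(1))
  qed
qed

text \<open>The element \<open>e\<^sub>F\<close> of a minimal \<open>F \<in> U\<close> is adjoined last.\<close>

lemma tower_independent:
  assumes "up_closed U"
    and "poly_vars a \<subseteq> old_vars" and "\<And>F. poly_vars (b F) \<subseteq> old_vars"
    and "a + (\<Sum>F\<in>U. b F * ev F) \<in> tower_ideal U"
  shows "a \<in> idl (chow_core_gens E' L') \<and> (\<forall>F\<in>U. b F \<in> idl (comp_gens F))"
proof -
  have "finite U" using assms(1) finite_both_flats finite_subset by (auto simp: up_closed_def)
  then show ?thesis
    using assms
  proof (induction U arbitrary: a rule: finite_psubset_induct)
    case (psubset U)
    show ?case
    proof (cases "U = {}")
      case True
      then show ?thesis using psubset.prems(4) by (simp add: tower_gens_def)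
    next
      case False
      then obtain F where F: "F \<in> U" "\<And>G. G \<in> U \<Longrightarrow> G \<subseteq> F \<Longrightarrow> G = F"
        using finite_has_minimal[OF psubset.hyps] by metis
      define V where "V = U - {F}"
      have UV: "insert F V = U" "F \<notin> V" "V \<subset> U" "finite V"
        using F psubset.hyps by (auto simp: V_def)
      have Ub: "U \<subseteq> both_flats" using psubset.prems(1) by (simp add: up_closed_def)
      have F_i: "i \<notin> F" using Ub F(1) both_flatsD by blast
      have V: "up_closed V"
        unfolding up_closed_def
      proof (intro conjI ballI impI)
        show "V \<subseteq> both_flats" using Ub UV(3) by blast
        fix A B assume AB: "A \<in> V" "B \<in> both_flats" "A \<subset> B"
        then have "B \<in> U" using psubset.prems(1) UV(3) unfolding up_closed_def by blast
        moreover have "B \<noteq> F" using AB F(2)[of A] UV(2,3) by blast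
        ultimately show "B \<in> V" by (simp add: V_def)
      qed
      let ?v = "X (insert i F)"
      let ?S = "tower_gens V" and ?T = "comp_tower_gens V F"
      let ?p = "D.xf F + below_sum F" and ?q = "quad_const F"
      have inj: "insert i G = insert i F \<longleftrightarrow> G = F" if "G \<in> both_flats" for G
        using that F_i both_flatsD(2) by (auto simp: insert_ident)
      have notin: "?v \<notin> old_vars \<union> (\<lambda>H. X (insert i H)) ` V"
        using new_var[of F] inj Ub UV by auto
      have free_old: "?v \<notin> poly_vars p" if "poly_vars p \<subseteq> old_vars" for p
        using that new_var by blast
      have iso_old: "isolate_var ?v p = [:p:]" if "poly_vars p \<subseteq> old_vars" for p
        using that by (intro isolate_var_free free_old)
      have iso_F: "isolate_var ?v (ev F) = [:0, 1:]" by (simp add: ev_def isolate_var_simps)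
      have iso_G: "isolate_var ?v (ev G) = [:ev G:]" if "G \<in> V" for G
        using that notin by (intro isolate_var_free) auto
      have "?v \<notin> poly_vars ?q"
        using poly_vars_quad_const[of F] new_var[of F] inj by fastforce
      then have iso_q: "isolate_var ?v ?q = [:?q:]" by (rule isolate_var_free)
      have ST: "idl ?S \<subseteq> idl ?T" by (rule idl_mono) (auto simp: comp_tower_gens_def)
      \<comment> \<open>Modulo the quadratic of \<open>F\<close>, a generator without
        \<open>ev F\<close> is its own remainder, one linear in \<open>ev F\<close> leaves a
        generator of \<open>K\<close>, and the quadratic relation of \<open>F\<close> leaves
        nothing.\<close>
      have red: "fst (quad_red ?p ?q (isolate_var ?v g)) \<in> idl ?S \<and>
          snd (quad_red ?p ?q (isolate_var ?v g)) \<in> idl ?T" if "g \<in> tower_gens U" for g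
      proof -
        have inV: ?thesis if g: "g \<in> ?S"
        proof -
          have "isolate_var ?v g = [:g:]"
            using poly_vars_tower_gens[OF V g] notin by (intro isolate_var_free) blast
          then show ?thesis using g by (simp add: quad_red_pCons idl_0 idl_gen)
        qed
        from that show ?thesis
        proof (cases rule: tower_gens_cases)
          case core
          then show ?thesis by (intro inV tower_gensI)
        next
          case (comp G k)
          show ?thesis
          proof (cases "G = F")
            case True
            have "isolate_var ?v g = [:0, k:]"
              using comp True by (simp add: isolate_var_simps iso_F iso_old poly_vars_comp_gens)
            moreover have "k \<in> idl ?T"
              using comp True by (intro idl_gen comp_tower_gensI) simp
            ultimately show ?thesis by (simp add: quad_red_pCons idl_0)
          next
            case False
            then have "G \<in> V" using comp by (simp add: V_def)
            then show ?thesis unfolding comp(3) using comp(2) by (intro inV[unfolded comp(3)] tower_gensI)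
          qed
        next
          case (chain G H)
          have HF: "H \<noteq> F" using chain F(2)[of G] by auto
          then have HV: "H \<in> V" using chain by (simp add: V_def)
          show ?thesis
          proof (cases "G = F")
            case True
            have "isolate_var ?v g = [:0, ev H - D.xf H:]"
              using chain True HV by (simp add: isolate_var_simps iso_F iso_G iso_old poly_vars_D_xf)
            moreover have "ev H - D.xf H \<in> idl ?T"
              using chain True HV by (intro idl_gen comp_tower_gensI) simp_all
            ultimately show ?thesis by (simp add: quad_red_pCons idl_0)
          next
            case False
            then have "G \<in> V" using chain by (simp add: V_def)
            then show ?thesis
              unfolding chain(4) using chain(3) HV by (intro inV[unfolded chain(4)] tower_gensI)
          qed
        next
          case (incomparable G H)
          have *: ?thesis if GH: "G = F" "H \<in> V" "g = ev G * ev H" "\<not> G \<subseteq> H" "\<not> H \<subseteq> G" for G H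
          proof -
            have "isolate_var ?v g = [:0, ev H:]"
              using GH by (simp add: isolate_var_simps iso_F iso_G)
            moreover have "ev H \<in> idl ?T"
              using GH by (intro idl_gen comp_tower_gensI) simp_all
            ultimately show ?thesis by (simp add: quad_red_pCons idl_0)
          qed
          consider "G = F" "H \<in> V" | "H = F" "G \<in> V" | "G \<in> V" "H \<in> V"
            using incomparable unfolding V_def by blast
          then show ?thesis
          proof cases
            case 1
            then show ?thesis using *[of G H] incomparable by blast
          next
            case 2
            then show ?thesis using *[of H G] incomparable by (simp add: mult.commute)
          next
            case 3
            then show ?thesis
              unfolding incomparable(5) using incomparable(3,4)
              by (intro inV[unfolded incomparable(5)] tower_gensI)
          qed
        next
          case (quad G)
          show ?thesis
          proof (cases "G = F")
            case True
            have "isolate_var ?v ?p = [:?p:]"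
              by (intro iso_old poly_vars_subsetI poly_vars_D_xf poly_vars_below_sum)
            then have "isolate_var ?v g = [:- ?q, - ?p, 1:]"
              using quad True
              by (simp add: quad_rel_def isolate_var_simps(4) isolate_var_simps(8) iso_F iso_q)
            then show ?thesis by (simp add: quad_red_pCons idl_0)
          next
            case False
            then have "G \<in> V" using quad by (simp add: V_def)
            then show ?thesis unfolding quad(2) by (intro inV[unfolded quad(2)] tower_gensI)
          qed
        qed
      qed
      have sum: "a + (\<Sum>G\<in>U. b G * ev G) = (a + (\<Sum>G\<in>V. b G * ev G)) + b F * poly_var ?v"
        using UV(4,2) by (simp add: UV(1)[symmetric] ev_def)
      have step: "a + (\<Sum>G\<in>V. b G * ev G) \<in> idl ?S \<and> b F \<in> idl ?T"
      proof (rule quadratic_extension[OF ST _ red])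
        show "k * ?q \<in> idl ?S" if "k \<in> idl ?T" for k
          using comp_tower_quad_const[OF V _ _ that] psubset.prems(1) UV by simp
        show "a + (\<Sum>G\<in>V. b G * ev G) + b F * poly_var ?v \<in> idl (tower_gens U)"
          using psubset.prems(4) sum by simp
        have "poly_vars (a + (\<Sum>G\<in>V. b G * ev G)) \<subseteq> old_vars \<union> (\<lambda>H. X (insert i H)) ` V"
          using psubset.prems(2,3) by (intro poly_vars_subsetI poly_vars_sum_subsetI) auto
        then show "?v \<notin> poly_vars (a + (\<Sum>G\<in>V. b G * ev G))" using notin by blast
        show "?v \<notin> poly_vars (b F)" using psubset.prems(3) by (rule free_old)
      qed
      \<comment> \<open>The extension step places \<open>b F\<close> only in the ideal of the stage
        \<open>V\<close>; retracting by \<open>forget F\<close> brings it into the ideal over the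
        deletion.\<close>
      have "forget F (b F) \<in> idl (comp_gens F)"
        using step forget_tower[OF V] psubset.prems(1) UV by simp
      then have "b F \<in> idl (comp_gens F)" using forget_old psubset.prems(3) by simp
      moreover have "a \<in> idl (chow_core_gens E' L') \<and> (\<forall>G\<in>V. b G \<in> idl (comp_gens G))"
        using step psubset.IH[OF UV(3) V psubset.prems(2,3)] by blast
      ultimately show ?thesis using UV(1) by auto
    qed
  qed
qed

text \<open>The value that \<open>x_G\<close> must have, solved from
  \<open>\<theta> x_H = x_H + e_H\<close> for \<open>H = G - {i}\<close>; if \<open>i\<close> is in
  \<open>G\<close> and \<open>G - {i}\<close> is no flat, \<open>x_G\<close> is itself in the image
  of \<open>\<theta>\<close>.\<close>

definition lift_flat :: "'a set \<Rightarrow> 'a chow_poly" where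
  "lift_flat G = (if i \<in> G then (if G - {i} \<in> L then ev (G - {i}) else D.xf (G - {i})) else zf G)"

text \<open>\<open>y_i\<close> has no counterpart in the deletion and goes to the sum that its
  linear relation prescribes.\<close>

definition lift_var :: "'a chow_var \<Rightarrow> 'a chow_poly" where
  "lift_var v = (case v of
      Y j \<Rightarrow> if j = i then (\<Sum>G\<in>{G \<in> L. i \<notin> G}. zf G) else if j \<in> E' then poly_var (Y j) else 0
    | X G \<Rightarrow> if G \<in> proper_flats E L then lift_flat G else 0)"

definition lift :: "'a chow_poly \<Rightarrow> 'a chow_poly" where
  "lift = poly_eval poly_const lift_var"

lemmas lift_simps = poly_eval_simps[OF scalar_hom_const, of lift_var, folded lift_def]

lemma lift_flat_pair:
  assumes "G \<in> L'"
  shows "(if G \<in> L then lift_flat G else 0) + (if insert i G \<in> L then lift_flat (insert i G) else 0) = D.xf G"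
  using assms by (auto simp: mem_deletion_iff lift_flat_def zf_def both_flats_def)

lemma sum_lift_flat:
  assumes "\<And>G. i \<notin> G \<Longrightarrow> P (insert i G) = P G"
  shows "(\<Sum>F\<in>{F \<in> L. P F}. lift_flat F) = (\<Sum>G\<in>{G \<in> L'. P G}. D.xf G)"
proof -
  let ?f = "\<lambda>F. if F \<in> L then lift_flat F else 0"
  have "(\<Sum>G\<in>{G \<in> L'. P G}. D.xf G) = (\<Sum>G\<in>{G \<in> L'. P G}. ?f G + ?f (insert i G))"
    using lift_flat_pair by (intro sum.cong) auto
  also have "\<dots> = (\<Sum>F\<in>{F \<in> L. P F}. ?f F)"
    using assms by (intro sum_deletion_flats) auto
  finally show ?thesis by simp
qed

text \<open>As in \<open>\<theta>_xf\<close>, the value at the ground set is forced because all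
  flats sum to zero on both sides.\<close>

lemma lift_xf: "G \<in> L \<Longrightarrow> lift (M.xf G) = lift_flat G"
proof -
  have proper: "lift (M.xf G) = lift_flat G" if "G \<in> proper_flats E L" for G
    using that by (simp add: M.xf_proper lift_simps lift_var_def)
  assume G: "G \<in> L"
  show ?thesis
  proof (cases "G = E")
    case True
    have "lift (M.xf E) = - (\<Sum>G\<in>L - {E}. lift_flat G)"
      using M.ground_flat by (simp add: M.xf_def lift_simps lift_var_def M.proper_flats_eq)
    also have "\<dots> = lift_flat E - (\<Sum>G\<in>L. lift_flat G)"
      by (simp add: sum.remove[OF M.finite_L M.ground_flat])
    also have "(\<Sum>G\<in>L. lift_flat G) = 0"
      using sum_lift_flat[of "\<lambda>_. True"] D.sum_xf by simp
    finally show ?thesis using True by simp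
  next
    case False
    then show ?thesis using proper G by (simp add: proper_flats_def)
  qed
qed

lemma up_closed_both_flats: "up_closed both_flats"
  by (simp add: up_closed_def)

abbreviation "TI \<equiv> tower_ideal both_flats"

lemma lift_flat_mult_zf:
  assumes "F \<in> L" "i \<in> F" "G \<in> L" "i \<notin> G" "\<not> G \<subseteq> F"
  shows "lift_flat F * zf G \<in> TI"
proof -
  define f where "f = F - {i}"
  have f: "i \<notin> f" "insert i f \<in> L" "F = insert i f" "\<not> G \<subseteq> f" "f \<in> L'"
    using assms deletionI by (auto simp: f_def insert_absorb)
  show ?thesis
  proof (cases "f \<in> L")
    case True
    then have "f \<in> both_flats" using f by (simp add: both_flats_def)
    then show ?thesis
      using True f assms ev_mult_zf[of f both_flats G] by (simp add: lift_flat_def)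
  next
    case False
    then have nsub: "\<not> f \<subseteq> G" using deleted_in_closure[of F G] assms by (simp add: f_def)
    have "D.xf f * D.xf G \<in> TI" using nsub f by (intro core_in_tower D.xf_incomparable_core)
    moreover have "D.xf f * ev G \<in> TI" if "G \<in> both_flats"
      using tower_comp[OF that comp_gens_incomparable[of f]] nsub f by (simp add: mult.commute)
    ultimately show ?thesis
      using False f by (auto simp: lift_flat_def zf_def right_diff_distrib intro: idl_diff)
  qed
qed

lemma lift_flat_incomparable:
  assumes "F \<in> L" "G \<in> L" "\<not> F \<subseteq> G" "\<not> G \<subseteq> F"
  shows "lift_flat F * lift_flat G \<in> TI"
proof -
  consider "i \<in> F" "i \<in> G" | "i \<in> F" "i \<notin> G" | "i \<notin> F" "i \<in> G" | "i \<notin> F" "i \<notin> G" by blast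
  then show ?thesis
  proof cases
    case 1
    define f g where "f = F - {i}" and "g = G - {i}"
    have fg: "\<not> f \<subseteq> g" "\<not> g \<subseteq> f" "f \<in> L'" "g \<in> L'" "insert i f \<in> L" "insert i g \<in> L" "i \<notin> f" "i \<notin> g"
      using 1 assms deletionI by (auto simp: f_def g_def insert_absorb)
    have F: "lift_flat F = (if f \<in> L then ev f else D.xf f)"
      and G: "lift_flat G = (if g \<in> L then ev g else D.xf g)"
      using 1 by (simp_all add: lift_flat_def f_def g_def)
    have both: "f \<in> L \<Longrightarrow> f \<in> both_flats" "g \<in> L \<Longrightarrow> g \<in> both_flats"
      using fg by (simp_all add: both_flats_def)
    have "D.xf f * D.xf g \<in> TI" using fg by (intro core_in_tower D.xf_incomparable_core)
    moreover have "ev f * D.xf g \<in> TI" if "f \<in> L"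
      using fg both that by (intro tower_comp comp_gens_incomparable)
    moreover have "D.xf f * ev g \<in> TI" if "g \<in> L"
      using fg both that tower_comp[of g both_flats "D.xf f"] comp_gens_incomparable[of f g]
      by (simp add: mult.commute)
    moreover have "ev f * ev g \<in> TI" if "f \<in> L" "g \<in> L"
      using fg both that by (intro tower_incomparable)
    ultimately show ?thesis by (simp add: F G)
  next
    case 2
    then show ?thesis using lift_flat_mult_zf assms by (simp add: lift_flat_def)
  next
    case 3
    then show ?thesis using lift_flat_mult_zf[of G F] assms by (simp add: lift_flat_def mult.commute)
  next
    case 4
    then show ?thesis using zf_mult_zf assms by (simp add: lift_flat_def)
  qed
qed

text \<open>The tower version of \<open>x_F y_i = 0\<close>: if \<open>insert i F\<close> is a flat,
  it is the quadratic equation of \<open>F\<close> after passing to the local sum; otherwise it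
  comes from the parallel element.\<close>

lemma zf_sum_avoiding:
  assumes "F \<in> L" "i \<notin> F"
  shows "zf F * (\<Sum>G\<in>{G \<in> L. i \<notin> G}. zf G) \<in> TI"
proof (cases "F \<in> both_flats")
  case True
  have "zf F * (\<Sum>H\<in>{H \<in> L. i \<notin> H}. zf H) - zf F * (\<Sum>H\<in>{H \<in> L. i \<notin> H}. local_zf F H) \<in> TI"
  proof (rule idl_sum_cong)
    fix H assume H: "H \<in> {H \<in> L. i \<notin> H}"
    consider "H \<subset> F" | "F \<subseteq> H" | "\<not> H \<subseteq> F" "\<not> F \<subseteq> H" by blast
    then show "zf F * (zf H - local_zf F H) \<in> TI"
    proof cases
      case 1
      then have "H \<in> both_flats" using both_flats_below[of H F] H True by auto
      then have "zf F * ev H \<in> TI" using zf_mult_ev[OF True True] 1 by blast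
      then have "zf F * (zf H - D.xf H) \<in> TI"
        using \<open>H \<in> both_flats\<close> by (simp add: zf_def idl_uminus)
      then show ?thesis using 1 by (simp add: local_zf_def)
    next
      case 2
      then show ?thesis by (auto simp: local_zf_def idl_0)
    next
      case 3
      then have "zf F * zf H \<in> TI" using assms H by (intro zf_mult_zf) auto
      then show ?thesis using 3 by (auto simp: local_zf_def)
    qed
  qed
  moreover have "zf F * (\<Sum>H\<in>{H \<in> L. i \<notin> H}. local_zf F H) \<in> TI"
    unfolding sum_local_zf[OF True] using True by (intro zf_mult_quad) auto
  ultimately show ?thesis using idl_cong_mem by blast
next
  case False
  then have nL: "insert i F \<notin> L" using assms by (auto simp: both_flats_def)
  have "D.xf F * (\<Sum>G\<in>{G \<in> L. i \<notin> G}. zf G) - D.xf F * (\<Sum>G\<in>{G \<in> L. i \<notin> G}. D.xf G) \<in> TI"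
  proof (rule idl_sum_cong)
    fix G
    have "D.xf F * ev G \<in> TI" if "G \<in> both_flats"
      using xf_mult_ev[OF assms nL that that] .
    then show "D.xf F * (zf G - D.xf G) \<in> TI"
      by (auto simp: zf_def idl_0 intro: idl_uminus)
  qed
  moreover have "D.xf F * (\<Sum>G\<in>{G \<in> L. i \<notin> G}. D.xf G) \<in> TI"
    using core_in_tower xf_mult_parallel[OF assms nL] by blast
  ultimately show ?thesis using idl_cong_mem False by (auto simp: zf_def)
qed

text \<open>This makes \<open>lift\<close> a map from the Chow ring of the matroid to the last ring
  of the tower. The linear relations hold by pairing flats, the one of \<open>i\<close> by the
  choice of \<open>lift_var\<close>; the relations \<open>y_i x_F = 0\<close> are
  \<open>zf_sum_avoiding\<close>.\<close>

lemma lift_ideal: "p \<in> IM \<Longrightarrow> lift p \<in> TI"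
proof (rule idl_hom_image[where h = lift])
  fix g assume "g \<in> chow_gens E L"
  then show "lift g \<in> TI"
  proof (cases rule: chow_gens_cases)
    case (linear j)
    have *: "lift g = lift (poly_var (Y j)) - (\<Sum>F\<in>{F \<in> L. j \<notin> F}. lift_flat F)"
      unfolding linear M.sum_xf_avoiding[OF linear(1)] by (simp add: lift_simps lift_xf)
    show ?thesis
    proof (cases "j = i")
      case True
      have "(\<Sum>F\<in>{F \<in> L. i \<notin> F}. lift_flat F) = (\<Sum>F\<in>{F \<in> L. i \<notin> F}. zf F)"
        by (intro sum.cong) (auto simp: lift_flat_def)
      then have "lift g = 0" using True * by (simp add: lift_simps lift_var_def)
      then show ?thesis by (simp add: idl_0)
    next
      case False
      then have "lift g = poly_var (Y j) - (\<Sum>F\<in>{F \<in> L'. j \<notin> F}. D.xf F)"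
        using linear(1) unfolding * by (simp add: lift_simps lift_var_def sum_lift_flat)
      then show ?thesis using linear(1) False by (simp add: core_in_tower D.var_Y_eq_core)
    qed
  next
    case (incomparable F G)
    then show ?thesis
      using lift_flat_incomparable[of F G] by (simp add: lift_simps lift_var_def proper_flats_def)
  next
    case (mixed j F)
    then have F: "F \<in> L" by (simp add: proper_flats_def)
    have eq: "lift g = lift_var (Y j) * lift_flat F"
      using mixed by (simp add: lift_simps lift_var_def)
    show ?thesis
    proof (cases "j = i")
      case True
      then show ?thesis
        using eq zf_sum_avoiding[OF F] mixed by (simp add: lift_var_def lift_flat_def mult.commute)
    next
      case False
      then have j: "j \<in> E'" "lift_var (Y j) = poly_var (Y j)" using mixed by (auto simp: lift_var_def)
      have 1: "poly_var (Y j) * D.xf H \<in> TI" if "j \<notin> H" for H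
        using core_in_tower D.var_Y_xf_core j that by blast
      have 2: "poly_var (Y j) * ev H \<in> TI" if "j \<notin> H" "H \<in> both_flats" for H
        using tower_comp[OF that(2) comp_gens_Y[of j]] j that by (simp add: mult.commute)
      show ?thesis
      proof (cases "i \<in> F")
        case True
        then have "F - {i} \<in> both_flats" if "F - {i} \<in> L"
          using F that by (simp add: both_flats_def insert_absorb)
        then show ?thesis using True 1 2 mixed(3) eq j by (simp add: lift_flat_def)
      next
        case False
        then show ?thesis
          using 1 2 mixed(3) eq j by (auto simp: lift_flat_def zf_def right_diff_distrib intro: idl_diff)
      qed
    qed
  next
    case (outside v)
    have "lift_var v = 0"
    proof (cases v)
      case (Y j)
      then have "j \<notin> E" using outside by blast
      then show ?thesis using i_in Y by (auto simp: lift_var_def)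
    next
      case (X G)
      then have "G \<notin> proper_flats E L" using outside by blast
      then show ?thesis using X by (simp add: lift_var_def)
    qed
    then show ?thesis using outside by (simp add: lift_simps idl_0)
  qed
qed (simp_all add: lift_simps)

text \<open>The lifts of \<open>x_G\<close> and \<open>e_G\<close> add up to the variable of
  \<open>G\<close>. Hence a module form lifts to an expression linear in the new indeterminates, to
  which \<open>tower_independent\<close> applies.\<close>

lemma lift_\<theta>: "poly_vars p \<subseteq> old_vars \<Longrightarrow> lift (\<theta> p) = p"
proof (induction p rule: poly_vars_induct)
  case (var v)
  show ?case
  proof (cases v)
    case (Y j)
    then show ?thesis using var by (auto simp: matroid_vars_def \<theta>_simps theta_var_def lift_simps lift_var_def)
  next
    case (X G)
    then have G: "G \<in> proper_flats E' L'" "G \<in> L'" using var by (auto simp: matroid_vars_def proper_flats_def)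
    have "lift (M.xf H) = (if H \<in> L then lift_flat H else 0)" for H
      by (simp add: lift_xf M.xf_not_flat lift_simps)
    then show ?thesis
      using G lift_flat_pair[OF G(2)] X by (simp add: \<theta>_simps theta_var_def lift_simps D.xf_proper)
  qed
qed (simp_all add: \<theta>_simps lift_simps)

theorem module_form_independent:
  assumes "module_form a b \<in> IM" and "poly_vars a \<subseteq> old_vars" and "\<And>F. poly_vars (b F) \<subseteq> old_vars"
  shows "a \<in> ID" and "F \<in> both_flats \<Longrightarrow> b F \<in> idl (comp_gens F)"
proof -
  have "lift (M.xf (insert i F)) = ev F" if "F \<in> both_flats" for F
    using both_flatsD[OF that] by (simp add: lift_xf lift_flat_def)
  then have "lift (module_form a b) = a + (\<Sum>F\<in>both_flats. b F * ev F)"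
    using assms(2,3) by (simp add: module_form_def lift_simps lift_\<theta> mult.commute)
  then have "a + (\<Sum>F\<in>both_flats. b F * ev F) \<in> TI" using lift_ideal[OF assms(1)] by simp
  from tower_independent[OF up_closed_both_flats assms(2,3) this]
  show "a \<in> ID" "F \<in> both_flats \<Longrightarrow> b F \<in> idl (comp_gens F)"
    using chow_core_ideal_subset by blast+
qed

text \<open>Complements \<open>module_form_independent\<close>: together they identify the
  annihilator of \<open>e F\<close>. A generator beyond the Chow relations expands into flats
  incomparable to \<open>insert i F\<close>, or is \<open>y_j\<close> for some \<open>j\<close>
  outside it.\<close>

lemma e_annihilator:
  assumes "F \<in> both_flats" "k \<in> idl (comp_gens F)"
  shows "e F * \<theta> k \<in> IM"
  using assms(2)
proof induction
  case (idl_gen g)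
  note FD = both_flatsD[OF assms(1)]
  from idl_gen show ?case
  proof (cases rule: comp_gens_cases)
    case core
    then have "g \<in> ID" using chow_core_ideal_subset idl.idl_gen by blast
    then show ?thesis using \<theta>_ideal idl.idl_mult by blast
  next
    case (Y j)
    then show ?thesis
      using M.var_Y_xf[of j "insert i F"] by (simp add: \<theta>_simps theta_var_def mult.commute)
  next
    case (incomparable G)
    then have "e F * M.xf G \<in> IM" "e F * e G \<in> IM"
      using FD by (auto intro!: M.xf_incomparable simp: mem_deletion_iff)
    then show ?thesis using incomparable by (simp add: \<theta>_xf distrib_left idl.idl_add)
  next
    case (above H)
    then have "e F * M.xf H \<in> IM" by (intro e_incomparable) (auto simp: mem_deletion_iff)
    then show ?thesis using above by (simp add: \<theta>_xf M.xf_not_flat)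
  qed
next
  case (idl_mult p r)
  then show ?case using idl.idl_mult[of "e F * \<theta> p" _ "\<theta> r"] by (simp add: \<theta>_simps mult_ac)
qed (auto simp: \<theta>_simps distrib_left idl_0 intro: idl_add)

end

section \<open>Restriction to the variables of a matroid\<close>

text \<open>Foreign variables are set to zero. This retracts the large ring onto that of the matroid
  and links \<open>chow_full_ideal\<close> with the ideal that defines the Chow ring.\<close>

definition restr :: "'a set \<Rightarrow> 'a set set \<Rightarrow> 'a chow_poly \<Rightarrow> 'a chow_poly" where
  "restr E L = poly_eval poly_const (\<lambda>v. if v \<in> matroid_vars E L then poly_var v else 0)"

lemmas restr_simps = poly_eval_simps[OF scalar_hom_const,
  of "\<lambda>v. if v \<in> matroid_vars E L then poly_var v else 0" for E L, folded restr_def]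

lemma restr_cong: "p - restr E L p \<in> chow_full_ideal E L"
proof (induction p rule: poly_induct_vars)
  case (var v)
  then show ?case
    by (auto simp: restr_simps idl_0 matroid_vars_def chow_gens_def intro!: idl_gen)
next
  case (add p q)
  then show ?case by (simp add: restr_simps idl_cong_add)
next
  case (mult p q)
  then show ?case by (simp add: restr_simps idl_cong_mult)
qed (simp add: restr_simps idl_0)

lemma poly_vars_restr: "poly_vars (restr E L p) \<subseteq> matroid_vars E L"
proof (induction p rule: poly_induct_vars)
  case (add p q)
  then show ?case using poly_vars_add[of "restr E L p" "restr E L q"] by (auto simp: restr_simps)
next
  case (mult p q)
  then show ?case using poly_vars_mult[of "restr E L p" "restr E L q"] by (auto simp: restr_simps)
qed (auto simp: restr_simps)

lemma restr_id: "poly_vars p \<subseteq> matroid_vars E L \<Longrightarrow> restr E L p = p"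
  by (induction p rule: poly_vars_induct) (simp_all add: restr_simps)

lemma restr_homogeneous: "homogeneous_poly k p \<Longrightarrow> homogeneous_poly k (restr E L p)"
  unfolding restr_def by (rule homogeneous_poly_eval) simp_all

section \<open>Flag monomials\<close>

definition flag_prod :: "'a set set \<Rightarrow> 'a chow_poly" where
  "flag_prod C = (\<Prod>F\<in>C. poly_var (X F))"

lemma flag_prod_homogeneous: "homogeneous_poly (card C) (flag_prod C)"
  unfolding flag_prod_def
  using homogeneous_poly_prod[of C "\<lambda>_. Suc 0" "\<lambda>F. poly_var (X F)"] by simp

lemma flag_prod_member:
  "finite C \<Longrightarrow> F \<in> C \<Longrightarrow> flag_prod C = poly_var (X F) * flag_prod (C - {F})"
  unfolding flag_prod_def by (rule prod.remove)

lemma flag_prod_insert: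
  "finite C \<Longrightarrow> F \<notin> C \<Longrightarrow> flag_prod (insert F C) = poly_var (X F) * flag_prod C"
  unfolding flag_prod_def by (rule prod.insert)

context flat_matroid
begin

text \<open>The flags \<open>C\<close> extend the marked flag \<open>D\<close>, whose members do not count as factors.\<close>

definition marked_flag :: "'a set set \<Rightarrow> 'a set set \<Rightarrow> bool" where
  "marked_flag D C \<longleftrightarrow> proper_flag E L (C \<union> D) \<and> C \<inter> D = {}"

text \<open>Used with \<open>D\<close> empty and \<open>J\<close> the Chow ideal, and with
  \<open>D = {F}\<close> and \<open>J\<close> the annihilator of \<open>e_F\<close>; in the latter
  case \<open>J\<close> contains the variables incompatible with \<open>F\<close>, as if a factor
  \<open>x_F\<close> were present.\<close>

inductive_set flag_span :: "'a chow_poly set \<Rightarrow> 'a set set \<Rightarrow> nat \<Rightarrow> 'a chow_poly set" for J D k where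
  flag_span_ideal: "p \<in> J \<Longrightarrow> p \<in> flag_span J D k"
| flag_span_flag: "marked_flag D C \<Longrightarrow> card C = k \<Longrightarrow> poly_const c * flag_prod C \<in> flag_span J D k"
| flag_span_add: "p \<in> flag_span J D k \<Longrightarrow> q \<in> flag_span J D k \<Longrightarrow> p + q \<in> flag_span J D k"

context
  fixes S :: "'a chow_poly set" and D :: "'a set set"
  assumes J: "chow_full_ideal E L \<subseteq> idl S"
    and D_Y: "\<And>G j. G \<in> D \<Longrightarrow> j \<in> E \<Longrightarrow> j \<notin> G \<Longrightarrow> poly_var (Y j) \<in> idl S"
    and D_X: "\<And>G H. G \<in> D \<Longrightarrow> H \<in> L \<Longrightarrow> \<not> G \<subseteq> H \<Longrightarrow> \<not> H \<subseteq> G \<Longrightarrow> poly_var (X H) \<in> idl S"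
begin

abbreviation "fspan k \<equiv> flag_span (idl S) D k"

lemma flag_span_sum: "(\<And>x. x \<in> I \<Longrightarrow> f x \<in> fspan k) \<Longrightarrow> (\<Sum>x\<in>I. f x) \<in> fspan k"
  by (induction I rule: infinite_finite_induct) (auto intro: flag_span_ideal flag_span_add idl_0)

lemma flag_span_const: "p \<in> fspan k \<Longrightarrow> poly_const c * p \<in> fspan k"
proof (induction rule: flag_span.induct)
  case (flag_span_flag C d)
  then show ?case
    using flag_span.flag_span_flag[where c = "c * d" and J = "idl S", OF flag_span_flag]
    by (simp add: poly_const_mult mult.assoc)
qed (auto simp: distrib_left intro: flag_span.intros idl_mult)

lemma flag_span_uminus: "p \<in> fspan k \<Longrightarrow> - p \<in> fspan k"
  using flag_span_const[of p k "- 1"] by (simp add: poly_const_uminus)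

lemma flag_span_cong: "p - q \<in> idl S \<Longrightarrow> q \<in> fspan k \<Longrightarrow> p \<in> fspan k"
proof -
  assume "p - q \<in> idl S" "q \<in> fspan k"
  then have "(p - q) + q \<in> fspan k" by (intro flag_span_add flag_span_ideal[of "p - q"])
  then show ?thesis by simp
qed

lemma flag_span_incomparable:
  assumes C: "marked_flag D C" and G: "G \<in> proper_flats E L"
    and H: "H \<in> C \<union> D" "\<not> G \<subseteq> H" "\<not> H \<subseteq> G"
  shows "poly_var (X G) * flag_prod C \<in> idl S"
proof (cases "H \<in> D")
  case True
  then have "poly_var (X G) \<in> idl S" using D_X[OF True, of G] G H by (auto simp: proper_flats_def)
  then show ?thesis by (rule idl_mult_right)
next
  case False
  then have HC: "H \<in> C" using H by blast
  have fin: "finite C" using proper_flag_finite C unfolding marked_flag_def by blast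
  have Hp: "H \<in> proper_flats E L" using C HC by (auto simp: marked_flag_def proper_flag_def)
  have "poly_var (X G) * poly_var (X H) \<in> idl S"
    using xf_incomparable[OF H(2,3)] J by (auto simp: xf_proper G Hp)
  then show ?thesis
    using idl_mult_right[of "poly_var (X G) * poly_var (X H)" S "flag_prod (C - {H})"]
    by (simp add: flag_prod_member[OF fin HC] mult.assoc)
qed

text \<open>A repeated factor \<open>x\<^sub>G\<close> is rewritten by means of \<open>x\<^sub>G y\<^sub>j = 0\<close>, where \<open>j\<close> lies in the next larger
  member of the flag: all other terms either are squarefree or repeat a smaller flat.\<close>

lemma flag_span_X:
  assumes C: "marked_flag D C" "card C = k"
  shows "G \<in> proper_flats E L \<Longrightarrow> poly_var (X G) * flag_prod C \<in> fspan (Suc k)"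
proof (induction "card G" arbitrary: G rule: less_induct)
  case less
  note G = less.prems
  have finC: "finite (C \<union> D)" using proper_flag_finite C unfolding marked_flag_def by blast
  have flats: "H \<in> L" "H \<noteq> E" if "H \<in> C \<union> D" for H
    using that C by (auto simp: marked_flag_def proper_flag_def proper_flats_def)
  have chain: "H \<subseteq> H' \<or> H' \<subseteq> H" if "H \<in> C \<union> D" "H' \<in> C \<union> D" for H H'
    using that C by (auto simp: marked_flag_def proper_flag_def)
  have new: "poly_var (X H) * flag_prod C \<in> fspan (Suc k)"
    if H: "H \<in> proper_flats E L" "H \<notin> C \<union> D" for H
  proof (cases "\<exists>K\<in>C \<union> D. \<not> H \<subseteq> K \<and> \<not> K \<subseteq> H")
    case True
    then show ?thesis using flag_span_incomparable[OF C(1) H(1)] flag_span_ideal by blast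
  next
    case False
    then have "marked_flag D (insert H C)"
      using C(1) H unfolding marked_flag_def proper_flag_def by blast
    then have "poly_const 1 * flag_prod (insert H C) \<in> fspan (Suc k)"
      using H finC C(2) by (intro flag_span_flag) auto
    then show ?thesis using H finC by (simp add: flag_prod_insert)
  qed
  show ?case
  proof (cases "G \<in> C \<union> D")
    case False
    then show ?thesis using new G by blast
  next
    case True
    \<comment> \<open>The ground set stands in for the next member when \<open>G\<close> is the
      largest one.\<close>
    define A where "A = {H \<in> insert E (C \<union> D). G \<subset> H}"
    have "E \<in> A" using flats[OF True] flat_subset by (auto simp: A_def)
    moreover have "finite A" using finC by (simp add: A_def)
    ultimately obtain N where "N \<in> A" and min: "\<And>H. H \<in> A \<Longrightarrow> H \<subseteq> N \<Longrightarrow> H = N"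
      using finite_has_minimal[of A] by blast
    then have N: "N \<in> insert E (C \<union> D)" "G \<subset> N" by (auto simp: A_def)
    obtain j where j: "j \<in> N" "j \<notin> G" using N by blast
    have jE: "j \<in> E" using j N(1) flats flat_subset by blast
    have above: "j \<in> H" if "H \<in> C \<union> D" "G \<subset> H" for H
    proof -
      have "N \<subseteq> H \<or> H \<subseteq> N" using that N(1) chain[of N H] flats flat_subset by blast
      moreover have "H \<in> A" using that by (simp add: A_def)
      ultimately have "N \<subseteq> H" using min[of H] by blast
      then show ?thesis using j by blast
    qed
    have Y: "poly_var (Y j) * flag_prod C \<in> idl S"
    proof (cases "G \<in> D")
      case True
      then show ?thesis using D_Y j jE by (blast intro: idl_mult_right)
    next
      case False
      then have GC: "G \<in> C" using True by blast
      have "poly_var (Y j) * poly_var (X G) \<in> idl S"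
        using var_Y_xf[OF jE j(2)] J by (auto simp: xf_proper G)
      then show ?thesis
        using idl_mult_right[of "poly_var (Y j) * poly_var (X G)" S "flag_prod (C - {G})"] GC finC
        by (simp add: flag_prod_member[of C G] mult.assoc)
    qed
    let ?F = "{F \<in> proper_flats E L. j \<notin> F}"
    have fin: "finite ?F" using finite_proper_flats by simp
    have GF: "G \<in> ?F" using G j by blast
    have "poly_var (Y j) - (\<Sum>F\<in>?F. poly_var (X F)) \<in> idl S"
      using var_Y_eq[OF jE] J unfolding sum_xf_avoiding[OF jE] by blast
    then have "(poly_var (Y j) - (\<Sum>F\<in>?F. poly_var (X F))) * flag_prod C \<in> idl S"
      by (rule idl_mult_right)
    with Y have "poly_var (Y j) * flag_prod C - (poly_var (Y j) - (\<Sum>F\<in>?F. poly_var (X F))) * flag_prod C \<in> idl S"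
      by (rule idl_diff)
    then have "(\<Sum>F\<in>?F. poly_var (X F)) * flag_prod C \<in> idl S"
      by (simp add: algebra_simps)
    moreover have "(\<Sum>F\<in>?F. poly_var (X F)) * flag_prod C =
        poly_var (X G) * flag_prod C - (- (\<Sum>F\<in>?F - {G}. poly_var (X F) * flag_prod C))"
      by (simp add: sum.remove[OF fin GF] distrib_right sum_distrib_right)
    ultimately have "poly_var (X G) * flag_prod C - (- (\<Sum>F\<in>?F - {G}. poly_var (X F) * flag_prod C)) \<in> idl S"
      by simp
    moreover have "- (\<Sum>F\<in>?F - {G}. poly_var (X F) * flag_prod C) \<in> fspan (Suc k)"
    proof (intro flag_span_uminus flag_span_sum)
      fix F assume F: "F \<in> ?F - {G}"
      show "poly_var (X F) * flag_prod C \<in> fspan (Suc k)"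
      proof (cases "F \<in> C \<union> D")
        case False
        then show ?thesis using new F by blast
      next
        case FA: True
        \<comment> \<open>Members strictly above \<open>G\<close> contain \<open>j\<close>, so a
          repeated flat avoiding \<open>j\<close> is smaller than \<open>G\<close> and covered by
          induction.\<close>
        then have "F \<subset> G" using above[OF FA] chain[OF FA True] F by blast
        then have "card F < card G"
          using finite_flat flats(1)[OF True] by (intro psubset_card_mono)
        then show ?thesis using less.hyps F by blast
      qed
    qed
    ultimately show ?thesis by (rule flag_span_cong)
  qed
qed

lemma flag_span_var: "p \<in> fspan k \<Longrightarrow> poly_var v * p \<in> fspan (Suc k)"
proof (induction rule: flag_span.induct)
  case (flag_span_ideal p)
  then show ?case by (intro flag_span.flag_span_ideal idl_mult)
next
  case (flag_span_add p q)
  then show ?case by (simp add: distrib_left flag_span.flag_span_add)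
next
  case (flag_span_flag C c)
  have "poly_var v * flag_prod C \<in> fspan (Suc k)"
  proof (cases v)
    case (X G)
    show ?thesis
    proof (cases "G \<in> proper_flats E L")
      case True
      then show ?thesis using flag_span_X flag_span_flag X by blast
    next
      case False
      then have "poly_var v \<in> idl S" using X outside_var[of v] J by blast
      then show ?thesis by (intro flag_span_ideal idl_mult_right)
    qed
  next
    case (Y j)
    show ?thesis
    proof (cases "j \<in> E")
      case True
      let ?F = "{F \<in> proper_flats E L. j \<notin> F}"
      have "poly_var (Y j) - (\<Sum>F\<in>?F. poly_var (X F)) \<in> idl S"
        using var_Y_eq[OF True] J unfolding sum_xf_avoiding[OF True] by blast
      then have "(poly_var (Y j) - (\<Sum>F\<in>?F. poly_var (X F))) * flag_prod C \<in> idl S"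
        by (rule idl_mult_right)
      then have "poly_var v * flag_prod C - (\<Sum>F\<in>?F. poly_var (X F) * flag_prod C) \<in> idl S"
        by (simp add: Y left_diff_distrib sum_distrib_right)
      moreover have "(\<Sum>F\<in>?F. poly_var (X F) * flag_prod C) \<in> fspan (Suc k)"
        using flag_span_X flag_span_flag by (intro flag_span_sum) blast
      ultimately show ?thesis by (rule flag_span_cong)
    next
      case False
      then have "poly_var v \<in> idl S" using Y outside_var[of v] J by blast
      then show ?thesis by (intro flag_span_ideal idl_mult_right)
    qed
  qed
  then show ?case using flag_span_const[of _ "Suc k" c] by (simp add: mult.left_commute)
qed

lemma flag_span_mono: "p \<in> fspan k \<Longrightarrow> mono_eval poly_var m * p \<in> fspan (k + mono_deg m)"
proof (induction m arbitrary: p k rule: poly_mapping_induct_single)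
  case zero
  then show ?case by (simp add: mono_deg_def)
next
  case (single v n)
  have "poly_var v ^ n * p \<in> fspan (k + n)"
    using single
  proof (induction n)
    case (Suc n)
    then show ?case using flag_span_var by (simp add: mult.assoc)
  qed simp
  then show ?case by (cases "n = 0") (simp_all add: mono_eval_single mono_deg_def)
next
  case (add m n)
  then have "mono_eval poly_var m * (mono_eval poly_var n * p) \<in> fspan (k + mono_deg n + mono_deg m)"
    by blast
  then show ?case by (simp add: mono_eval_add mono_deg_add ac_simps)
qed

lemma homogeneous_in_flag_span:
  assumes "homogeneous_poly k p" "proper_flag E L D"
  shows "p \<in> fspan k"
proof -
  have "marked_flag D {}" using assms(2) by (simp add: marked_flag_def)
  then have 1: "1 \<in> fspan 0" using flag_span_flag[of D "{}" 0 1] by (simp add: flag_prod_def)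
  have "(\<Sum>m\<in>Poly_Mapping.keys p. Poly_Mapping.single m (Poly_Mapping.lookup p m)) \<in> fspan k"
  proof (rule flag_span_sum)
    fix m assume "m \<in> Poly_Mapping.keys p"
    then have "mono_deg m = k" using assms(1) by (simp add: homogeneous_poly_def)
    then have "mono_eval poly_var m \<in> fspan k" using flag_span_mono[OF 1, of m] by simp
    then show "Poly_Mapping.single m (Poly_Mapping.lookup p m) \<in> fspan k"
      unfolding single_mono_eval by (rule flag_span_const)
  qed
  then show ?thesis by (simp flip: poly_mapping_sum_single)
qed

text \<open>Vanishing in degree \<open>k\<close> thus becomes a question about flags with
  \<open>k\<close> unmarked members.\<close>

lemma homogeneous_vanishing:
  assumes "homogeneous_poly k p" "proper_flag E L D"
    and "\<And>C. marked_flag D C \<Longrightarrow> card C = k \<Longrightarrow> flag_prod C \<in> idl S"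
  shows "p \<in> idl S"
  using homogeneous_in_flag_span[OF assms(1,2)]
  by induction (auto intro: idl.intros assms(3))

end

end

context loopless_matroid
begin

lemma vanishing_above_rank:
  assumes "homogeneous_poly k p" "corank {} < k"
  shows "p \<in> chow_full_ideal E L"
proof (rule homogeneous_vanishing[of _ "{}", OF order.refl _ _ assms(1)])
  show "flag_prod C \<in> chow_full_ideal E L" if "marked_flag {} C" "card C = k" for C
    using proper_flag_card_le[of C] that assms(2) by (simp add: marked_flag_def)
qed (auto simp: proper_flag_def)

end

section \<open>Vanishing of \<open>e_F\<close> times the image of \<open>\<theta>\<close> in top
  degree\<close>

context matroid_deletion
begin

lemma \<theta>_restr: "\<theta> (restr E' L' p) = \<theta> p"
proof (induction p rule: poly_induct_vars)
  case (var v)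
  then show ?case
    by (auto simp: restr_simps \<theta>_simps matroid_vars_def theta_var_def split: chow_var.split)
qed (simp_all add: restr_simps \<theta>_simps)

text \<open>The annihilator of \<open>e_F\<close> enlarged by the foreign variables, so that
  coefficients may be arbitrary polynomials.\<close>

definition comp_ideal :: "'a set \<Rightarrow> 'a chow_poly set" where
  "comp_ideal F = idl (comp_gens F \<union> chow_gens E' L')"

lemma comp_ideal_D: "p \<in> ID \<Longrightarrow> p \<in> comp_ideal F"
  unfolding comp_ideal_def by (rule subsetD[OF idl_mono]) auto

text \<open>Every flat of the deletion lies below \<open>E'\<close>, so nothing beyond the Chow
  relations is generated. For a coloop this makes the multiples of \<open>e E'\<close> by the image
  a copy of the Chow ring of the deletion.\<close>

lemma comp_ideal_ground: "comp_ideal E' = ID"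
proof -
  have "comp_gens E' \<subseteq> chow_gens E' L'"
  proof
    fix g assume "g \<in> comp_gens E'"
    then show "g \<in> chow_gens E' L'"
      by (cases rule: comp_gens_cases) (use D.flat_subset in \<open>auto simp: chow_gens_def\<close>)
  qed
  then show ?thesis unfolding comp_ideal_def by (simp add: Un_absorb1)
qed

lemma comp_ideal_annihilates:
  assumes "F \<in> both_flats" "k \<in> comp_ideal F"
  shows "e F * \<theta> k \<in> IM"
  using assms(2) unfolding comp_ideal_def
proof induction
  case (idl_gen g)
  then show ?case
    using e_annihilator[OF assms(1) idl.idl_gen] idl_mult[OF \<theta>_ideal[OF idl.idl_gen]] by blast
next
  case (idl_mult p r)
  then show ?case using idl.idl_mult[of "e F * \<theta> p" _ "\<theta> r"] by (simp add: \<theta>_simps mult_ac)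
qed (auto simp: \<theta>_simps distrib_left idl_0 intro: idl_add)

lemma module_form_unique:
  assumes "module_form a b \<in> IM"
  shows "a \<in> ID" and "F \<in> both_flats \<Longrightarrow> b F \<in> comp_ideal F"
proof -
  have "module_form (restr E' L' a) (\<lambda>F. restr E' L' (b F)) \<in> IM"
    using assms by (simp add: module_form_def \<theta>_restr)
  note ind = module_form_independent[OF this]
  have "restr E' L' a \<in> ID" using ind(1) poly_vars_restr by blast
  then show "a \<in> ID" using restr_cong idl_cong_mem by blast
  assume "F \<in> both_flats"
  then have "restr E' L' (b F) \<in> idl (comp_gens F)" using ind(2) poly_vars_restr by blast
  then have "restr E' L' (b F) \<in> comp_ideal F"
    unfolding comp_ideal_def by (rule rev_subsetD[OF _ idl_mono]) auto
  moreover have "b F - restr E' L' (b F) \<in> comp_ideal F" using restr_cong comp_ideal_D by blast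
  ultimately show "b F \<in> comp_ideal F" unfolding comp_ideal_def using idl_cong_mem by blast
qed

lemma module_form_diff: "module_form a b - module_form a' b' = module_form (a - a') (\<lambda>F. b F - b' F)"
  by (simp add: module_form_def \<theta>_simps right_diff_distrib sum_subtractf algebra_simps)

lemma module_form_cong_unique:
  assumes "p - module_form a b \<in> IM" "p - module_form a' b' \<in> IM"
  shows "a - a' \<in> ID" and "F \<in> both_flats \<Longrightarrow> b F - b' F \<in> comp_ideal F"
proof -
  have "module_form (a - a') (\<lambda>F. b F - b' F) = (p - module_form a' b') - (p - module_form a b)"
    by (simp flip: module_form_diff)
  also have "\<dots> \<in> IM" using assms by (intro idl_diff[of "p - module_form a' b'"])
  finally have "module_form (a - a') (\<lambda>F. b F - b' F) \<in> IM" .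
  note * = module_form_unique[OF this]
  show "a - a' \<in> ID" using *(1) .
  show "F \<in> both_flats \<Longrightarrow> b F - b' F \<in> comp_ideal F" using *(2) .
qed

text \<open>\<open>F\<close> counts twice in the matroid: the members below \<open>F\<close>, then
  \<open>F\<close>, \<open>insert i F\<close> and the larger members with \<open>i\<close> added
  form a proper flag. The condition \<open>F \<noteq> E'\<close> keeps \<open>insert i F\<close>
  proper.\<close>

lemma marked_flag_card:
  assumes F: "F \<in> both_flats" "F \<noteq> E'" and C: "D.marked_flag {F} C"
    and above: "\<And>H. H \<in> C \<Longrightarrow> F \<subset> H \<Longrightarrow> insert i H \<in> L"
  shows "card C + 2 \<le> M.corank {}"
proof -
  note FD = both_flatsD[OF F(1)]
  have flag: "proper_flag E' L' (insert F C)" "F \<notin> C" using C by (auto simp: D.marked_flag_def)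
  have finC: "finite C" using D.proper_flag_finite[OF flag(1)] by simp
  have CL: "H \<in> L'" "H \<noteq> E'" "i \<notin> H" if "H \<in> C" for H
    using flag that by (auto simp: proper_flag_def proper_flats_def mem_deletion_iff)
  have chain: "H \<subseteq> K \<or> K \<subseteq> H" if "H \<in> insert F C" "K \<in> insert F C" for H K
    using flag(1) that unfolding proper_flag_def by blast
  define A where "A = insert F {G \<in> C. G \<subset> F}"
  define B where "B = insert F {H \<in> C. F \<subset> H}"
  have AB: "insert F C = A \<union> B" "A \<inter> B = {F}"
    using chain flag(2) by (auto simp: A_def B_def)
  have finAB: "finite A" "finite B" using finC by (auto simp: A_def B_def)
  have Ai: "G \<in> L" "i \<notin> G" "G \<subseteq> F" if "G \<in> A" for G
    using that FD CL deletion_flat_below[of G F] by (auto simp: A_def)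
  have ground: "insert i H \<noteq> E" if "i \<notin> H" "H \<noteq> E'" for H
    using that by auto
  have Bi: "insert i H \<in> L" "i \<notin> H" "F \<subseteq> H" "insert i H \<noteq> E" if "H \<in> B" for H
    using that FD CL[of H] F above[of H] ground[of H] by (auto simp: B_def)
  have ABC: "A \<subseteq> insert F C" "B \<subseteq> insert F C" using AB by auto
  have "proper_flag E L (A \<union> insert i ` B)"
    unfolding proper_flag_def
  proof (intro conjI ballI)
    show "A \<union> insert i ` B \<subseteq> proper_flats E L"
    proof
      fix G assume "G \<in> A \<union> insert i ` B"
      then consider "G \<in> A" | H where "H \<in> B" "G = insert i H" by blast
      then show "G \<in> proper_flats E L"
        by cases (use Ai Bi i_in in \<open>auto simp: proper_flats_def\<close>)
    qed
    fix G H assume GH: "G \<in> A \<union> insert i ` B" "H \<in> A \<union> insert i ` B"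
    consider "G \<in> A" "H \<in> A" | K where "G \<in> A" "K \<in> B" "H = insert i K"
      | K where "H \<in> A" "K \<in> B" "G = insert i K"
      | K K' where "K \<in> B" "G = insert i K" "K' \<in> B" "H = insert i K'"
      using GH by blast
    then show "G \<subseteq> H \<or> H \<subseteq> G"
    proof cases
      case 1
      then show ?thesis using chain[of G H] ABC by blast
    next
      case 2
      then show ?thesis using Ai(3)[of G] Bi(3)[of K] by blast
    next
      case 3
      then show ?thesis using Ai(3)[of H] Bi(3)[of K] by blast
    next
      case 4
      then have "K \<subseteq> K' \<or> K' \<subseteq> K" using chain[of K K'] ABC by blast
      then show ?thesis using 4 by auto
    qed
  qed
  then have "card (A \<union> insert i ` B) \<le> M.corank {}" by (rule M.proper_flag_card_le)
  moreover have "card (A \<union> insert i ` B) = card A + card (insert i ` B)"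
    using finAB Ai(2) by (intro card_Un_disjoint) auto
  moreover have "card (insert i ` B) = card B"
    using Bi(2) by (intro card_image) (auto simp: inj_on_def insert_ident)
  moreover have "card A + card B = card (A \<union> B) + card (A \<inter> B)"
    using finAB by (rule card_Un_Int)
  moreover have "card (A \<union> B) = Suc (card C)" "card (A \<inter> B) = 1"
    using finC flag(2) AB by (metis card_insert_disjoint, simp)
  ultimately show ?thesis by linarith
qed

text \<open>By \<open>marked_flag_card\<close> a flag monomial of degree \<open>k\<close> compatible
  with \<open>F\<close> is too long unless it has a factor \<open>x_H\<close> above \<open>F\<close>
  with \<open>insert i H\<close> no flat, and such a factor annihilates \<open>e F\<close>. With
  \<open>k\<close> one less than the rank the product has top degree.\<close>

lemma e_vanishing:
  assumes F: "F \<in> both_flats" "F \<noteq> E'" and p: "homogeneous_poly k p" and k: "M.corank {} < k + 2"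
  shows "e F * \<theta> p \<in> IM"
proof -
  note FD = both_flatsD[OF F(1)]
  have "p \<in> idl (comp_gens F \<union> chow_gens E' L')"
  proof (rule D.homogeneous_vanishing[of _ "{F}", OF _ _ _ p])
    show "ID \<subseteq> idl (comp_gens F \<union> chow_gens E' L')" by (intro idl_mono) auto
    show "poly_var (Y j) \<in> idl (comp_gens F \<union> chow_gens E' L')"
      if "G \<in> {F}" "j \<in> E'" "j \<notin> G" for G j
      using that comp_gens_Y[of j F] by (intro idl_gen) auto
    show "poly_var (X H) \<in> idl (comp_gens F \<union> chow_gens E' L')"
      if "G \<in> {F}" "H \<in> L'" "\<not> G \<subseteq> H" "\<not> H \<subseteq> G" for G H
    proof -
      have "H \<in> proper_flats E' L'" using that FD by (auto simp: proper_flats_def)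
      then have "poly_var (X H) = D.xf H" by (simp add: D.xf_proper)
      then show ?thesis using that comp_gens_incomparable[of H F] by (auto intro!: idl_gen)
    qed
    show "proper_flag E' L' {F}" using FD F(2) by (auto simp: proper_flag_def proper_flats_def)
    fix C assume C: "D.marked_flag {F} C" "card C = k"
    then obtain H where H: "H \<in> C" "F \<subset> H" "insert i H \<notin> L"
      using marked_flag_card[OF F C(1)] k by force
    have flag: "proper_flag E' L' (insert F C)" using C by (simp add: D.marked_flag_def)
    then have Hp: "H \<in> proper_flats E' L'" using H by (auto simp: proper_flag_def)
    have "finite C" using D.proper_flag_finite[OF flag] by simp
    moreover have "D.xf H \<in> comp_gens F" using H Hp by (intro comp_gens_above) (auto simp: proper_flats_def)
    then have "poly_var (X H) \<in> idl (comp_gens F \<union> chow_gens E' L')"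
      using Hp by (intro idl_gen) (simp add: D.xf_proper)
    ultimately show "flag_prod C \<in> idl (comp_gens F \<union> chow_gens E' L')"
      using flag_prod_member[OF _ H(1)] by (simp add: idl_mult_right)
  qed
  then show ?thesis using comp_ideal_annihilates[OF F(1)] by (simp add: comp_ideal_def)
qed

end

section \<open>The degree map on polynomials\<close>

text \<open>The degree map before passing to classes. The last clause says that the top degree is at
  most one-dimensional.\<close>

definition degree_functional :: "'a set \<Rightarrow> 'a set set \<Rightarrow> ('a chow_poly \<Rightarrow> rat) \<Rightarrow> bool" where
  "degree_functional E L \<delta> \<longleftrightarrow>
     (\<forall>p q. \<delta> (p + q) = \<delta> p + \<delta> q) \<and> (\<forall>c p. \<delta> (poly_const c * p) = c * \<delta> p) \<and>
     (\<forall>p\<in>chow_full_ideal E L. \<delta> p = 0) \<and>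
     (\<forall>C. complete_flag E L C \<longrightarrow> \<delta> (flag_prod C) = 1) \<and>
     (\<forall>p. homogeneous_poly (matroid_rank E L) p \<longrightarrow> \<delta> p = 0 \<longrightarrow> p \<in> chow_full_ideal E L)"

lemma degree_functionalD:
  assumes "degree_functional E L \<delta>"
  shows "\<delta> (p + q) = \<delta> p + \<delta> q" "\<delta> (poly_const c * p) = c * \<delta> p"
    "p \<in> chow_full_ideal E L \<Longrightarrow> \<delta> p = 0" "complete_flag E L C \<Longrightarrow> \<delta> (flag_prod C) = 1"
    "homogeneous_poly (matroid_rank E L) p \<Longrightarrow> \<delta> p = 0 \<Longrightarrow> p \<in> chow_full_ideal E L"
    "\<delta> (p - q) = \<delta> p - \<delta> q" "p - q \<in> chow_full_ideal E L \<Longrightarrow> \<delta> p = \<delta> q"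
proof -
  show add: "\<delta> (p + q) = \<delta> p + \<delta> q" "\<delta> (poly_const c * p) = c * \<delta> p" for p q
    using assms by (auto simp: degree_functional_def)
  show zero: "p \<in> chow_full_ideal E L \<Longrightarrow> \<delta> p = 0" for p
    using assms by (auto simp: degree_functional_def)
  show "complete_flag E L C \<Longrightarrow> \<delta> (flag_prod C) = 1"
    "homogeneous_poly (matroid_rank E L) p \<Longrightarrow> \<delta> p = 0 \<Longrightarrow> p \<in> chow_full_ideal E L"
    using assms by (auto simp: degree_functional_def)
  show diff: "\<delta> (p - q) = \<delta> p - \<delta> q" using add(1)[of "p - q" q] by simp
  show "p - q \<in> chow_full_ideal E L \<Longrightarrow> \<delta> p = \<delta> q" using diff zero by fastforce
qed

section \<open>Exchanging one member of a complete flag\<close>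

context loopless_matroid
begin

lemma corank_eq: "F \<in> L \<Longrightarrow> G \<in> L \<Longrightarrow> F \<subseteq> G \<Longrightarrow> corank F = corank G \<Longrightarrow> F = G"
  using corank_strict[of F G] by (metis less_irrefl psubsetI)

lemma complete_flagD:
  assumes "complete_flag E L C"
  shows "F \<in> C \<Longrightarrow> F \<in> L" "F \<in> C \<Longrightarrow> F \<noteq> E" "F \<in> C \<Longrightarrow> G \<in> C \<Longrightarrow> F \<subseteq> G \<or> G \<subseteq> F" "finite C"
    "\<lbrakk>1 \<le> n; n \<le> corank {}\<rbrakk> \<Longrightarrow> \<exists>F\<in>C. corank F = n"
    "F \<in> C \<Longrightarrow> G \<in> C \<Longrightarrow> corank F = corank G \<Longrightarrow> F = G"
    "F \<in> C \<Longrightarrow> G \<in> C \<Longrightarrow> corank G < corank F \<Longrightarrow> F \<subset> G"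
proof -
  have flag: "proper_flag E L C" and card: "card C = corank {}"
    using assms by (simp_all add: complete_flag_iff)
  show CL: "F \<in> C \<Longrightarrow> F \<in> L" "F \<in> C \<Longrightarrow> F \<noteq> E" for F
    using flag by (auto simp: proper_flag_def proper_flats_def)
  show chain: "F \<in> C \<Longrightarrow> G \<in> C \<Longrightarrow> F \<subseteq> G \<or> G \<subseteq> F" for F G
    using flag by (auto simp: proper_flag_def)
  show "finite C" using flag by (rule proper_flag_finite)
  have "corank ` C = {1..corank {}}"
    using card proper_flag_corank[OF flag] by (intro card_subset_eq) (auto simp: card_image)
  then have "n \<in> corank ` C" if "1 \<le> n" "n \<le> corank {}" using that by simp
  then show "\<lbrakk>1 \<le> n; n \<le> corank {}\<rbrakk> \<Longrightarrow> \<exists>F\<in>C. corank F = n" by blast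
  show "F \<in> C \<Longrightarrow> G \<in> C \<Longrightarrow> corank F = corank G \<Longrightarrow> F = G"
    using proper_flag_corank(1)[OF flag] by (auto dest: inj_onD)
  show "F \<in> C \<Longrightarrow> G \<in> C \<Longrightarrow> corank G < corank F \<Longrightarrow> F \<subset> G"
    using chain[of F G] corank_strict[OF CL(1) CL(1), of G F] by fastforce
qed

lemma flag_prod_incomparable:
  assumes C: "proper_flag E L C" and G: "G \<in> proper_flats E L" and H: "H \<in> C" "\<not> G \<subseteq> H" "\<not> H \<subseteq> G"
  shows "poly_var (X G) * flag_prod C \<in> chow_full_ideal E L"
proof (rule flag_span_incomparable[where D = "{}" and H = H])
  show "marked_flag {} C" using C by (simp add: marked_flag_def)
qed (use G H in auto)

text \<open>Choose \<open>j\<close> in \<open>N\<close> but not in \<open>F2\<close>, and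
  \<open>k\<close> in \<open>F2\<close> but not in \<open>N\<close>. Both \<open>y_j\<close> and
  \<open>y_k\<close> kill \<open>x_F\<close>; in the difference of the two relations, multiplied by
  the common part of the flags, only the terms of \<open>N\<close> and \<open>F2\<close>
  survive.\<close>

lemma flag_exchange:
  assumes C: "complete_flag E L C" and F: "F \<in> C" and N: "N \<in> C" and N2: "N2 \<in> insert E C"
    and less: "F \<subset> N" "N \<subset> N2" and rk: "corank F = Suc (corank N)" "corank N = Suc (corank N2)"
    and F2: "F2 \<in> L" "F \<subset> F2" "F2 \<subset> N2" "F2 \<noteq> N"
  shows "complete_flag E L (insert F2 (C - {N}))"
    and "flag_prod C - flag_prod (insert F2 (C - {N})) \<in> chow_full_ideal E L"
proof -
  note CD = complete_flagD[OF C]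
  have N2L: "N2 \<in> L" using N2 CD(1) ground_flat by blast
  have rk_between: "corank G = corank N" if "G \<in> L" "F \<subset> G" "G \<subset> N2" for G
    using corank_strict[OF CD(1)[OF F] that(1,2)] corank_strict[OF that(1) N2L that(3)] rk by simp
  have sides: "H \<subseteq> F \<or> N2 \<subseteq> H" if H: "H \<in> C - {N}" for H
  proof -
    consider "corank H > corank N" | "corank H = corank N" | "corank H < corank N" by linarith
    then show ?thesis
    proof cases
      case 1
      then have "corank H = corank F \<or> corank F < corank H" using rk by linarith
      moreover have "H \<in> C" using H by blast
      ultimately have "H = F \<or> H \<subset> F" using CD(6)[OF _ F] CD(7)[OF _ F] by blast
      then show ?thesis by blast
    next
      case 2
      then show ?thesis using CD(6) H N by blast
    next
      case 3
      show ?thesis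
      proof (cases "N2 = E")
        case True
        then have "corank H = 0" using 3 rk corank_ground by simp
        moreover have "0 < corank H" using corank_pos[of H] CD(1,2) H by blast
        ultimately show ?thesis by simp
      next
        case False
        then have "N2 \<in> C" "H \<in> C" using N2 H by auto
        moreover have "corank N2 = corank H \<or> corank H < corank N2" using 3 rk by linarith
        ultimately have "N2 = H \<or> N2 \<subset> H" using CD(6)[of N2 H] CD(7)[of N2 H] by blast
        then show ?thesis by blast
      qed
    qed
  qed
  let ?Q = "flag_prod (C - {N})"
  have flag: "proper_flag E L C" using C by (simp add: complete_flag_def)
  then have flagQ: "proper_flag E L (C - {N})" by (auto simp: proper_flag_def)
  have Np: "N \<in> proper_flats E L" using CD(1,2) N by (auto simp: proper_flats_def)
  have F2p: "F2 \<in> proper_flats E L" using F2 flat_subset[OF N2L] by (auto simp: proper_flats_def)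
  have F2C: "F2 \<notin> C - {N}" using sides F2 by blast
  have cmp: "H \<subseteq> F2 \<or> F2 \<subseteq> H" if "H \<in> C - {N}" for H
    using sides[OF that] F2 by blast
  have "proper_flag E L (insert F2 (C - {N}))"
    unfolding proper_flag_def
  proof (intro conjI ballI)
    show "insert F2 (C - {N}) \<subseteq> proper_flats E L" using flagQ F2p by (simp add: proper_flag_def)
    fix H K assume "H \<in> insert F2 (C - {N})" "K \<in> insert F2 (C - {N})"
    then show "H \<subseteq> K \<or> K \<subseteq> H" using cmp[of H] cmp[of K] CD(3)[of H K] by blast
  qed
  moreover have "card (insert F2 (C - {N})) = card C"
    using F2C CD(4) N by (simp add: card_Suc_Diff1 del: card_Diff_insert)
  ultimately show "complete_flag E L (insert F2 (C - {N}))"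
    using C by (simp add: complete_flag_iff)
  have rkF2: "corank F2 = corank N" using rk_between F2 by blast
  obtain j where j: "j \<in> N" "j \<notin> F2" using corank_eq[of N F2] CD(1) N F2 rkF2 by auto
  obtain k where k: "k \<in> F2" "k \<notin> N" using corank_eq[of F2 N] CD(1) N F2 rkF2 by auto
  have jk: "j \<in> E" "k \<in> E" "j \<notin> F" "k \<notin> F" "j \<in> N2" "k \<in> N2"
    using j k less F2 N2L flat_subset by blast+
  have FQ: "F \<in> C - {N}" using F less by auto
  have rel: "(\<Sum>G\<in>{G \<in> proper_flats E L. l \<notin> G}. poly_var (X G) * ?Q) \<in> chow_full_ideal E L"
    if l: "l \<in> E" "l \<notin> F" for l
  proof -
    let ?S = "\<Sum>G\<in>{G \<in> proper_flats E L. l \<notin> G}. poly_var (X G)"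
    have "poly_var (Y l) * poly_var (X F) \<in> chow_full_ideal E L"
      using var_Y_xf[OF l] CD(1,2) F by (simp add: xf_proper proper_flats_def)
    then have "(poly_var (Y l) * poly_var (X F)) * flag_prod (C - {N} - {F}) \<in> chow_full_ideal E L"
      by (rule idl_mult_right)
    then have "poly_var (Y l) * ?Q \<in> chow_full_ideal E L"
      using flag_prod_member[OF _ FQ] CD(4) by (simp add: mult.assoc)
    moreover have "(poly_var (Y l) - ?S) * ?Q \<in> chow_full_ideal E L"
      using var_Y_eq[OF l(1)] unfolding sum_xf_avoiding[OF l(1)] by (rule idl_mult_right)
    ultimately have "poly_var (Y l) * ?Q - (poly_var (Y l) - ?S) * ?Q \<in> chow_full_ideal E L"
      by (rule idl_diff)
    then show ?thesis by (simp add: left_diff_distrib sum_distrib_right)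
  qed
  \<comment> \<open>A surviving flat that contains just one of the two elements is squeezed between
    \<open>F\<close> and \<open>N2\<close>, hence has the corank of \<open>N\<close> and is the
    closure of \<open>F\<close> with that element.\<close>
  have only: "poly_var (X G) * ?Q \<in> chow_full_ideal E L"
    if G: "G \<in> proper_flats E L" "l \<in> G" "l' \<notin> G" "G \<noteq> K"
      and K: "K \<in> L" "F \<subset> K" "K \<subset> N2" "l \<in> K" and l: "l \<notin> F" "l \<in> E" "l' \<in> N2" for G K l l'
  proof (cases "\<exists>H\<in>C - {N}. \<not> G \<subseteq> H \<and> \<not> H \<subseteq> G")
    case True
    then show ?thesis using flag_prod_incomparable[OF flagQ G(1)] by blast
  next
    case False
    have GL: "G \<in> L" using G by (simp add: proper_flats_def)
    have FG: "F \<subset> G" using False FQ G l by blast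
    have "G \<subset> N2"
    proof (cases "N2 = E")
      case True
      then show ?thesis using flat_subset[OF GL] l G by blast
    next
      case ne: False
      then have "N2 \<in> C - {N}" using N2 less by blast
      then show ?thesis using False G l by blast
    qed
    let ?M = "cl (insert l F)"
    have FL: "F \<in> L" using CD(1) F by blast
    have M: "?M \<in> L" using flat_subset[OF FL] l by (intro cl_flat) auto
    have "?M \<subseteq> G" "?M \<subseteq> K" using FG G(2) K by (intro cl_least GL, blast, intro cl_least, blast+)
    moreover have "corank ?M = corank N" using corank_cl_insert[OF FL l(2,1)] rk by simp
    moreover have "corank G = corank N" "corank K = corank N"
      using rk_between GL FG \<open>G \<subset> N2\<close> K by blast+
    ultimately have "?M = G" "?M = K" using corank_eq M GL K by metis+
    then show ?thesis using G by simp
  qed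
  let ?P = "proper_flats E L"
  define f where "f l G = (if l \<notin> G then poly_var (X G) * ?Q else 0)" for l G
  have sum_f: "(\<Sum>G\<in>?P. f l G) = (\<Sum>G\<in>{G \<in> ?P. l \<notin> G}. poly_var (X G) * ?Q)" for l
    unfolding f_def using finite_proper_flats by (intro sum.inter_filter[symmetric])
  have "(\<Sum>G\<in>?P. f k G) - (\<Sum>G\<in>?P. f j G) \<in> chow_full_ideal E L"
    unfolding sum_f using rel jk by (intro idl_diff) auto
  then have "(\<Sum>G\<in>?P. f k G - f j G) \<in> chow_full_ideal E L" by (simp add: sum_subtractf)
  define R where "R = (\<Sum>G\<in>?P - {N} - {F2}. f k G - f j G)"
  note \<open>(\<Sum>G\<in>?P. f k G - f j G) \<in> _\<close>
  also have "(\<Sum>G\<in>?P. f k G - f j G) = (f k N - f j N) + ((f k F2 - f j F2) + R)"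
    using finite_proper_flats Np F2p F2(4)
    by (simp add: R_def sum.remove[of _ N] sum.remove[of _ F2])
  also have "\<dots> = (poly_var (X N) * ?Q - poly_var (X F2) * ?Q) + R"
    using j k by (simp add: f_def)
  finally have 1: "(poly_var (X N) * ?Q - poly_var (X F2) * ?Q) + R \<in> chow_full_ideal E L" .
  have "R \<in> chow_full_ideal E L"
    unfolding R_def
  proof (rule idl_sum)
    fix G assume G: "G \<in> ?P - {N} - {F2}"
    consider "j \<in> G \<longleftrightarrow> k \<in> G" | "j \<in> G" "k \<notin> G" | "k \<in> G" "j \<notin> G" by blast
    then show "f k G - f j G \<in> chow_full_ideal E L"
    proof cases
      case 1
      then show ?thesis by (simp add: f_def idl_0)
    next
      case 2
      then have "poly_var (X G) * ?Q \<in> chow_full_ideal E L"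
        using only[of G j k N] G jk j less CD(1) N by blast
      then show ?thesis using 2 by (simp add: f_def)
    next
      case 3
      then have "poly_var (X G) * ?Q \<in> chow_full_ideal E L"
        using only[of G k j F2] G jk k F2 by blast
      then show ?thesis using 3 by (simp add: f_def idl_uminus)
    qed
  qed
  from idl_diff[OF 1 this] have "poly_var (X N) * ?Q - poly_var (X F2) * ?Q \<in> chow_full_ideal E L"
    by simp
  then show "flag_prod C - flag_prod (insert F2 (C - {N})) \<in> chow_full_ideal E L"
    using flag_prod_member[OF CD(4) N] flag_prod_insert[OF _ F2C] CD(4) by simp
qed

end

text \<open>Factors are exchanged one at a time.\<close>

lemma idl_prod_cong:
  assumes "finite A" "\<And>x. x \<in> A \<Longrightarrow> c * (f x - g x) \<in> idl S"
  shows "c * ((\<Prod>x\<in>A. f x) - (\<Prod>x\<in>A. g x)) \<in> idl S"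
  using assms
proof (induction A rule: finite_induct)
  case (insert x A)
  have "c * ((\<Prod>x\<in>insert x A. f x) - (\<Prod>x\<in>insert x A. g x)) =
      f x * (c * ((\<Prod>x\<in>A. f x) - (\<Prod>x\<in>A. g x))) + (\<Prod>x\<in>A. g x) * (c * (f x - g x))"
    using insert(1,2) by (simp add: algebra_simps)
  then show ?case using insert by (simp add: idl_add idl_mult)
qed (simp add: idl_0)

context matroid_deletion
begin

lemma both_flats_ground: "E' \<in> both_flats \<longleftrightarrow> E' \<in> L"
  using M.ground_flat i_in by (simp add: both_flats_def insert_absorb)

lemma flag_prod_\<theta>:
  assumes "inj_on (\<lambda>G. G - {i}) C" "\<And>G. G \<in> C \<Longrightarrow> G - {i} \<in> proper_flats E' L'"
  shows "(\<Prod>G\<in>C. \<theta> (D.xf (G - {i}))) = \<theta> (flag_prod ((\<lambda>G. G - {i}) ` C))"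
proof -
  have "\<theta> (flag_prod ((\<lambda>G. G - {i}) ` C)) = (\<Prod>G\<in>C. \<theta> (poly_var (X (G - {i}))))"
    unfolding flag_prod_def \<theta>_simps(10) using assms(1) by (simp add: prod.reindex)
  also have "\<dots> = (\<Prod>G\<in>C. \<theta> (D.xf (G - {i})))"
    using assms(2) by (intro prod.cong) (simp_all add: D.xf_proper)
  finally show ?thesis by simp
qed

lemma rank_pos: "0 < M.corank {}"
  using M.corank_pos[OF M.empty_flat] i_in by blast

text \<open>In the presence of the factor \<open>x_F\<close>, each \<open>x_G\<close> may be
  replaced by the image of \<open>x\<close> at \<open>G - {i}\<close>: the extra term is zero or
  belongs to a flat incomparable to \<open>F\<close>. No two members differ by \<open>i\<close>
  alone, so removing \<open>i\<close> keeps the length of the flag, which equals the rank of the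
  deletion.\<close>

lemma flag_prod_noncoloop:
  assumes nc: "E' \<notin> L" and C: "complete_flag E L C" and F: "F \<in> C" "i \<notin> F" "insert i F \<notin> L"
    and top: "\<And>H. H \<in> C \<Longrightarrow> i \<notin> H \<Longrightarrow> H \<subseteq> F"
  obtains C' where "complete_flag E' L' C'" "flag_prod C - \<theta> (flag_prod C') \<in> IM"
proof -
  note CD = M.complete_flagD[OF C]
  let ?d = "\<lambda>G. G - {i}"
  have proper: "?d G \<in> proper_flats E' L'" if "G \<in> C" for G
  proof -
    have "?d G \<noteq> E'"
    proof
      assume eq: "?d G = E'"
      have "G \<noteq> E'" using CD(1)[OF that] nc by blast
      then have "G = E" using eq i_in by blast
      then show False using CD(2)[OF that] by blast
    qed
    then show ?thesis using deletionI[OF CD(1)[OF that]] by (simp add: proper_flats_def)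
  qed
  have no_pair: "insert i G \<notin> C" if G: "G \<in> C" "i \<notin> G" for G
  proof
    assume iG: "insert i G \<in> C"
    then have "G \<noteq> F" using F CD(1) by blast
    then have "\<not> F \<subseteq> insert i G" "\<not> insert i G \<subseteq> F" using top[OF G] F by blast+
    then show False using CD(3)[OF F(1) iG] by blast
  qed
  have inj: "inj_on ?d C"
  proof (rule inj_onI)
    fix G H assume GH: "G \<in> C" "H \<in> C" "?d G = ?d H"
    consider "i \<in> G" "i \<in> H" | "i \<notin> G" "i \<notin> H" | "i \<notin> G" "i \<in> H" | "i \<in> G" "i \<notin> H" by blast
    then show "G = H"
    proof cases
      case 3
      then have "H = insert i G" using GH(3) by auto
      then show ?thesis using no_pair 3 GH by blast
    next
      case 4
      then have "G = insert i H" using GH(3) by auto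
      then show ?thesis using no_pair 4 GH by blast
    qed (use GH(3) in auto)
  qed
  have "proper_flag E' L' (?d ` C)"
    using proper CD(3) unfolding proper_flag_def by blast
  moreover have "card (?d ` C) = D.corank {}"
    using card_image[OF inj] C nc rank_deletion by (simp add: M.complete_flag_iff)
  ultimately have C': "complete_flag E' L' (?d ` C)" by (simp add: D.complete_flag_iff)
  have Fp: "F \<in> proper_flats E L" using F CD(1,2) by (simp add: proper_flats_def)
  have other: "poly_var (X F) * (poly_var (X G) - \<theta> (D.xf (?d G))) \<in> IM" if G: "G \<in> C - {F}" for G
  proof (cases "i \<in> G")
    case True
    then have iG: "insert i (?d G) = G" by blast
    have "?d G \<in> L'" using proper G by (simp add: proper_flats_def)
    then have eq: "poly_var (X G) - \<theta> (D.xf (?d G)) = - M.xf (?d G)"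
      using \<theta>_xf[of "?d G"] CD(1,2) G unfolding iG by (simp add: M.xf_def)
    have "\<not> G \<subseteq> F" using True F by blast
    then have "F \<subseteq> ?d G" using CD(3) F G by blast
    then have "?d G \<notin> L"
      using both_flats_below[of F "?d G"] CD(1) F G iG by (auto simp: both_flats_def)
    then show ?thesis using eq by (simp add: M.xf_not_flat idl_0)
  next
    case False
    then have dG: "?d G = G" by simp
    have "G \<in> L'" using CD(1) G False flat_in_deletion by blast
    then have eq: "poly_var (X G) - \<theta> (D.xf (?d G)) = - e G"
      using \<theta>_xf[of G] CD(1,2) G unfolding dG by (simp add: M.xf_def)
    have "G \<subset> F" using top False G by blast
    then have "M.xf F * e G \<in> IM" using F by (intro M.xf_incomparable) auto
    then show ?thesis using eq Fp by (simp add: M.xf_proper idl_uminus)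
  qed
  have "\<theta> (D.xf (?d F)) = poly_var (X F)"
    using \<theta>_xf[of F] flat_in_deletion[of F] CD(1) F Fp by (simp add: M.xf_proper M.xf_not_flat)
  moreover have "\<theta> (flag_prod (?d ` C)) = (\<Prod>G\<in>C. \<theta> (D.xf (?d G)))"
    using flag_prod_\<theta>[OF inj] proper by simp
  ultimately have "flag_prod C - \<theta> (flag_prod (?d ` C)) =
      poly_var (X F) * ((\<Prod>G\<in>C - {F}. poly_var (X G)) - (\<Prod>G\<in>C - {F}. \<theta> (D.xf (?d G))))"
    using CD(4) F(1) by (simp add: flag_prod_def prod.remove[of C F] right_diff_distrib)
  also have "\<dots> \<in> IM" using other CD(4) by (intro idl_prod_cong) auto
  finally show thesis using that C' by blast
qed

text \<open>All other members lie below \<open>E'\<close>, and the factor \<open>x\<close> at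
  \<open>E'\<close> kills \<open>e G\<close> for them. The flag of the deletion is one shorter, and
  so is its rank.\<close>

lemma flag_prod_coloop:
  assumes co: "E' \<in> L" and C: "complete_flag E L C" and E': "E' \<in> C"
  obtains C' where "complete_flag E' L' C'" "flag_prod C - M.xf E' * \<theta> (flag_prod C') \<in> IM"
proof -
  note CD = M.complete_flagD[OF C]
  have sub: "G \<subset> E'" if G: "G \<in> C - {E'}" for G
  proof -
    have "\<not> E' \<subset> G" using M.flat_subset[OF CD(1)] CD(2) G by blast
    then show ?thesis using CD(3) E' G by blast
  qed
  then have dG: "G - {i} = G" if "G \<in> C - {E'}" for G using that by blast
  have proper: "G \<in> proper_flats E' L'" if "G \<in> C - {E'}" for G
    using sub[OF that] CD(1) that flat_in_deletion by (auto simp: proper_flats_def)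
  have "proper_flag E' L' (C - {E'})"
    using proper CD(3) by (auto simp: proper_flag_def)
  moreover have "card (C - {E'}) = D.corank {}"
    using C co rank_deletion E' CD(4) by (simp add: M.complete_flag_iff)
  ultimately have C': "complete_flag E' L' (C - {E'})" by (simp add: D.complete_flag_iff)
  have "E' \<noteq> E" using i_in by blast
  then have xE': "M.xf E' = poly_var (X E')" using co by (simp add: M.xf_def)
  have other: "M.xf E' * (poly_var (X G) - \<theta> (poly_var (X G))) \<in> IM" if G: "G \<in> C - {E'}" for G
  proof -
    have "poly_var (X G) - \<theta> (poly_var (X G)) = - e G"
      using \<theta>_xf[of G] proper[OF G] CD(1,2) G by (simp add: D.xf_proper M.xf_def proper_flats_def)
    moreover have "M.xf E' * e G \<in> IM" using sub[OF G] by (intro M.xf_incomparable) auto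
    ultimately show ?thesis by (simp add: idl_uminus)
  qed
  have "flag_prod C - M.xf E' * \<theta> (flag_prod (C - {E'})) =
      M.xf E' * ((\<Prod>G\<in>C - {E'}. poly_var (X G)) - (\<Prod>G\<in>C - {E'}. \<theta> (poly_var (X G))))"
    unfolding flag_prod_member[OF CD(4) E'] xE'
    by (simp add: flag_prod_def \<theta>_simps right_diff_distrib)
  also have "\<dots> \<in> IM" using other CD(4) by (intro idl_prod_cong) auto
  finally show thesis using that C' by blast
qed

lemma module_form_image: "module_form a (\<lambda>_. 0) = \<theta> a"
  by (simp add: module_form_def \<theta>_simps)

lemma module_form_single: "F \<in> both_flats \<Longrightarrow> module_form a (\<lambda>H. if H = F then b else 0) = \<theta> a + e F * \<theta> b"
proof -
  assume F: "F \<in> both_flats"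
  have "(\<Sum>H\<in>both_flats. e H * \<theta> (if H = F then b else 0)) = (\<Sum>H\<in>both_flats. if H = F then e H * \<theta> b else 0)"
    by (intro sum.cong) (auto simp: \<theta>_simps)
  then show ?thesis using F finite_both_flats by (simp add: module_form_def)
qed

text \<open>In top degree \<open>e_vanishing\<close> leaves one term of a module form: the image of
  \<open>\<theta>\<close> if \<open>i\<close> is no coloop, the multiple of \<open>e E'\<close> if
  it is, since the image term then exceeds the rank of the deletion.\<close>

lemma degree_functional_step:
  assumes \<delta>': "degree_functional E' L' \<delta>'"
  shows "\<exists>\<delta>. degree_functional E L \<delta>"
proof -
  note D' = degree_functionalD[OF \<delta>']
  \<comment> \<open>The sign comes from \<open>x = \<theta> x - e\<close> at \<open>E'\<close>, by
    which \<open>x\<close> at \<open>E'\<close> has coefficient -1 at \<open>e E'\<close>.\<close>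
  define \<psi> where "\<psi> a b = (if E' \<in> L then - \<delta>' (b E') else \<delta>' a)"
    for a and b :: "'a set \<Rightarrow> 'a chow_poly"
  \<comment> \<open>An arbitrary representation: coefficients are unique modulo the ideals of
    \<open>module_form_cong_unique\<close>, and on those that enter \<open>\<psi>\<close> the
    functional \<open>\<delta>'\<close> vanishes.\<close>
  define co where "co p = (SOME ab. p - module_form (fst ab) (snd ab) \<in> IM)" for p
  define \<delta> where "\<delta> p = \<psi> (fst (co p)) (snd (co p))" for p
  have \<psi>_unique: "\<psi> a b = \<psi> a' b'" if "p - module_form a b \<in> IM" "p - module_form a' b' \<in> IM" for p a b a' b'
    using module_form_cong_unique(1)[OF that] module_form_cong_unique(2)[OF that, of E'] D'(7)
      both_flats_ground comp_ideal_ground by (auto simp: \<psi>_def)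
  have \<delta>_eq: "\<delta> p = \<psi> a b" if "p - module_form a b \<in> IM" for p a b
  proof -
    have "p - module_form (fst (a, b)) (snd (a, b)) \<in> IM" using that by simp
    then have "p - module_form (fst (co p)) (snd (co p)) \<in> IM"
      unfolding co_def by (rule someI)
    then show ?thesis unfolding \<delta>_def using that by (rule \<psi>_unique)
  qed
  have \<delta>'0: "\<delta>' 0 = 0" using D'(3) idl_0 by blast
  have add: "\<delta> (p + q) = \<delta> p + \<delta> q" for p q
  proof -
    obtain a b a' b' where "p - module_form a b \<in> IM" "q - module_form a' b' \<in> IM"
      using ex_module_form by metis
    moreover from idl_cong_add[OF this]
    have "(p + q) - module_form (a + a') (\<lambda>F. b F + b' F) \<in> IM" by (simp add: module_form_add)
    ultimately show ?thesis using \<delta>_eq D'(1) by (simp add: \<psi>_def)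
  qed
  have scale: "\<delta> (poly_const c * p) = c * \<delta> p" for c p
  proof -
    obtain a b where ab: "p - module_form a b \<in> IM" using ex_module_form by blast
    have "poly_const c * (p - module_form a b) \<in> IM" using ab by (rule idl_mult)
    then have "poly_const c * p - module_form (poly_const c * a) (\<lambda>F. poly_const c * b F) \<in> IM"
      using module_form_mult[of "poly_const c" a b] by (simp add: right_diff_distrib \<theta>_simps)
    then show ?thesis using \<delta>_eq ab D'(2) by (simp add: \<psi>_def)
  qed
  have ideal: "\<delta> p = 0" if "p \<in> IM" for p
    using \<delta>_eq[of p 0 "\<lambda>_. 0"] that \<delta>'0 by (simp add: module_form_image \<theta>_simps \<psi>_def)
  have cong: "\<delta> p = \<delta> q" if "p - q \<in> IM" for p q
    using add[of "p - q" q] ideal[OF that] by simp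
  have \<delta>_noncoloop: "\<delta> (\<theta> a) = \<delta>' a" if "E' \<notin> L" for a
    using \<delta>_eq[of "\<theta> a" a "\<lambda>_. 0"] that by (simp add: module_form_image idl_0 \<psi>_def)
  have \<delta>_coloop: "\<delta> (M.xf E' * \<theta> b) = \<delta>' b" if "E' \<in> L" for b
  proof -
    have eq: "M.xf E' = \<theta> (D.xf E') - e E'" using \<theta>_xf[OF D.ground_flat] by simp
    have "M.xf E' * \<theta> b = (\<theta> (D.xf E') - e E') * \<theta> b" by (simp only: eq)
    also have "\<dots> = module_form (D.xf E' * b) (\<lambda>H. if H = E' then - b else 0)"
      using that by (simp add: module_form_single both_flats_ground \<theta>_simps left_diff_distrib)
    finally have "\<delta> (M.xf E' * \<theta> b) = - \<delta>' (- b)"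
      using \<delta>_eq[of "M.xf E' * \<theta> b" "D.xf E' * b" "\<lambda>H. if H = E' then - b else 0"] that
      by (simp add: idl_0 \<psi>_def)
    also have "\<dots> = \<delta>' b" using D'(6)[of 0 b] \<delta>'0 by simp
    finally show ?thesis .
  qed
  \<comment> \<open>Exchanges enlarge the last member \<open>F\<close> avoiding \<open>i\<close> until the flag restricts to a complete
    flag of the deletion.\<close>
  have flags: "\<delta> (flag_prod C) = 1"
    if "complete_flag E L C" "F \<in> C" "i \<notin> F" "\<And>H. H \<in> C \<Longrightarrow> i \<notin> H \<Longrightarrow> H \<subseteq> F" for C F
    using that
  proof (induction "M.corank F" arbitrary: C F rule: less_induct)
    case less
    note C = less.prems(1) and F = less.prems(2,3) and top = less.prems(4)
    note CD = M.complete_flagD[OF C]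
    have FL: "F \<in> L" "F \<noteq> E" using CD(1,2) F by auto
    \<comment> \<open>For a coloop, adding \<open>i\<close> to a flat below \<open>E'\<close> always
      gives a flat. So the first two cases end the process, and the third one admits an
      exchange.\<close>
    consider "E' \<in> L" "F = E'" | "E' \<notin> L" "insert i F \<notin> L" | "F \<noteq> E'" "insert i F \<in> L"
    proof -
      have "insert i F \<in> L" if "E' \<in> L"
        using both_flats_below[of F E'] that FL F M.flat_subset both_flats_ground
        by (auto simp: both_flats_def)
      then show thesis using that FL by blast
    qed
    then show ?case
    proof cases
      case 1
      then obtain C' where C': "complete_flag E' L' C'" "flag_prod C - M.xf E' * \<theta> (flag_prod C') \<in> IM"
        using flag_prod_coloop C F by blast
      then show ?thesis using cong[OF C'(2)] \<delta>_coloop 1 D'(4) by simp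
    next
      case 2
      then obtain C' where C': "complete_flag E' L' C'" "flag_prod C - \<theta> (flag_prod C') \<in> IM"
        using flag_prod_noncoloop[OF 2(1) C F(1) F(2) 2(2) top] by blast
      then show ?thesis using cong[OF C'(2)] \<delta>_noncoloop 2 D'(4) by simp
    next
      case 3
      define N where "N = insert i F"
      have N: "N \<in> L" "F \<subset> N" "N \<noteq> E"
        using 3 F M.flat_subset[OF FL(1)] by (auto simp: N_def)
      have "M.cl (insert i F) = N" using M.cl_eq[OF N(1)] by (simp add: N_def)
      then have rkN: "M.corank F = Suc (M.corank N)"
        using M.corank_cl_insert[OF FL(1) i_in F(2)] by simp
      have "\<exists>H\<in>C. M.corank H = M.corank N"
        using M.corank_pos[OF N(1,3)] M.corank_le[OF N(1)] by (intro CD(5)) auto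
      then obtain H where H: "H \<in> C" "M.corank H = M.corank N" by blast
      have "F \<subset> H" using CD(7)[OF F(1) H(1)] H rkN by simp
      then have "N \<subseteq> H" using top[OF H(1)] by (auto simp: N_def)
      then have NC: "N \<in> C" using M.corank_eq[OF N(1) CD(1)[OF H(1)]] H by simp
      obtain N2 where N2: "N2 \<in> insert E C" "N \<subset> N2" "M.corank N = Suc (M.corank N2)"
      proof (cases "M.corank N = 1")
        case True
        have "N \<subset> E" using M.flat_subset[OF N(1)] N(3) by blast
        then show thesis using that[of E] M.corank_ground True by simp
      next
        case False
        then have "\<exists>H\<in>C. M.corank H = M.corank N - 1"
          using M.corank_pos[OF N(1,3)] M.corank_le[OF N(1)] by (intro CD(5)) auto
        then obtain H where H: "H \<in> C" "M.corank H = M.corank N - 1" by blast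
        have less: "M.corank N = Suc (M.corank H)" using H(2) M.corank_pos[OF N(1,3)] by simp
        then have "N \<subset> H" by (intro CD(7)[OF NC H(1)]) simp
        then show thesis using that[of H] H(1) less by blast
      qed
      have N2L: "N2 \<in> L" using N2 CD(1) M.ground_flat by blast
      obtain k where k: "k \<in> N2" "k \<notin> N" using N2 by blast
      then have kF: "k \<in> E" "k \<notin> F" using M.flat_subset[OF N2L] by (auto simp: N_def)
      \<comment> \<open>The next member \<open>N = insert i F\<close> is traded for a cover of
        \<open>F\<close> that avoids \<open>i\<close>, so the last member avoiding \<open>i\<close>
        becomes larger and its corank drops.\<close>
      define F2 where "F2 = M.cl (insert k F)"
      have F2: "F2 \<in> L" "F \<subset> F2"
        using M.covering_cl[OF FL(1) kF] by (simp_all add: F2_def covering_flat_def)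
      have rkF2: "M.corank F = Suc (M.corank F2)"
        using M.corank_cl_insert[OF FL(1) kF] by (simp add: F2_def)
      have kF2: "k \<in> F2" using M.subset_cl[of "insert k F"] by (auto simp: F2_def)
      have "F2 \<subseteq> N2" unfolding F2_def using N2L k N2(2) N(2) by (intro M.cl_least) auto
      moreover have "F2 \<noteq> N2" using rkF2 rkN N2(3) by auto
      ultimately have F2N2: "F2 \<subset> N2" by blast
      have iF2: "i \<notin> F2"
      proof
        assume "i \<in> F2"
        then have "N \<subseteq> F2" using F2 by (auto simp: N_def)
        then have "N = F2" using M.corank_eq[OF N(1) F2(1)] rkN rkF2 by simp
        then show False using k kF2 by simp
      qed
      have F2N: "F2 \<noteq> N" using k kF2 by blast
      let ?C2 = "insert F2 (C - {N})"
      note ex = M.flag_exchange[OF C F(1) NC N2(1) N(2) N2(2) rkN N2(3) F2 F2N2 F2N]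
      have "\<delta> (flag_prod ?C2) = 1"
        using rkF2 ex(1) iF2 top F2(2) by (intro less.hyps[of F2]) auto
      then show ?thesis using cong[OF ex(2)] by simp
    qed
  qed
  have "\<delta> (flag_prod C) = 1" if C: "complete_flag E L C" for C
  proof -
    note CD = M.complete_flagD[OF C]
    obtain H where H: "H \<in> C" "M.corank H = M.corank {}"
      using CD(5)[of "M.corank {}"] rank_pos by auto
    then have "{} = H" using M.corank_eq[OF M.empty_flat CD(1)[OF H(1)]] by simp
    define B where "B = {H \<in> C. i \<notin> H}"
    have "{} \<in> B" "finite B" using H \<open>{} = H\<close> CD(4) by (auto simp: B_def)
    then obtain F where F: "F \<in> B" "\<And>H. H \<in> B \<Longrightarrow> F \<subseteq> H \<Longrightarrow> H = F"
      using finite_has_maximal[of B] by blast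
    have "H \<subseteq> F" if "H \<in> C" "i \<notin> H" for H
      using F(2)[of H] CD(3)[of H F] F(1) that by (auto simp: B_def)
    then show ?thesis using flags[OF C, of F] F(1) by (auto simp: B_def)
  qed
  moreover have "p \<in> IM" if p: "homogeneous_poly (matroid_rank E L) p" "\<delta> p = 0" for p
  proof -
    obtain d where d: "M.corank {} = Suc d" using rank_pos gr0_implies_Suc by blast
    obtain a b where ab: "p - module_form a b \<in> IM" "homogeneous_poly (Suc d) a"
        "\<And>F. homogeneous_poly d (b F)"
      using ex_module_form_homogeneous[of d p] p(1) d M.matroid_rank_eq by metis
    have van: "e F * \<theta> (b F) \<in> IM" if "F \<in> both_flats" "F \<noteq> E'" for F
      using e_vanishing[OF that ab(3)] d by simp
    have \<psi>0: "\<psi> a b = 0" using \<delta>_eq[OF ab(1)] p(2) by simp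
    have "module_form a b \<in> IM"
    proof (cases "E' \<in> L")
      case True
      then have rk: "D.corank {} = d" using rank_deletion d by simp
      then have "a \<in> ID" using D.vanishing_above_rank[OF ab(2)] by simp
      moreover have "b E' \<in> ID"
        using D'(5)[of "b E'"] ab(3) rk \<psi>0 True D.matroid_rank_eq by (simp add: \<psi>_def)
      then have "e F * \<theta> (b F) \<in> IM" if "F \<in> both_flats" for F
        using van[OF that] \<theta>_ideal idl_mult by (cases "F = E'") blast+
      ultimately show ?thesis unfolding module_form_def by (intro idl_add idl_sum \<theta>_ideal)
    next
      case False
      then have rk: "D.corank {} = Suc d" using rank_deletion d by simp
      then have "a \<in> ID"
        using D'(5)[of a] ab(2) \<psi>0 False D.matroid_rank_eq by (simp add: \<psi>_def)
      moreover have "e F * \<theta> (b F) \<in> IM" if "F \<in> both_flats" for F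
        using van[OF that] that False both_flats_ground by blast
      ultimately show ?thesis unfolding module_form_def by (intro idl_add idl_sum \<theta>_ideal)
    qed
    then show ?thesis using ab(1) idl_cong_mem by blast
  qed
  ultimately have "degree_functional E L \<delta>"
    unfolding degree_functional_def using add scale ideal by blast
  then show ?thesis by blast
qed

end

text \<open>Without proper flats all variables vanish, the empty flag is the complete one, and the
  degree is the constant term.\<close>

lemma degree_functional_empty:
  assumes "loopless_matroid {} L"
  shows "\<exists>\<delta>. degree_functional {} L \<delta>"
proof -
  interpret loopless_matroid "{}" L by fact
  have pf: "proper_flats {} L = {}" using flat_subset by (auto simp: proper_flats_def)
  define \<delta> where "\<delta> = (poly_eval (\<lambda>c. c) (\<lambda>_. 0) :: 'a chow_poly \<Rightarrow> rat)"
  note \<delta>_simps = poly_eval_simps[OF scalar_hom_id, of "\<lambda>_::'a chow_var. 0", folded \<delta>_def]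
  have var: "poly_var v \<in> chow_full_ideal {} L" for v :: "'a chow_var"
    using outside_var[of v] pf by simp
  have const: "p - poly_const (\<delta> p) \<in> chow_full_ideal {} L" for p
  proof (induction p rule: poly_induct_vars)
    case (add p q)
    then show ?case by (simp add: \<delta>_simps poly_const_add idl_cong_add)
  next
    case (mult p q)
    then show ?case by (simp add: \<delta>_simps poly_const_mult idl_cong_mult)
  qed (simp_all add: \<delta>_simps idl_0 var)
  have "\<delta> p = 0" if "p \<in> chow_full_ideal {} L" for p
    using that
  proof induction
    case (idl_gen g)
    then show ?case by (cases rule: chow_gens_cases) (simp_all add: pf \<delta>_simps)
  qed (simp_all add: \<delta>_simps)
  moreover have "\<delta> (flag_prod C) = 1" if "complete_flag {} L C" for C
    using that pf by (simp add: complete_flag_def proper_flag_def flag_prod_def \<delta>_simps)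
  moreover have "p \<in> chow_full_ideal {} L" if "\<delta> p = 0" for p
    using const[of p] that by simp
  ultimately have "degree_functional {} L \<delta>"
    by (simp add: degree_functional_def \<delta>_simps)
  then show ?thesis by blast
qed

theorem ex_degree_functional:
  assumes "loopless_matroid E L"
  shows "\<exists>\<delta>. degree_functional E L \<delta>"
  using assms
proof (induction "card E" arbitrary: E L)
  case 0
  interpret loopless_matroid E L by fact
  have "E = {}" using 0 finite_E by simp
  then show ?case using degree_functional_empty 0 by blast
next
  case (Suc n)
  interpret loopless_matroid E L by fact
  obtain i where i: "i \<in> E" using Suc(2) by fastforce
  interpret matroid_deletion E L i by unfold_locales (rule i)
  have "card (E - {i}) = n" using Suc(2) i finite_E by simp
  then show ?case using Suc(1)[OF _ D.loopless_matroid_axioms] degree_functional_step by metis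
qed

section \<open>Classes in the Chow ring\<close>

lemma carrier_chow_poly_ring: "carrier (chow_poly_ring E L) = {p. poly_vars p \<subseteq> matroid_vars E L}"
  by (simp add: chow_poly_ring_def matroid_vars_def)

lemma chow_poly_ring_simps:
  "monoid.mult (chow_poly_ring E L) = (*)" "monoid.one (chow_poly_ring E L) = 1"
  "ring.zero (chow_poly_ring E L) = 0" "ring.add (chow_poly_ring E L) = (+)"
  by (simp_all add: chow_poly_ring_def)

lemma restr_carrier: "restr E L p \<in> carrier (chow_poly_ring E L)"
  using poly_vars_restr by (simp add: carrier_chow_poly_ring)

lemma restr_of_carrier: "p \<in> carrier (chow_poly_ring E L) \<Longrightarrow> restr E L p = p"
  by (simp add: carrier_chow_poly_ring restr_id)

lemma chow_poly_ring_cring: "cring (chow_poly_ring E L)"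
proof (rule cringI)
  show "abelian_group (chow_poly_ring E L)"
  proof (rule abelian_groupI)
    fix x assume "x \<in> carrier (chow_poly_ring E L)"
    then have "- x \<in> carrier (chow_poly_ring E L)" by (simp add: carrier_chow_poly_ring)
    then show "\<exists>y\<in>carrier (chow_poly_ring E L). y \<oplus>\<^bsub>chow_poly_ring E L\<^esub> x = \<zero>\<^bsub>chow_poly_ring E L\<^esub>"
      by (auto simp: chow_poly_ring_simps intro!: bexI[of _ "- x"])
  qed (auto simp: chow_poly_ring_simps carrier_chow_poly_ring ac_simps dest: subsetD[OF poly_vars_add])
  show "comm_monoid (chow_poly_ring E L)"
    by (rule comm_monoidI)
      (auto simp: chow_poly_ring_simps carrier_chow_poly_ring ac_simps dest: subsetD[OF poly_vars_mult])
qed (simp add: chow_poly_ring_simps distrib_right)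

context
  fixes E :: "'a set" and L :: "'a set set"
begin

interpretation R: cring "chow_poly_ring E L"
  by (rule chow_poly_ring_cring)

abbreviation "linear_gens \<equiv>
  {poly_var (Y j) - (\<Sum>F\<in>{F \<in> proper_flats E L. j \<notin> F}. poly_var (X F)) | j. j \<in> E}"
abbreviation "monomial_gens \<equiv>
  {poly_var (X F) * poly_var (X G) | F G.
     F \<in> proper_flats E L \<and> G \<in> proper_flats E L \<and> \<not> F \<subseteq> G \<and> \<not> G \<subseteq> F} \<union>
  {poly_var (Y j) * poly_var (X F) | j F. j \<in> E \<and> F \<in> proper_flats E L \<and> j \<notin> F}"

lemma chow_core_gens_eq: "chow_core_gens E L = linear_gens \<union> monomial_gens"
  by (simp add: chow_core_gens_def Un_assoc)

lemma gens_carrier: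
  "linear_gens \<subseteq> carrier (chow_poly_ring E L)" "monomial_gens \<subseteq> carrier (chow_poly_ring E L)"
proof -
  have "chow_core_gens E L \<subseteq> carrier (chow_poly_ring E L)"
    using poly_vars_chow_core_gens by (auto simp: carrier_chow_poly_ring)
  then show "linear_gens \<subseteq> carrier (chow_poly_ring E L)" "monomial_gens \<subseteq> carrier (chow_poly_ring E L)"
    unfolding chow_core_gens_eq Un_subset_iff by simp_all
qed

lemma chow_ideal_ideal: "ideal (chow_ideal E L) (chow_poly_ring E L)"
  unfolding chow_ideal_def chow_linear_ideal_def chow_monomial_ideal_def
  by (intro R.add_ideals R.genideal_ideal gens_carrier)

interpretation I: ideal "chow_ideal E L" "chow_poly_ring E L"
  by (rule chow_ideal_ideal)

lemma full_ideal_ideal: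
  "ideal (chow_full_ideal E L \<inter> carrier (chow_poly_ring E L)) (chow_poly_ring E L)"
proof (rule idealI)
  let ?J = "chow_full_ideal E L \<inter> carrier (chow_poly_ring E L)"
  show "subgroup ?J (add_monoid (chow_poly_ring E L))"
  proof (rule R.add.subgroupI)
    show "?J \<noteq> {}" using idl_0 R.zero_closed by (auto simp: chow_poly_ring_simps)
    fix a assume a: "a \<in> ?J"
    then have "\<ominus>\<^bsub>chow_poly_ring E L\<^esub> a = - a"
      by (intro R.minus_equality) (auto simp: chow_poly_ring_simps carrier_chow_poly_ring)
    then show "\<ominus>\<^bsub>chow_poly_ring E L\<^esub> a \<in> ?J"
      using a R.a_inv_closed[of a] by (simp add: idl_uminus)
  next
    fix a b assume "a \<in> ?J" "b \<in> ?J"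
    then show "a \<oplus>\<^bsub>chow_poly_ring E L\<^esub> b \<in> ?J"
      using R.a_closed[of a b] by (auto simp: chow_poly_ring_simps intro: idl_add)
  qed auto
next
  fix a x assume "a \<in> chow_full_ideal E L \<inter> carrier (chow_poly_ring E L)" "x \<in> carrier (chow_poly_ring E L)"
  then show "x \<otimes>\<^bsub>chow_poly_ring E L\<^esub> a \<in> chow_full_ideal E L \<inter> carrier (chow_poly_ring E L)"
    "a \<otimes>\<^bsub>chow_poly_ring E L\<^esub> x \<in> chow_full_ideal E L \<inter> carrier (chow_poly_ring E L)"
    using R.m_closed[of x a] R.m_closed[of a x]
    by (auto simp: chow_poly_ring_simps intro: idl_mult idl_mult_right)
qed (rule R.ring_axioms)

lemma chow_ideal_subset: "chow_ideal E L \<subseteq> chow_full_ideal E L"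
proof -
  let ?J = "chow_full_ideal E L \<inter> carrier (chow_poly_ring E L)"
  have "linear_gens \<union> monomial_gens \<subseteq> chow_full_ideal E L"
    unfolding chow_core_gens_eq[symmetric] using chow_core_ideal_subset idl_gen by blast
  then have "linear_gens \<subseteq> ?J" "monomial_gens \<subseteq> ?J" using gens_carrier by simp_all
  then have "chow_linear_ideal E L \<subseteq> ?J" "chow_monomial_ideal E L \<subseteq> ?J"
    unfolding chow_linear_ideal_def chow_monomial_ideal_def
    by (intro R.genideal_minimal full_ideal_ideal; simp)+
  then show ?thesis
    unfolding chow_ideal_def set_add_def' by (auto simp: chow_poly_ring_simps intro!: idl_add)
qed

lemma gens_in_chow_ideal: "chow_core_gens E L \<subseteq> chow_ideal E L"
proof -
  have 1: "ideal (chow_linear_ideal E L) (chow_poly_ring E L)" "ideal (chow_monomial_ideal E L) (chow_poly_ring E L)"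
    unfolding chow_linear_ideal_def chow_monomial_ideal_def by (intro R.genideal_ideal gens_carrier)+
  have 0: "0 \<in> chow_linear_ideal E L" "0 \<in> chow_monomial_ideal E L"
    using additive_subgroup.zero_closed[OF ideal.axioms(1)] 1 by (fastforce simp: chow_poly_ring_simps)+
  have "linear_gens \<subseteq> chow_linear_ideal E L" "monomial_gens \<subseteq> chow_monomial_ideal E L"
    unfolding chow_linear_ideal_def chow_monomial_ideal_def by (intro R.genideal_self gens_carrier)+
  moreover have "p \<in> chow_ideal E L" if "p \<in> chow_linear_ideal E L \<or> p \<in> chow_monomial_ideal E L" for p
    using that 0 unfolding chow_ideal_def set_add_def' chow_poly_ring_simps
    by (metis (no_types, lifting) UN_iff add.left_neutral add.right_neutral singletonI)
  ultimately show ?thesis unfolding chow_core_gens_eq by blast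
qed

text \<open>Along a derivation in the inductive ideal, \<open>restr\<close> kills the foreign
  generators and fixes the others, so the result lies in the ideal generated inside the
  carrier.\<close>

lemma chow_ideal_iff:
  assumes "p \<in> carrier (chow_poly_ring E L)"
  shows "p \<in> chow_ideal E L \<longleftrightarrow> p \<in> chow_full_ideal E L"
proof
  show "p \<in> chow_ideal E L \<Longrightarrow> p \<in> chow_full_ideal E L" using chow_ideal_subset by blast
  assume "p \<in> chow_full_ideal E L"
  then have "restr E L p \<in> chow_ideal E L"
  proof induction
    case idl_0
    then show ?case using I.zero_closed by (simp add: restr_simps chow_poly_ring_simps)
  next
    case (idl_gen g)
    show ?case
    proof (cases "g \<in> chow_core_gens E L")
      case True
      then show ?thesis using gens_in_chow_ideal restr_id[OF poly_vars_chow_core_gens[OF True]] by auto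
    next
      case False
      then have "restr E L g = 0"
        using idl_gen by (auto simp: chow_gens_def restr_simps matroid_vars_def)
      then show ?thesis using I.zero_closed by (simp add: chow_poly_ring_simps)
    qed
  next
    case (idl_add p q)
    then show ?case using I.a_closed by (simp add: restr_simps chow_poly_ring_simps)
  next
    case (idl_mult p r)
    then show ?case
      using I.I_l_closed[OF _ restr_carrier[of E L r]] by (simp add: restr_simps chow_poly_ring_simps)
  qed
  then show "p \<in> chow_ideal E L" using assms by (simp add: restr_of_carrier)
qed

lemma chow_class_eq_iff:
  assumes "p \<in> carrier (chow_poly_ring E L)" "q \<in> carrier (chow_poly_ring E L)"
  shows "chow_class E L p = chow_class E L q \<longleftrightarrow> p - q \<in> chow_full_ideal E L"
proof -
  have "- q \<in> carrier (chow_poly_ring E L)" using assms by (simp add: carrier_chow_poly_ring)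
  moreover from this have "\<ominus>\<^bsub>chow_poly_ring E L\<^esub> q = - q"
    using assms by (intro R.minus_equality) (auto simp: chow_poly_ring_simps)
  ultimately have "p \<ominus>\<^bsub>chow_poly_ring E L\<^esub> q = p - q" "p - q \<in> carrier (chow_poly_ring E L)"
    using R.minus_closed[OF assms] by (simp_all add: a_minus_def chow_poly_ring_simps)
  then show ?thesis
    using R.quotient_eq_iff_same_a_r_cos[OF chow_ideal_ideal assms] chow_ideal_iff
    by (simp add: chow_class_def)
qed

text \<open>Total on all polynomials, so computations with classes carry no carrier conditions and
  equality becomes membership in \<open>chow_full_ideal\<close>.\<close>

definition cc :: "'a chow_poly \<Rightarrow> 'a chow_poly set" where
  "cc p = chow_class E L (restr E L p)"

lemma cc_eq_iff: "cc p = cc q \<longleftrightarrow> p - q \<in> chow_full_ideal E L"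
proof -
  have "restr E L p - restr E L q \<in> chow_full_ideal E L \<longleftrightarrow> p - q \<in> chow_full_ideal E L"
    using restr_cong[of "p - q" E L] idl_cong_mem[of "p - q" "restr E L (p - q)"]
      idl_cong_mem[OF idl_cong_sym, of "p - q" "restr E L (p - q)"]
    by (auto simp: restr_simps)
  then show ?thesis unfolding cc_def by (simp add: chow_class_eq_iff restr_carrier)
qed

lemma cc_of_carrier: "p \<in> carrier (chow_poly_ring E L) \<Longrightarrow> chow_class E L p = cc p"
  by (simp add: cc_def restr_of_carrier)

lemma CH_cring: "cring (CH E L)"
  unfolding CH_def by (rule I.quotient_is_cring) (rule R.is_cring)

lemma chow_class_hom: "chow_class E L \<in> ring_hom (chow_poly_ring E L) (CH E L)"
  using I.rcos_ring_hom unfolding CH_def chow_class_def[abs_def] .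

lemma cc_add: "cc p \<oplus>\<^bsub>CH E L\<^esub> cc q = cc (p + q)"
  using ring_hom_add[OF chow_class_hom restr_carrier restr_carrier, of p q]
  by (simp add: cc_def restr_simps chow_poly_ring_simps)

lemma cc_mult: "cc p \<otimes>\<^bsub>CH E L\<^esub> cc q = cc (p * q)"
  using ring_hom_mult[OF chow_class_hom restr_carrier restr_carrier, of p q]
  by (simp add: cc_def restr_simps chow_poly_ring_simps)

lemma cc_one: "\<one>\<^bsub>CH E L\<^esub> = cc 1"
  using ring_hom_one[OF chow_class_hom] by (simp add: cc_def restr_simps chow_poly_ring_simps)

lemma carrier_CH: "carrier (CH E L) = range cc"
proof -
  have "carrier (CH E L) = chow_class E L ` carrier (chow_poly_ring E L)"
    by (auto simp: CH_def FactRing_def A_RCOSETS_def' chow_class_def)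
  also have "\<dots> = range cc"
  proof
    show "chow_class E L ` carrier (chow_poly_ring E L) \<subseteq> range cc" using cc_of_carrier by auto
    show "range cc \<subseteq> chow_class E L ` carrier (chow_poly_ring E L)"
      using restr_carrier by (auto simp: cc_def)
  qed
  finally show ?thesis .
qed

lemma cc_carrier [simp]: "cc p \<in> carrier (CH E L)"
  by (simp add: carrier_CH)

interpretation Q: cring "CH E L"
  by (rule CH_cring)

lemma cc_zero: "\<zero>\<^bsub>CH E L\<^esub> = cc 0"
  using Q.r_neg[of "cc 0"] Q.l_zero[of "cc 0"] cc_add[of 0 0] Q.add.l_cancel_one'[of "cc 0" "cc 0"] by simp

lemma cc_eq_zero_iff: "cc p = \<zero>\<^bsub>CH E L\<^esub> \<longleftrightarrow> p \<in> chow_full_ideal E L"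
  by (simp add: cc_zero cc_eq_iff)

lemma cc_finsum: "(\<Oplus>\<^bsub>CH E L\<^esub>x\<in>A. cc (f x)) = cc (\<Sum>x\<in>A. f x)"
proof (induction A rule: infinite_finite_induct)
  case (infinite A)
  then show ?case by (simp add: cc_zero Q.finsum_infinite)
qed (simp_all add: cc_zero cc_add)

lemma cc_finprod: "(\<Otimes>\<^bsub>CH E L\<^esub>x\<in>A. cc (f x)) = cc (\<Prod>x\<in>A. f x)"
proof (induction A rule: infinite_finite_induct)
  case (infinite A)
  then show ?case by (simp add: cc_one Q.finprod_infinite)
qed (simp_all add: cc_one cc_mult)

lemma chow_const_eq: "chow_const E L c = cc (poly_const c)"
  unfolding chow_const_def by (rule cc_of_carrier) (simp add: carrier_chow_poly_ring)

lemma chow_x_eq: "chow_x E L F = cc (if F \<in> proper_flats E L then poly_var (X F) else 0)"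
  using cc_of_carrier[of "poly_var (X F)"]
  by (auto simp: chow_x_def cc_zero carrier_chow_poly_ring matroid_vars_def)

lemma CH_deg_eq: "CH_deg E L k = cc ` {p. homogeneous_poly k p}"
proof -
  have "cc p = chow_class E L (restr E L p) \<and> restr E L p \<in> carrier (chow_poly_ring E L) \<and>
      homogeneous_poly k (restr E L p)" if "homogeneous_poly k p" for p
    using that restr_carrier restr_homogeneous by (auto simp: cc_def)
  then show ?thesis unfolding CH_deg_def using cc_of_carrier by (auto simp: image_def) metis+
qed

end

context flat_matroid
begin

text \<open>At the ground set the conventions differ: \<open>chow_x\<close> is zero there,
  \<open>xf\<close> is minus the sum over the proper flats.\<close>

lemma chow_x_xf: "F \<noteq> E \<Longrightarrow> chow_x E L F = cc E L (xf F)"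
  by (simp add: chow_x_eq xf_def proper_flats_def)

end

section \<open>Uniqueness of the degree map\<close>

context loopless_matroid
begin

text \<open>Existence comes from a degree functional. For uniqueness, every class of top degree is a
  multiple of one complete flag monomial, whose value is prescribed; elsewhere the map is fixed by
  extensionality.\<close>

lemma is_degree_map_degree_map: "is_degree_map E L (degree_map E L)"
proof -
  interpret Q: cring "CH E L" by (rule CH_cring)
  let ?d = "matroid_rank E L" and ?T = "CH_deg E L (matroid_rank E L)"
  obtain \<delta> where \<delta>: "degree_functional E L \<delta>"
    using ex_degree_functional loopless_matroid_axioms by blast
  note D = degree_functionalD[OF \<delta>]
  obtain C0 where C0: "complete_flag E L C0" using ex_complete_flag by blast
  have flag_deg: "homogeneous_poly ?d (flag_prod C)" if "complete_flag E L C" for C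
    using flag_prod_homogeneous[of C] complete_flag_card[OF that] by (simp add: matroid_rank_eq)
  have flag_class: "(\<Otimes>\<^bsub>CH E L\<^esub>F\<in>C. chow_x E L F) = cc E L (flag_prod C)" if "complete_flag E L C" for C
  proof -
    have "(\<Otimes>\<^bsub>CH E L\<^esub>F\<in>C. chow_x E L F) = (\<Otimes>\<^bsub>CH E L\<^esub>F\<in>C. cc E L (poly_var (X F)))"
      using that by (intro Q.finprod_cong') (auto simp: chow_x_eq complete_flag_def proper_flag_def)
    then show ?thesis by (simp add: cc_finprod flag_prod_def)
  qed
  define \<phi> where "\<phi> = restrict (\<lambda>\<eta>. \<delta> (SOME p. \<eta> = cc E L p)) ?T"
  have \<phi>: "\<phi> (cc E L p) = \<delta> p" if "cc E L p \<in> ?T" for p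
  proof -
    have "cc E L p = cc E L (SOME q. cc E L p = cc E L q)" by (rule someI) (rule refl)
    then have "p - (SOME q. cc E L p = cc E L q) \<in> chow_full_ideal E L" by (simp add: cc_eq_iff)
    then show ?thesis using D(7) that by (simp add: \<phi>_def)
  qed
  have T: "cc E L p \<in> ?T" if "homogeneous_poly ?d p" for p
    using that by (auto simp: CH_deg_eq)
  have T_cases: "\<exists>p. homogeneous_poly ?d p \<and> \<eta> = cc E L p" if "\<eta> \<in> ?T" for \<eta>
    using that by (auto simp: CH_deg_eq)
  have scale_deg: "homogeneous_poly ?d (poly_const c * p)" if "homogeneous_poly ?d p" for c p
    using homogeneous_poly_mult[OF homogeneous_poly_const that] by simp
  have multiple: "cc E L p = chow_const E L (\<delta> p) \<otimes>\<^bsub>CH E L\<^esub> cc E L (flag_prod C0)"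
    if "homogeneous_poly ?d p" for p
  proof -
    have "homogeneous_poly ?d (p - poly_const (\<delta> p) * flag_prod C0)"
      using that scale_deg flag_deg[OF C0] by (intro homogeneous_poly_diff)
    moreover have "\<delta> (p - poly_const (\<delta> p) * flag_prod C0) = 0" using D(2,4,6) C0 by simp
    ultimately have "p - poly_const (\<delta> p) * flag_prod C0 \<in> chow_full_ideal E L" by (rule D(5))
    then show ?thesis by (simp add: chow_const_eq cc_mult cc_eq_iff)
  qed
  have "is_degree_map E L \<phi>"
    unfolding is_degree_map_def Let_def
  proof (intro conjI ballI allI impI)
    show "\<phi> \<in> extensional ?T" by (simp add: \<phi>_def)
    show "\<phi> (\<eta> \<oplus>\<^bsub>CH E L\<^esub> \<xi>) = \<phi> \<eta> + \<phi> \<xi>" if \<eta>: "\<eta> \<in> ?T" and \<xi>: "\<xi> \<in> ?T" for \<eta> \<xi>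
    proof -
      obtain p q where "homogeneous_poly ?d p" "\<eta> = cc E L p" "homogeneous_poly ?d q" "\<xi> = cc E L q"
        using T_cases \<eta> \<xi> by blast
      then show ?thesis using T homogeneous_poly_add[of ?d p q] by (simp add: cc_add \<phi> D(1))
    qed
    show "\<phi> (chow_const E L c \<otimes>\<^bsub>CH E L\<^esub> \<eta>) = c * \<phi> \<eta>" if \<eta>: "\<eta> \<in> ?T" for c \<eta>
    proof -
      obtain p where p: "homogeneous_poly ?d p" "\<eta> = cc E L p" using T_cases[OF \<eta>] by blast
      have "\<phi> (cc E L (poly_const c * p)) = \<delta> (poly_const c * p)" "\<phi> (cc E L p) = \<delta> p"
        using \<phi>[OF T[OF scale_deg[OF p(1)]]] \<phi>[OF T[OF p(1)]] by blast+
      then show ?thesis by (simp add: p(2) chow_const_eq cc_mult D(2))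
    qed
    show "bij_betw \<phi> ?T UNIV"
    proof (rule bij_betwI')
      show "\<phi> \<eta> = \<phi> \<xi> \<longleftrightarrow> \<eta> = \<xi>" if \<eta>: "\<eta> \<in> ?T" and \<xi>: "\<xi> \<in> ?T" for \<eta> \<xi>
      proof -
        obtain p q where "homogeneous_poly ?d p" "\<eta> = cc E L p" "homogeneous_poly ?d q" "\<xi> = cc E L q"
          using T_cases \<eta> \<xi> by blast
        then show ?thesis using multiple[of p] multiple[of q] \<phi>[of p] \<phi>[of q] \<eta> \<xi> by metis
      qed
      show "\<exists>\<eta>\<in>?T. c = \<phi> \<eta>" for c
      proof
        have hom: "homogeneous_poly ?d (poly_const c * flag_prod C0)" using scale_deg flag_deg C0 by blast
        then show "cc E L (poly_const c * flag_prod C0) \<in> ?T" by (rule T)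
        then show "c = \<phi> (cc E L (poly_const c * flag_prod C0))" using D(2,4) C0 \<phi> by simp
      qed
    qed simp
    show "\<phi> (\<Otimes>\<^bsub>CH E L\<^esub>F\<in>C. chow_x E L F) = 1" if "complete_flag E L C" for C
      using flag_class[OF that] \<phi>[OF T[OF flag_deg[OF that]]] D(4)[OF that] by simp
  qed
  moreover have "\<phi>' = \<phi>" if \<phi>': "is_degree_map E L \<phi>'" for \<phi>'
  proof (rule extensionalityI[of _ ?T])
    show "\<phi>' \<in> extensional ?T" using \<phi>' by (simp add: is_degree_map_def Let_def)
    show "\<phi> \<in> extensional ?T" by (simp add: \<phi>_def)
    fix \<eta> assume \<eta>: "\<eta> \<in> ?T"
    then obtain p where p: "homogeneous_poly ?d p" "\<eta> = cc E L p" using T_cases by blast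
    have "\<phi>' (cc E L p) = \<delta> p * \<phi>' (cc E L (flag_prod C0))"
      unfolding multiple[OF p(1)] using \<phi>' T[OF flag_deg[OF C0]]
      unfolding is_degree_map_def Let_def by blast
    moreover have "\<phi>' (cc E L (flag_prod C0)) = 1"
      using \<phi>' C0 flag_class[OF C0] unfolding is_degree_map_def Let_def by metis
    ultimately show "\<phi>' \<eta> = \<phi> \<eta>" using p \<phi> \<eta> by simp
  qed
  ultimately show ?thesis unfolding degree_map_def by (rule theI)
qed

lemma degree_map_zero: "degree_map E L (cc E L 0) = 0"
proof -
  have "cc E L 0 \<in> CH_deg E L (matroid_rank E L)" by (auto simp: CH_deg_eq)
  then have "degree_map E L (chow_const E L 0 \<otimes>\<^bsub>CH E L\<^esub> cc E L 0) = 0 * degree_map E L (cc E L 0)"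
    using is_degree_map_degree_map unfolding is_degree_map_def Let_def by blast
  then show ?thesis by (simp add: chow_const_eq cc_mult)
qed

end

section \<open>The homomorphism from the Chow ring of the deletion\<close>

context matroid_deletion
begin

abbreviation "ccM \<equiv> cc E L"
abbreviation "ccD \<equiv> cc E' L'"

text \<open>The conditions fix \<open>h\<close> on scalars and on all \<open>x_F\<close>; each
  \<open>y_j\<close> is a sum of those, and foreign variables are zero.\<close>

lemma is_theta_eq:
  assumes h: "is_theta E L i h"
  shows "h (ccD p) = ccM (\<theta> p)"
proof -
  interpret QD: cring "CH E' L'" by (rule CH_cring)
  interpret QM: cring "CH E L" by (rule CH_cring)
  have hom: "h \<in> ring_hom (CH E' L') (CH E L)" using h by (simp add: is_theta_def Let_def)
  have add: "h (ccD (p + q)) = ccM (\<theta> (p + q))"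
    if "h (ccD p) = ccM (\<theta> p)" "h (ccD q) = ccM (\<theta> q)" for p q
    using ring_hom_add[OF hom, of "ccD p" "ccD q"] that by (simp add: cc_add \<theta>_simps)
  have cong: "h (ccD p) = ccM (\<theta> p)" if "p - q \<in> ID" "h (ccD q) = ccM (\<theta> q)" for p q
  proof -
    have "\<theta> p - \<theta> q \<in> IM" using \<theta>_ideal[OF that(1)] by (simp add: \<theta>_simps)
    then have "ccM (\<theta> p) = ccM (\<theta> q)" "ccD p = ccD q" using that(1) by (simp_all add: cc_eq_iff)
    then show ?thesis using that(2) by simp
  qed
  have const: "h (ccD (poly_const c)) = ccM (\<theta> (poly_const c))" for c
    using h by (simp add: is_theta_def Let_def chow_const_eq \<theta>_simps)
  have zero: "h (ccD 0) = ccM (\<theta> 0)" using const[of 0] by simp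
  have X: "h (ccD (poly_var (X F))) = ccM (\<theta> (poly_var (X F)))" if F: "F \<in> proper_flats E' L'" for F
  proof -
    have ne: "F \<noteq> E" "insert i F \<noteq> E"
      using F D.flat_subset by (auto simp: proper_flats_def mem_deletion_iff)
    have "h (chow_x E' L' F) = chow_x E L F \<oplus>\<^bsub>CH E L\<^esub> chow_x E L (insert i F)"
      using h F by (simp add: is_theta_def Let_def)
    then show ?thesis using F ne
      by (simp add: chow_x_eq[of E' L'] M.chow_x_xf cc_add \<theta>_simps theta_var_def)
  qed
  have sum: "h (ccD (\<Sum>F\<in>A. poly_var (X F))) = ccM (\<theta> (\<Sum>F\<in>A. poly_var (X F)))"
    if "A \<subseteq> proper_flats E' L'" for A
    using that
  proof (induction A rule: infinite_finite_induct)
    case (insert F A)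
    then show ?case using add[OF X] by simp
  qed (simp_all add: zero)
  show ?thesis
  proof (induction p rule: poly_induct_vars)
    case (const c)
    then show ?case by (rule \<open>\<And>c. h (ccD (poly_const c)) = ccM (\<theta> (poly_const c))\<close>)
  next
    case (var v)
    show ?case
    proof (cases "v \<in> matroid_vars E' L'")
      case False
      then have "poly_var v - 0 \<in> ID"
        using D.outside_var[of v] by (simp add: matroid_vars_def)
      then show ?thesis using cong zero by blast
    next
      case True
      then consider j where "j \<in> E'" "v = Y j" | F where "F \<in> proper_flats E' L'" "v = X F"
        by (auto simp: matroid_vars_def)
      then show ?thesis
      proof cases
        case 1
        then show ?thesis
          using cong[OF D.var_Y_eq[OF 1(1), folded D.sum_xf_avoiding[OF 1(1)]] sum] by auto
      next
        case 2
        then show ?thesis using X by simp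
      qed
    qed
  next
    case (add p q)
    then show ?case by (rule \<open>\<And>p q. \<lbrakk>h (ccD p) = ccM (\<theta> p); h (ccD q) = ccM (\<theta> q)\<rbrakk> \<Longrightarrow> _\<close>)
  next
    case (mult p q)
    then show ?case
      using ring_hom_mult[OF hom, of "ccD p" "ccD q"] by (simp add: cc_mult \<theta>_simps)
  qed
qed

text \<open>Existence by choosing representatives, which \<open>\<theta>_ideal\<close> permits;
  uniqueness by \<open>is_theta_eq\<close>. From here on \<open>theta\<close> is computed by
  substitution.\<close>

lemma theta_eq: "theta E L i (ccD p) = ccM (\<theta> p)"
proof -
  define h where "h = restrict (\<lambda>\<eta>. ccM (\<theta> (SOME p. \<eta> = ccD p))) (carrier (CH E' L'))"
  have h: "h (ccD p) = ccM (\<theta> p)" for p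
  proof -
    have "ccD p = ccD (SOME q. ccD p = ccD q)" by (rule someI) (rule refl)
    then have "p - (SOME q. ccD p = ccD q) \<in> ID" by (simp add: cc_eq_iff)
    then have "\<theta> p - \<theta> (SOME q. ccD p = ccD q) \<in> IM" using \<theta>_ideal by (fastforce simp: \<theta>_simps)
    then show ?thesis by (simp add: h_def cc_eq_iff idl_cong_sym)
  qed
  have "is_theta E L i h"
    unfolding is_theta_def Let_def
  proof (intro conjI allI ballI)
    show "h \<in> ring_hom (CH E' L') (CH E L)"
      by (rule ring_hom_memI) (auto simp: carrier_CH cc_add cc_mult cc_one h \<theta>_simps)
    show "h \<in> extensional (carrier (CH E' L'))" by (simp add: h_def)
    show "h (chow_const E' L' c) = chow_const E L c" for c
      by (simp add: chow_const_eq h \<theta>_simps)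
    show "h ` CH_deg E' L' k \<subseteq> CH_deg E L k" for k
      using \<theta>_homogeneous by (auto simp: CH_deg_eq h)
    fix F assume F: "F \<in> proper_flats E' L'"
    then have "F \<noteq> E" "insert i F \<noteq> E"
      using D.flat_subset by (auto simp: proper_flats_def mem_deletion_iff)
    then show "h (chow_x E' L' F) = chow_x E L F \<oplus>\<^bsub>CH E L\<^esub> chow_x E L (insert i F)"
      using F by (simp add: chow_x_eq[of E' L'] M.chow_x_xf cc_add h \<theta>_simps theta_var_def)
  qed
  moreover have "h' = h" if h': "is_theta E L i h'" for h'
  proof (rule extensionalityI[of _ "carrier (CH E' L')"])
    show "h' \<in> extensional (carrier (CH E' L'))" using h' by (simp add: is_theta_def Let_def)
    show "h' \<eta> = h \<eta>" if "\<eta> \<in> carrier (CH E' L')" for \<eta>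
      using that is_theta_eq[OF h'] h by (auto simp: carrier_CH)
  qed (simp add: h_def)
  ultimately have "theta E L i = h" unfolding theta_def by (rule the_equality)
  then show ?thesis using h by simp
qed

lemma CH_image_eq: "CH_image E L i = range (\<lambda>a. ccM (\<theta> a))"
  by (auto simp: CH_image_def carrier_CH theta_eq image_def)

end

section \<open>The summands\<close>

lemma homogeneous_poly_0_const: "homogeneous_poly 0 p \<Longrightarrow> \<exists>c. p = poly_const c"
proof -
  assume p: "homogeneous_poly 0 p"
  have "m = 0" if "m \<in> Poly_Mapping.keys p" for m
  proof -
    have "mono_deg m = 0" using p that by (simp add: homogeneous_poly_def)
    then have "Poly_Mapping.lookup m v = 0" for v by (auto simp: mono_deg_def in_keys_iff)
    then show ?thesis by (intro poly_mapping_eqI) simp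
  qed
  then have "Poly_Mapping.keys p \<subseteq> {0}" by blast
  then have "p = poly_const (Poly_Mapping.lookup p 0)"
    by (intro poly_mapping_eqI) (auto simp: poly_const_def lookup_single in_keys_iff when_def)
  then show ?thesis by blast
qed

lemma hcomp_mult_low:
  assumes "homogeneous_poly l q" "k < l"
  shows "hcomp k (q * p) = 0"
proof (induction p rule: poly_mapping_induct_single)
  case (single m c)
  have "homogeneous_poly (mono_deg m) (Poly_Mapping.single m c)"
    by (simp add: homogeneous_poly_def)
  from homogeneous_poly_mult[OF assms(1) this] show ?case
    using assms(2) by (simp add: hcomp_homogeneous)
qed (simp_all add: hcomp_add distrib_left)

text \<open>Generators of positive degree have constant term zero, and so has everything they
  generate.\<close>

lemma one_not_in_ideal:
  fixes S :: "'a chow_poly set"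
  assumes "\<And>g. g \<in> S \<Longrightarrow> \<exists>k>0. homogeneous_poly k g"
  shows "1 \<notin> idl S"
proof
  assume "1 \<in> idl S"
  have zero: "hcomp 0 p = 0" if "p \<in> idl S" for p
    using that
  proof induction
    case (idl_gen g)
    then obtain k where "0 < k" "homogeneous_poly k g" using assms by blast
    then show ?case by (simp add: hcomp_homogeneous)
  next
    case (idl_mult p r)
    have "coeff (grade r * grade p) 0 = coeff (grade r) 0 * coeff (grade p) 0" by (simp add: coeff_mult)
    then show ?case using idl_mult by (simp add: hcomp_def grade_simps)
  qed (simp_all add: hcomp_add)
  have "hcomp 0 1 = (1 :: 'a chow_poly)" by (simp add: hcomp_homogeneous[OF homogeneous_poly_1])
  then show False using zero[OF \<open>1 \<in> idl S\<close>] by simp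
qed

context matroid_deletion
begin

definition summand_gen :: "'a summand_label \<Rightarrow> 'a chow_poly" where
  "summand_gen s = (case s of Image_Summand \<Rightarrow> 1 | Coloop_Summand \<Rightarrow> M.xf E' | Flat_Summand F \<Rightarrow> e F)"

lemma summand_eq:
  assumes "\<And>F. s = Flat_Summand F \<Longrightarrow> F \<in> special_flats E L i"
  shows "summand E L i s = range (\<lambda>a. ccM (summand_gen s * \<theta> a))"
proof (cases s)
  case Image_Summand
  then show ?thesis by (simp add: CH_image_eq summand_gen_def)
next
  case Coloop_Summand
  have "E' \<noteq> E" using i_in by blast
  then show ?thesis using Coloop_Summand
    by (auto simp: CH_image_eq summand_gen_def M.chow_x_xf l_coset_def cc_mult)
next
  case (Flat_Summand F)
  then have "insert i F \<noteq> E" using assms by (auto simp: special_flats_def)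
  then show ?thesis using Flat_Summand
    by (auto simp: CH_image_eq summand_gen_def M.chow_x_xf l_coset_def cc_mult)
qed

lemma summand_gen_homogeneous: "homogeneous_poly (case s of Image_Summand \<Rightarrow> 0 | _ \<Rightarrow> Suc 0) (summand_gen s)"
  by (cases s) (simp_all add: summand_gen_def M.xf_homogeneous)

lemma CH_module_simps:
  "carrier (CH_module E L i) = carrier (CH E L)" "ring.add (CH_module E L i) = ring.add (CH E L)"
  "ring.zero (CH_module E L i) = ring.zero (CH E L)"
  "module.smult (CH_module E L i) = (\<lambda>\<alpha> \<eta>. theta E L i \<alpha> \<otimes>\<^bsub>CH E L\<^esub> \<eta>)"
  by (simp_all add: CH_module_def ring.extend_def)

lemma subgroup_CH_module:
  "subgroup N (add_monoid (CH_module E L i)) \<longleftrightarrow> subgroup N (add_monoid (CH E L))"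
  by (simp add: subgroup_def m_inv_def CH_module_simps)

section \<open>Indecomposability of a cyclic graded module\<close>

context
  fixes g :: "'a chow_poly" and c :: nat
  assumes g: "homogeneous_poly c g" and g_ne: "g \<notin> IM"
begin

interpretation QM: cring "CH E L" by (rule CH_cring)
interpretation QD: cring "CH E' L'" by (rule CH_cring)

abbreviation "cyclic \<equiv> range (\<lambda>a. ccM (g * \<theta> a))"

lemma hcomp_cyclic: "\<exists>b. hcomp k (g * \<theta> a) = g * \<theta> b"
proof (cases "c \<le> k")
  case True
  then have "hcomp k (g * \<theta> a) = g * \<theta> (hcomp (k - c) a)"
    using hcomp_mult_homogeneous[OF g, of "k - c" "\<theta> a"] by (simp add: hcomp_\<theta>)
  then show ?thesis by blast
next
  case False
  then have "hcomp k (g * \<theta> a) = g * \<theta> 0" using hcomp_mult_low[OF g] by (simp add: \<theta>_simps)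
  then show ?thesis by blast
qed

lemma cyclic_graded_submodule: "graded_submodule E L i cyclic"
  unfolding graded_submodule_def
proof (intro conjI ballI)
  show "submodule cyclic (CH E' L') (CH_module E L i)"
  proof (intro submodule.intro submodule_axioms.intro)
    show "subgroup cyclic (add_monoid (CH_module E L i))"
      unfolding subgroup_CH_module
    proof (rule QM.add.subgroupI)
      fix \<eta> assume "\<eta> \<in> cyclic"
      then obtain a where a: "\<eta> = ccM (g * \<theta> a)" by blast
      have "\<ominus>\<^bsub>CH E L\<^esub> \<eta> = ccM (g * \<theta> (- a))"
        unfolding a by (intro QM.minus_equality) (simp_all add: cc_add cc_zero \<theta>_simps)
      then show "\<ominus>\<^bsub>CH E L\<^esub> \<eta> \<in> cyclic" by blast
    next
      fix \<eta> \<xi> assume "\<eta> \<in> cyclic" "\<xi> \<in> cyclic"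
      then obtain a b where ab: "\<eta> = ccM (g * \<theta> a)" "\<xi> = ccM (g * \<theta> b)" by blast
      have "\<eta> \<oplus>\<^bsub>CH E L\<^esub> \<xi> = ccM (g * \<theta> (a + b))"
        by (simp add: ab cc_add \<theta>_simps distrib_left)
      then show "\<eta> \<oplus>\<^bsub>CH E L\<^esub> \<xi> \<in> cyclic" by blast
    qed auto
    fix \<alpha> \<eta> assume "\<alpha> \<in> carrier (CH E' L')" "\<eta> \<in> cyclic"
    then obtain a b where ab: "\<alpha> = ccD a" "\<eta> = ccM (g * \<theta> b)" by (auto simp: carrier_CH)
    have "theta E L i \<alpha> \<otimes>\<^bsub>CH E L\<^esub> \<eta> = ccM (g * \<theta> (a * b))"
      by (simp add: ab theta_eq cc_mult \<theta>_simps mult.left_commute)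
    then show "\<alpha> \<odot>\<^bsub>CH_module E L i\<^esub> \<eta> \<in> cyclic" unfolding CH_module_simps by blast
  qed
  fix \<eta> assume "\<eta> \<in> cyclic"
  then obtain a where a: "\<eta> = ccM (g * \<theta> a)" by blast
  obtain n where "g * \<theta> a = (\<Sum>k\<le>n. hcomp k (g * \<theta> a))" using hcomp_sum_bound by blast
  then have "\<eta> = (\<Oplus>\<^bsub>CH E L\<^esub>k\<in>{..n}. ccM (hcomp k (g * \<theta> a)))"
    unfolding a by (simp add: cc_finsum)
  moreover have "ccM (hcomp k (g * \<theta> a)) \<in> cyclic \<inter> CH_deg E L k" for k
    using hcomp_cyclic[of k a] by (auto simp: CH_deg_eq)
  ultimately show "\<exists>n h. (\<forall>k\<le>n. h k \<in> cyclic \<inter> CH_deg E L k) \<and> \<eta> = (\<Oplus>\<^bsub>CH E L\<^esub>k\<in>{..n::nat}. h k)"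
    by (intro exI[of _ n] exI[of _ "\<lambda>k. ccM (hcomp k (g * \<theta> a))"]) blast
qed

text \<open>Components of a class are well defined because the Chow ideal is homogeneous, so the
  decomposition granted by the grading must be the one by \<open>hcomp\<close>; degrees beyond
  \<open>n\<close> give zero.\<close>

lemma graded_submodule_component:
  assumes A: "graded_submodule E L i A" and p: "ccM p \<in> A"
  shows "ccM (hcomp k p) \<in> A"
proof -
  obtain n h where h: "\<And>k. k \<le> n \<Longrightarrow> h k \<in> A \<inter> CH_deg E L k" "ccM p = (\<Oplus>\<^bsub>CH E L\<^esub>k\<in>{..n::nat}. h k)"
    using A p unfolding graded_submodule_def by blast
  have "\<exists>q. homogeneous_poly k q \<and> h k = ccM q" if "k \<le> n" for k
    using h(1)[OF that] by (auto simp: CH_deg_eq)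
  then obtain q where q: "\<And>k. k \<le> n \<Longrightarrow> homogeneous_poly k (q k) \<and> h k = ccM (q k)" by metis
  have "(\<Oplus>\<^bsub>CH E L\<^esub>k\<in>{..n}. h k) = (\<Oplus>\<^bsub>CH E L\<^esub>k\<in>{..n}. ccM (q k))"
    using q by (intro QM.finsum_cong') auto
  then have "p - (\<Sum>k\<le>n. q k) \<in> IM" using h(2) by (simp add: cc_finsum cc_eq_iff)
  then have "hcomp k (p - (\<Sum>k\<le>n. q k)) \<in> IM" by (rule hcomp_chow_ideal)
  moreover have "hcomp k (\<Sum>k\<le>n. q k) = (\<Sum>l\<le>n. if k = l then q l else 0)"
    unfolding hcomp_sum using q by (intro sum.cong) (auto simp: hcomp_homogeneous)
  ultimately have eq: "ccM (hcomp k p) = ccM (if k \<le> n then q k else 0)"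
    by (simp add: hcomp_diff cc_eq_iff)
  show ?thesis
  proof (cases "k \<le> n")
    case True
    then show ?thesis using eq h(1)[OF True] q[OF True] by simp
  next
    case False
    have "\<zero>\<^bsub>CH E L\<^esub> \<in> A"
      using subgroup.one_closed[of A "add_monoid (CH E L)"] A submodule.axioms(1)
      unfolding graded_submodule_def by (fastforce simp: subgroup_CH_module)
    then show ?thesis using eq False by (simp add: cc_zero)
  qed
qed

lemma submodule_mult: "graded_submodule E L i A \<Longrightarrow> ccM p \<in> A \<Longrightarrow> ccM (\<theta> a * p) \<in> A"
  using submodule.smult_closed[of A "CH E' L'" "CH_module E L i" "ccD a" "ccM p"]
  by (simp add: graded_submodule_def CH_module_simps theta_eq cc_mult)

text \<open>The module is cyclic and its component in the degree of the generator is one-dimensional,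
  so one of two complementary graded submodules contains the generator.\<close>

lemma cyclic_indecomposable: "indecomposable_graded_submodule E L i cyclic"
  unfolding indecomposable_graded_submodule_def
proof (intro conjI allI impI)
  show "graded_submodule E L i cyclic" by (rule cyclic_graded_submodule)
  have "ccM (g * \<theta> 1) \<noteq> \<zero>\<^bsub>CH E L\<^esub>" using g_ne by (simp add: cc_eq_zero_iff \<theta>_simps)
  then show "cyclic \<noteq> {\<zero>\<^bsub>CH E L\<^esub>}" by blast
  fix A B assume A: "graded_submodule E L i A" and B: "graded_submodule E L i B"
    and AB: "A <+>\<^bsub>CH E L\<^esub> B = cyclic" "A \<inter> B = {\<zero>\<^bsub>CH E L\<^esub>}"
  have sub: "S \<subseteq> carrier (CH E L)" "\<zero>\<^bsub>CH E L\<^esub> \<in> S" if "graded_submodule E L i S" for S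
  proof -
    have "subgroup S (add_monoid (CH E L))"
      using that submodule.axioms(1) unfolding graded_submodule_def subgroup_CH_module[symmetric] by blast
    then show "S \<subseteq> carrier (CH E L)" "\<zero>\<^bsub>CH E L\<^esub> \<in> S"
      using subgroup.subset[of S "add_monoid (CH E L)"] subgroup.one_closed[of S "add_monoid (CH E L)"] by simp_all
  qed
  have mem: "\<alpha> \<oplus>\<^bsub>CH E L\<^esub> \<beta> \<in> cyclic" if "\<alpha> \<in> A" "\<beta> \<in> B" for \<alpha> \<beta>
    unfolding AB(1)[symmetric] set_add_def' using that by blast
  have AN: "A \<subseteq> cyclic"
  proof
    fix \<alpha> assume "\<alpha> \<in> A"
    then have "\<alpha> \<oplus>\<^bsub>CH E L\<^esub> \<zero>\<^bsub>CH E L\<^esub> = \<alpha>" using sub(1)[OF A] by (intro QM.r_zero) blast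
    then show "\<alpha> \<in> cyclic" using mem[OF \<open>\<alpha> \<in> A\<close> sub(2)[OF B]] by simp
  qed
  have BN: "B \<subseteq> cyclic"
  proof
    fix \<beta> assume "\<beta> \<in> B"
    then have "\<zero>\<^bsub>CH E L\<^esub> \<oplus>\<^bsub>CH E L\<^esub> \<beta> = \<beta>" using sub(1)[OF B] by (intro QM.l_zero) blast
    then show "\<beta> \<in> cyclic" using mem[OF sub(2)[OF A] \<open>\<beta> \<in> B\<close>] by simp
  qed
  \<comment> \<open>In the degree of \<open>g\<close> the coefficient has degree zero, hence is a
    scalar.\<close>
  have scalar: "\<exists>s. ccM (poly_const s * g) \<in> S \<and> ccM (hcomp c p) = ccM (poly_const s * g)"
    if S: "graded_submodule E L i S" "S \<subseteq> cyclic" "ccM p \<in> S" for S p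
  proof -
    obtain a where "ccM p = ccM (g * \<theta> a)" using S(2,3) by blast
    then have "hcomp c (p - g * \<theta> a) \<in> IM" by (intro hcomp_chow_ideal) (simp add: cc_eq_iff)
    moreover obtain s where "hcomp 0 a = poly_const s"
      using homogeneous_poly_0_const[OF homogeneous_poly_hcomp] by blast
    then have "hcomp c (g * \<theta> a) = poly_const s * g"
      using hcomp_mult_homogeneous[OF g, of 0 "\<theta> a"] by (simp add: hcomp_\<theta> \<theta>_simps mult.commute)
    ultimately have "ccM (hcomp c p) = ccM (poly_const s * g)"
      by (simp add: hcomp_diff cc_eq_iff)
    then show ?thesis using graded_submodule_component[OF S(1,3), of c] by auto
  qed
  have full: "cyclic \<subseteq> S" if S: "graded_submodule E L i S" "ccM (poly_const s * g) \<in> S" "s \<noteq> 0" for S s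
  proof
    fix \<eta> assume "\<eta> \<in> cyclic"
    then obtain a where a: "\<eta> = ccM (g * \<theta> a)" by blast
    have "\<theta> (poly_const (1 / s) * a) * (poly_const s * g) = (poly_const (1 / s) * poly_const s) * (g * \<theta> a)"
      by (simp add: \<theta>_simps mult_ac)
    also have "\<dots> = g * \<theta> a" using S(3) by (simp flip: poly_const_mult)
    finally show "\<eta> \<in> S" using submodule_mult[OF S(1,2), of "poly_const (1 / s) * a"] a by simp
  qed
  have "ccM (g * \<theta> 1) \<in> A <+>\<^bsub>CH E L\<^esub> B" unfolding AB(1) by blast
  then obtain \<alpha> \<beta> where \<alpha>\<beta>: "\<alpha> \<in> A" "\<beta> \<in> B" "ccM (g * \<theta> 1) = \<alpha> \<oplus>\<^bsub>CH E L\<^esub> \<beta>"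
    unfolding set_add_def' by blast
  obtain p q where pq: "\<alpha> = ccM p" "\<beta> = ccM q"
    using sub(1)[OF A] sub(1)[OF B] \<alpha>\<beta>(1,2) unfolding carrier_CH by blast
  obtain s where s: "ccM (poly_const s * g) \<in> A" "ccM (hcomp c p) = ccM (poly_const s * g)"
    using scalar[OF A AN, of p] \<alpha>\<beta>(1) pq by blast
  obtain t where t: "ccM (poly_const t * g) \<in> B" "ccM (hcomp c q) = ccM (poly_const t * g)"
    using scalar[OF B BN, of q] \<alpha>\<beta>(2) pq by blast
  have "g - (p + q) \<in> IM" using \<alpha>\<beta>(3) by (simp add: pq cc_add cc_eq_iff \<theta>_simps)
  then have "hcomp c (g - (p + q)) \<in> IM" by (rule hcomp_chow_ideal)
  then have "g - (hcomp c p + hcomp c q) \<in> IM"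
    using g by (simp add: hcomp_diff hcomp_add hcomp_homogeneous)
  moreover have "(hcomp c p + hcomp c q) - (poly_const s * g + poly_const t * g) \<in> IM"
    using s(2) t(2) by (intro idl_cong_add) (simp_all add: cc_eq_iff)
  ultimately have "g - (poly_const s * g + poly_const t * g) \<in> IM" by (rule idl_cong_trans)
  \<comment> \<open>If both scalars vanished, \<open>g\<close> would lie in the ideal. A nonzero
    scalar puts the generator into one submodule, which then contains the other, while their
    intersection is zero.\<close>
  then have "s \<noteq> 0 \<or> t \<noteq> 0" using g_ne by auto
  then have "B \<subseteq> A \<or> A \<subseteq> B" using full[OF A s(1)] full[OF B t(1)] AN BN by (meson subset_trans)
  then show "A = {\<zero>\<^bsub>CH E L\<^esub>} \<or> B = {\<zero>\<^bsub>CH E L\<^esub>}"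
    using AB(2) by (metis inf.absorb1 inf.absorb2)
qed

end

lemma comp_gens_homogeneous:
  assumes "g \<in> comp_gens F \<union> chow_gens E' L'"
  shows "\<exists>k>0. homogeneous_poly k g"
proof (cases "g \<in> chow_gens E' L'")
  case False
  then have "g \<in> comp_gens F" "g \<notin> chow_core_gens E' L'" using assms by (auto simp: chow_gens_def)
  then have "homogeneous_poly (Suc 0) g"
    by (cases rule: comp_gens_cases) (auto simp: D.xf_homogeneous)
  then show ?thesis by blast
qed (rule chow_gens_homogeneous)

lemma one_not_in_comp_ideal: "1 \<notin> comp_ideal F" "1 \<notin> ID"
proof -
  show "1 \<notin> comp_ideal F"
    unfolding comp_ideal_def by (rule one_not_in_ideal) (rule comp_gens_homogeneous)
  then show "1 \<notin> ID" using comp_ideal_D by blast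
qed

section \<open>The direct sum decomposition\<close>

definition labels :: "'a summand_label set" where
  "labels = (if E' \<in> L then {Image_Summand, Coloop_Summand} else {Image_Summand}) \<union>
     Flat_Summand ` special_flats E L i"

lemma finite_labels: "finite labels"
  using finite_both_flats by (simp add: labels_def special_flats_eq)

lemma summand_labels: "s \<in> labels \<Longrightarrow> summand E L i s = range (\<lambda>a. ccM (summand_gen s * \<theta> a))"
  by (rule summand_eq) (auto simp: labels_def split: if_splits)

definition label_sum :: "('a summand_label \<Rightarrow> 'a chow_poly) \<Rightarrow> 'a chow_poly" where
  "label_sum a = (\<Sum>s\<in>labels. summand_gen s * \<theta> (a s))"

text \<open>If \<open>i\<close> is a coloop, \<open>x\<^bsub>E - i\<^esub> = \<theta> x\<^bsub>E - i\<^esub> - e\<^bsub>E - i\<^esub>\<close> trades the coloop summand for \<open>e\<^bsub>E - i\<^esub>\<close>.\<close>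

lemma label_sum_eq:
  "label_sum a = (if E' \<in> L
     then module_form (a Image_Summand + D.xf E' * a Coloop_Summand)
       (\<lambda>F. if F = E' then - a Coloop_Summand else a (Flat_Summand F))
     else module_form (a Image_Summand) (\<lambda>F. a (Flat_Summand F)))"
proof -
  let ?S = "\<Sum>F\<in>special_flats E L i. e F * \<theta> (a (Flat_Summand F))"
  have fin: "finite (special_flats E L i)" using finite_both_flats by (simp add: special_flats_eq)
  have flats: "(\<Sum>s\<in>Flat_Summand ` special_flats E L i. summand_gen s * \<theta> (a s)) = ?S"
    by (subst sum.reindex) (auto simp: inj_on_def summand_gen_def)
  show ?thesis
  proof (cases "E' \<in> L")
    case True
    have notin: "Coloop_Summand \<notin> Flat_Summand ` special_flats E L i"
      "Image_Summand \<notin> insert Coloop_Summand (Flat_Summand ` special_flats E L i)" by auto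
    have l: "labels = insert Image_Summand (insert Coloop_Summand (Flat_Summand ` special_flats E L i))"
      using True by (auto simp: labels_def)
    have "label_sum a = \<theta> (a Image_Summand) + (M.xf E' * \<theta> (a Coloop_Summand) + ?S)"
      unfolding label_sum_def l using notin fin
      by (simp add: flats summand_gen_def[of Image_Summand] summand_gen_def[of Coloop_Summand])
    moreover have "both_flats = insert E' (special_flats E L i)" "E' \<notin> special_flats E L i"
      using True both_flats_ground by (auto simp: special_flats_eq)
    then have "(\<Sum>F\<in>both_flats. e F * \<theta> (if F = E' then - a Coloop_Summand else a (Flat_Summand F))) =
        e E' * \<theta> (- a Coloop_Summand) +
        (\<Sum>F\<in>special_flats E L i. e F * \<theta> (if F = E' then - a Coloop_Summand else a (Flat_Summand F)))"
      using fin by simp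
    moreover have "(\<Sum>F\<in>special_flats E L i. e F * \<theta> (if F = E' then - a Coloop_Summand else a (Flat_Summand F))) = ?S"
      by (intro sum.cong) (auto simp: special_flats_eq)
    moreover have "\<theta> (D.xf E') = M.xf E' + e E'" by (rule \<theta>_xf) (rule D.ground_flat)
    ultimately show ?thesis
      using True by (simp add: module_form_def \<theta>_simps algebra_simps)
  next
    case False
    have notin: "Image_Summand \<notin> Flat_Summand ` special_flats E L i" by auto
    have "both_flats = special_flats E L i" using False both_flats_ground by (auto simp: special_flats_eq)
    moreover have "labels = insert Image_Summand (Flat_Summand ` special_flats E L i)"
      using False by (simp add: labels_def)
    ultimately show ?thesis
      using False notin fin
      by (simp add: label_sum_def module_form_def flats summand_gen_def[of Image_Summand])
  qed
qed

lemma ex_label_sum: "\<exists>a. p - label_sum a \<in> IM"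
proof -
  obtain a b where ab: "p - module_form a b \<in> IM" using ex_module_form by blast
  \<comment> \<open>The inverse of the triangular change of coordinates in
    \<open>label_sum_eq\<close>.\<close>
  define h where "h s = (case s of
      Image_Summand \<Rightarrow> if E' \<in> L then a + D.xf E' * b E' else a
    | Coloop_Summand \<Rightarrow> - b E' | Flat_Summand F \<Rightarrow> b F)" for s
  have "(\<lambda>F. if F = E' then - h Coloop_Summand else h (Flat_Summand F)) = b"
    "(\<lambda>F. h (Flat_Summand F)) = b"
    by (auto simp: h_def)
  then have "label_sum h = module_form a b" unfolding label_sum_eq by (simp add: h_def)
  then show ?thesis using ab by metis
qed

text \<open>For a coloop the coefficient of the coloop summand is read off at \<open>e E'\<close>
  first, and the image coefficient follows by subtracting its multiple; the other coefficients lie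
  in annihilators.\<close>

lemma label_sum_independent:
  assumes "label_sum a \<in> IM" "s \<in> labels"
  shows "summand_gen s * \<theta> (a s) \<in> IM"
proof (cases "E' \<in> L")
  case True
  note u = module_form_unique[OF assms(1)[unfolded label_sum_eq if_P[OF True]]]
  have co: "a Coloop_Summand \<in> ID"
    using u(2)[of E'] True both_flats_ground comp_ideal_ground idl_uminus[of "- a Coloop_Summand"] by simp
  then have im: "a Image_Summand \<in> ID"
    using idl_diff[OF u(1) idl_mult[OF co, of "D.xf E'"]] by simp
  show ?thesis
  proof (cases s)
    case (Flat_Summand F)
    then have "F \<in> both_flats" "F \<noteq> E'" using assms(2) by (auto simp: labels_def special_flats_eq True)
    then show ?thesis using u(2)[of F] comp_ideal_annihilates Flat_Summand by (simp add: summand_gen_def)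
  qed (use co im \<theta>_ideal idl_mult in \<open>auto simp: summand_gen_def\<close>)
next
  case False
  note u = module_form_unique[OF assms(1)[unfolded label_sum_eq if_not_P[OF False]]]
  show ?thesis
  proof (cases s)
    case (Flat_Summand F)
    then have "F \<in> both_flats" using assms(2) by (auto simp: labels_def special_flats_eq False)
    then show ?thesis using u(2)[of F] comp_ideal_annihilates Flat_Summand by (simp add: summand_gen_def)
  next
    case Coloop_Summand
    then show ?thesis using assms(2) False by (auto simp: labels_def)
  qed (use u(1) \<theta>_ideal in \<open>simp add: summand_gen_def\<close>)
qed

text \<open>A vanishing generator would be a relation with coefficient 1, or -1 at
  \<open>e E'\<close>, but the annihilators are generated in positive degree.\<close>

lemma summand_gen_nonzero:
  assumes "s \<in> labels"
  shows "summand_gen s \<notin> IM"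
proof
  assume gen: "summand_gen s \<in> IM"
  have "label_sum (\<lambda>t. if t = s then 1 else 0) = (\<Sum>t\<in>labels. if t = s then summand_gen t else 0)"
    unfolding label_sum_def by (intro sum.cong) (auto simp: \<theta>_simps)
  then have in_IM: "label_sum (\<lambda>t. if t = s then 1 else 0) \<in> IM"
    using assms finite_labels gen by simp
  show False
  proof (cases "E' \<in> L")
    case True
    note u = module_form_unique[OF in_IM[unfolded label_sum_eq if_P[OF True]]]
    show False
    proof (cases s)
      case Image_Summand
      then show False using u(1) one_not_in_comp_ideal by simp
    next
      case Coloop_Summand
      then have "- 1 \<in> ID" using u(2)[of E'] True both_flats_ground comp_ideal_ground by simp
      then show False using idl_uminus[of "- 1"] one_not_in_comp_ideal by fastforce
    next
      case (Flat_Summand F)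
      then have "F \<in> both_flats" "F \<noteq> E'" using assms by (auto simp: labels_def special_flats_eq True)
      then show False using u(2)[of F] Flat_Summand one_not_in_comp_ideal by simp
    qed
  next
    case False
    note u = module_form_unique[OF in_IM[unfolded label_sum_eq if_not_P[OF False]]]
    show False
    proof (cases s)
      case Image_Summand
      then show False using u(1) one_not_in_comp_ideal by simp
    next
      case Coloop_Summand
      then show False using assms False by (auto simp: labels_def)
    next
      case (Flat_Summand F)
      then have "F \<in> both_flats" using assms by (auto simp: labels_def special_flats_eq False)
      then show False using u(2)[of F] Flat_Summand one_not_in_comp_ideal by simp
    qed
  qed
qed

lemma label_sum_diff: "label_sum a - label_sum b = label_sum (\<lambda>s. a s - b s)"
  by (simp add: label_sum_def \<theta>_simps right_diff_distrib sum_subtractf)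

lemma summands_direct: "internal_direct_sum (CH E L) (carrier (CH E L)) labels (summand E L i)"
  unfolding internal_direct_sum_def
proof (intro conjI ballI)
  interpret QM: cring "CH E L" by (rule CH_cring)
  show "finite labels" by (rule finite_labels)
  show "summand E L i s \<subseteq> carrier (CH E L)" if "s \<in> labels" for s
    using that by (auto simp: summand_labels)
  have total: "(\<Oplus>\<^bsub>CH E L\<^esub>s\<in>labels. h s) = ccM (label_sum a)"
    if "\<And>s. s \<in> labels \<Longrightarrow> h s = ccM (summand_gen s * \<theta> (a s))" for h a
  proof -
    have "(\<Oplus>\<^bsub>CH E L\<^esub>s\<in>labels. h s) = (\<Oplus>\<^bsub>CH E L\<^esub>s\<in>labels. ccM (summand_gen s * \<theta> (a s)))"
      using that by (intro QM.finsum_cong') auto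
    then show ?thesis by (simp add: cc_finsum label_sum_def)
  qed
  fix \<eta> assume "\<eta> \<in> carrier (CH E L)"
  then obtain p where p: "\<eta> = ccM p" by (auto simp: carrier_CH)
  obtain a where a: "p - label_sum a \<in> IM" using ex_label_sum by blast
  define h where "h = restrict (\<lambda>s. ccM (summand_gen s * \<theta> (a s))) labels"
  show "\<exists>!h. h \<in> (\<Pi>\<^sub>E s\<in>labels. summand E L i s) \<and> \<eta> = (\<Oplus>\<^bsub>CH E L\<^esub>s\<in>labels. h s)"
  proof (rule ex1I[of _ h])
    have "h \<in> (\<Pi>\<^sub>E s\<in>labels. summand E L i s)"
      by (auto simp: h_def summand_labels)
    moreover have "\<eta> = (\<Oplus>\<^bsub>CH E L\<^esub>s\<in>labels. h s)"
      using total[of h a] a p by (simp add: h_def cc_eq_iff)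
    ultimately show "h \<in> (\<Pi>\<^sub>E s\<in>labels. summand E L i s) \<and> \<eta> = (\<Oplus>\<^bsub>CH E L\<^esub>s\<in>labels. h s)" ..
    fix h' assume h': "h' \<in> (\<Pi>\<^sub>E s\<in>labels. summand E L i s) \<and> \<eta> = (\<Oplus>\<^bsub>CH E L\<^esub>s\<in>labels. h' s)"
    then have "\<exists>b. h' s = ccM (summand_gen s * \<theta> b)" if "s \<in> labels" for s
      using PiE_mem[of h' labels "summand E L i" s] that summand_labels[OF that] by auto
    then obtain b where b: "\<And>s. s \<in> labels \<Longrightarrow> h' s = ccM (summand_gen s * \<theta> (b s))" by metis
    have "p - label_sum b \<in> IM" using total[OF b] h' p by (simp add: cc_eq_iff)
    then have "(p - label_sum b) - (p - label_sum a) \<in> IM" using a by (rule idl_diff)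
    then have "label_sum (\<lambda>s. a s - b s) \<in> IM" by (simp flip: label_sum_diff)
    then have "summand_gen s * \<theta> (a s - b s) \<in> IM" if "s \<in> labels" for s
      using label_sum_independent that by blast
    then have eq: "ccM (summand_gen s * \<theta> (a s)) = ccM (summand_gen s * \<theta> (b s))" if "s \<in> labels" for s
      using that by (simp add: cc_eq_iff \<theta>_simps right_diff_distrib)
    show "h' = h"
    proof (rule PiE_ext[of _ labels "summand E L i"])
      show "h' \<in> (\<Pi>\<^sub>E s\<in>labels. summand E L i s)" using h' by blast
      show "h \<in> (\<Pi>\<^sub>E s\<in>labels. summand E L i s)" by fact
      show "h' s = h s" if "s \<in> labels" for s using b[OF that] eq[OF that] that by (simp add: h_def)
    qed
  qed
qed

lemma summands_indecomposable:
  assumes "s \<in> labels"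
  shows "indecomposable_graded_submodule E L i (summand E L i s)"
proof -
  from cyclic_indecomposable[OF summand_gen_homogeneous summand_gen_nonzero[OF assms]] show ?thesis
    using summand_labels[OF assms] by simp
qed

text \<open>Products from the two summands are zero or multiples of some \<open>e F\<close> with
  \<open>F\<close> special. Of such a multiple only the top-degree part matters; its coefficient has
  degree one below the rank, where \<open>e_vanishing\<close> applies.\<close>

lemma orthogonalI:
  assumes s: "s \<in> labels" and t: "t \<in> labels"
    and st: "summand_gen s * summand_gen t \<in> IM \<or>
      (\<exists>F\<in>special_flats E L i. \<exists>b. summand_gen s * summand_gen t - e F * \<theta> b \<in> IM)"
  shows "poincare_orthogonal E L (summand E L i s) (summand E L i t)"
  unfolding poincare_orthogonal_def
proof (intro allI impI ballI)
  fix k \<eta> \<xi> assume k: "k \<le> matroid_rank E L" and \<eta>: "\<eta> \<in> summand E L i s \<inter> CH_deg E L k"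
    and \<xi>: "\<xi> \<in> summand E L i t \<inter> CH_deg E L (matroid_rank E L - k)"
  obtain a b where ab: "\<eta> = ccM (summand_gen s * \<theta> a)" "\<xi> = ccM (summand_gen t * \<theta> b)"
    using \<eta> \<xi> summand_labels s t by auto
  obtain p q where pq: "\<eta> = ccM p" "homogeneous_poly k p"
      "\<xi> = ccM q" "homogeneous_poly (matroid_rank E L - k) q"
    using \<eta> \<xi> by (auto simp: CH_deg_eq)
  have "p * q - (summand_gen s * \<theta> a) * (summand_gen t * \<theta> b) \<in> IM"
    using ab pq by (intro idl_cong_mult) (simp_all flip: cc_eq_iff)
  then have 1: "p * q - \<theta> (a * b) * (summand_gen s * summand_gen t) \<in> IM"
    by (simp add: \<theta>_simps mult_ac)
  have "p * q \<in> IM"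
    using st
  proof
    assume "summand_gen s * summand_gen t \<in> IM"
    then show "p * q \<in> IM" using idl_cong_mem[OF 1] idl_mult by blast
  next
    assume "\<exists>F\<in>special_flats E L i. \<exists>b. summand_gen s * summand_gen t - e F * \<theta> b \<in> IM"
    then obtain F r where F: "F \<in> special_flats E L i" "summand_gen s * summand_gen t - e F * \<theta> r \<in> IM"
      by blast
    have Fb: "F \<in> both_flats" "F \<noteq> E'" using F(1) by (auto simp: special_flats_eq)
    have "\<theta> (a * b) * (summand_gen s * summand_gen t - e F * \<theta> r) \<in> IM" using F(2) by (rule idl_mult)
    then have "\<theta> (a * b) * (summand_gen s * summand_gen t) - e F * \<theta> (a * b * r) \<in> IM"
      by (simp add: \<theta>_simps right_diff_distrib mult_ac)
    with 1 have pqF: "p * q - e F * \<theta> (a * b * r) \<in> IM" by (rule idl_cong_trans)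
    obtain d where d: "M.corank {} = Suc d" using rank_pos gr0_implies_Suc by blast
    have "homogeneous_poly (Suc d) (p * q)"
      using homogeneous_poly_mult[OF pq(2,4)] k d by (simp add: M.matroid_rank_eq)
    then have "hcomp (Suc d) (p * q - e F * \<theta> (a * b * r)) = p * q - e F * \<theta> (hcomp d (a * b * r))"
      using hcomp_mult_homogeneous[OF M.xf_homogeneous, of d "insert i F" "\<theta> (a * b * r)"]
      by (simp add: hcomp_diff hcomp_homogeneous hcomp_\<theta>)
    then have "p * q - e F * \<theta> (hcomp d (a * b * r)) \<in> IM" using hcomp_chow_ideal[OF pqF] by metis
    moreover have "e F * \<theta> (hcomp d (a * b * r)) \<in> IM" using d by (intro e_vanishing[OF Fb, of d]) auto
    ultimately show "p * q \<in> IM" by (rule idl_cong_mem)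
  qed
  then have "\<eta> \<otimes>\<^bsub>CH E L\<^esub> \<xi> = ccM 0" by (simp add: pq cc_mult cc_eq_iff)
  then show "degree_map E L (\<eta> \<otimes>\<^bsub>CH E L\<^esub> \<xi>) = 0" using M.degree_map_zero by simp
qed

text \<open>Image times flat gives \<open>e F\<close> itself, coloop times flat is a product of
  incomparable flats, and two flats give zero or the smaller one's \<open>e F\<close> times the
  image. The excluded pair produces \<open>x\<close> at \<open>E'\<close> times the image, which
  contains complete flag monomials.\<close>

lemma summands_orthogonal:
  assumes s: "s \<in> labels" and t: "t \<in> labels" and st: "s \<noteq> t" "{s, t} \<noteq> {Image_Summand, Coloop_Summand}"
  shows "poincare_orthogonal E L (summand E L i s) (summand E L i t)"
proof (rule orthogonalI[OF s t])
  let ?ok = "\<lambda>p. p \<in> IM \<or> (\<exists>F\<in>special_flats E L i. \<exists>b. p - e F * \<theta> b \<in> IM)"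
  have flat: "F \<in> special_flats E L i" if "Flat_Summand F \<in> labels" for F
    using that by (auto simp: labels_def split: if_splits)
  have image: "?ok (e F * 1)" if "F \<in> special_flats E L i" for F
  proof -
    have "e F * 1 - e F * \<theta> 1 \<in> IM" by (simp add: \<theta>_simps idl_0)
    then show ?thesis using that by blast
  qed
  have coloop: "?ok (e F * M.xf E')" if F: "F \<in> special_flats E L i" for F
  proof -
    have "\<not> E' \<subseteq> F" using F by (auto simp: special_flats_def)
    then show ?thesis using e_incomparable[of E' F] by simp
  qed
  have flats: "?ok (e F * e G)"
    if FG: "F \<in> special_flats E L i" "G \<in> special_flats E L i" "F \<noteq> G" for F G
  proof -
    have b: "F \<in> both_flats" "G \<in> both_flats" using FG by (auto simp: special_flats_eq)
    consider "F \<subset> G" | "G \<subset> F" | "\<not> F \<subseteq> G" "\<not> G \<subseteq> F" using FG(3) by blast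
    then show ?thesis
    proof cases
      case 1
      then show ?thesis using e_mult_psubset[OF b] FG by blast
    next
      case 2
      then have "e F * e G - e G * \<theta> (D.xf F) \<in> IM"
        using e_mult_psubset[OF b(2,1)] by (simp add: mult.commute)
      then show ?thesis using FG(2) by blast
    next
      case 3
      then show ?thesis using e_mult_incomparable[OF b] by blast
    qed
  qed
  show "?ok (summand_gen s * summand_gen t)"
  proof (cases s)
    case sI: Image_Summand
    show ?thesis
    proof (cases t)
      case (Flat_Summand F)
      then show ?thesis using sI image[OF flat] t by (simp add: summand_gen_def)
    qed (use sI st in auto)
  next
    case sC: Coloop_Summand
    show ?thesis
    proof (cases t)
      case (Flat_Summand F)
      then show ?thesis using sC coloop[OF flat] t by (simp add: summand_gen_def mult.commute)
    qed (use sC st in auto)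
  next
    case sF: (Flat_Summand F)
    show ?thesis
    proof (cases t)
      case Image_Summand
      then show ?thesis using sF image[OF flat] s by (simp add: summand_gen_def)
    next
      case Coloop_Summand
      then show ?thesis using sF coloop[OF flat] s by (simp add: summand_gen_def)
    next
      case (Flat_Summand G)
      then show ?thesis using sF flats[OF flat flat] s t st by (simp add: summand_gen_def)
    qed
  qed
qed

end

theorem theorem1p2:
  fixes E :: "'a set" and L :: "'a set set" and i :: 'a
  assumes "matroid E L" and "loopless L" and "i \<in> E"
  shows
    "(\<not> coloop E L i \<longrightarrow>
        (let I = insert Image_Summand (Flat_Summand ` special_flats E L i) in
           internal_direct_sum (CH E L) (carrier (CH E L)) I (summand E L i) \<and>
           (\<forall>s\<in>I. indecomposable_graded_submodule E L i (summand E L i s)) \<and>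
           (\<forall>s\<in>I. \<forall>t\<in>I. s \<noteq> t \<longrightarrow>
              poincare_orthogonal E L (summand E L i s) (summand E L i t)))) \<and>
     (coloop E L i \<longrightarrow>
        (let I = {Image_Summand, Coloop_Summand} \<union> Flat_Summand ` special_flats E L i in
           internal_direct_sum (CH E L) (carrier (CH E L)) I (summand E L i) \<and>
           (\<forall>s\<in>I. indecomposable_graded_submodule E L i (summand E L i s)) \<and>
           (\<forall>s\<in>I. \<forall>t\<in>I. s \<noteq> t \<longrightarrow> {s, t} \<noteq> {Image_Summand, Coloop_Summand} \<longrightarrow>
              poincare_orthogonal E L (summand E L i s) (summand E L i t))))"
proof -
  interpret matroid_deletion E L i
    using assms
    by (simp add: matroid_deletion_def matroid_deletion_axioms_def loopless_matroid_def
        loopless_matroid_axioms_def flat_matroid_def)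
  have "labels = (if coloop E L i then {Image_Summand, Coloop_Summand} \<union> Flat_Summand ` special_flats E L i
      else insert Image_Summand (Flat_Summand ` special_flats E L i))"
    by (simp add: labels_def coloop_iff)
  \<comment> \<open>Without a coloop the second label is absent, so the excluded pair does not
    occur.\<close>
  moreover have "{s, t} \<noteq> {Image_Summand, Coloop_Summand}"
    if "\<not> coloop E L i" "s \<in> labels" "t \<in> labels" for s t
    using that by (auto simp: labels_def coloop_iff doubleton_eq_iff)
  ultimately show ?thesis
    unfolding Let_def
    using summands_direct summands_indecomposable summands_orthogonal by auto
qed

end
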